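(* Let $L,k$ be integers with $1\le k<L$ and let $0<\lambda<1$. For each $n\ge L$ let $u^n$ be the tail occupancy process of the $n$-server batch-sampling system described in the context, started from a nonrandom initial state, and let $\mathcal{L}_n$ be the unique invariant distribution of the process $u^n$, regarded as a probability measure on $\bar{\mathcal U}$. Let $\bar u=(\bar u_m)_{m\in\mathbb{N}_0}$ be defined by $\bar u_0=1$, $\bar u_{m+1}=\lambda f(\bar u_m)/k$ for $m\in\mathbb{N}_0$. Then, as $n\to\infty$, $\mathcal{L}_n\Rightarrow\delta_{\bar u}$ (weak convergence of probability measures on $\bar{\mathcal U}$ to the Dirac measure at $\bar u$). Furthermore, $$\lim_{n\to\infty}\lim_{t\to\infty}\mathbb{E}\,u^n(t)=\bar u ,$$ where expectations are taken coordinatewise and limits are in $\bar{\mathcal U}$ (i.e. coordinatewise).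
   Context: $\mathbb{N}_0=\{0,1,2,\dots\}$. Function $f$: for integers $1\le k<L$, $f:[0,1]\to\mathbb{R}$, $f(x)=\sum_{i=1}^k\binom{L}{L-k+i}\binom{L-k+i-2}{i-1}(-1)^{i-1}x^{L-k+i}$, with $\binom00=1$ and $\binom ab=0$ for $a<b$. State space: $\bar{\mathcal U}=\{u=(u_i)_{i\in\mathbb{N}_0}\in\mathbb{R}_+^\infty:1=u_0\ge u_1\ge\cdots\ge0\}$ with the product metric $\rho(x,y)=\sum_{j=1}^\infty2^{-j}|x_j-y_j|$. Model: there are $n$ servers, each with an infinite-capacity FIFO queue. Jobs arrive according to a Poisson process of rate $n\lambda$. Each arriving job selects one of the $\binom nL$ sets of $L$ servers uniformly at random, and one task is added to each of the $k$ shortest queues among these $L$ servers. Processing times are mutually independent and exponentially distributed with mean $k^{-1}$ at each server. $Q^n_i(t)$ is the length of the $i$-th queue at time $t$, $\pi^n_i(t)=\frac1n\sum_{j=1}^n1_{\{Q^n_j(t)=i\}}$ is the proportion of queues of length exactly $i$, and $u^n_i(t)=\sum_{j\ge i}\pi^n_j(t)$ is the proportion of queues of length at least $i$, $i\in\mathbb{N}_0$; $u^n(t)=(u^n_i(t))_{i\in\mathbb{N}_0}$. The initial state $Q^n(0)$ is nonrandom. Equivalently, $\pi^n$ is the continuous-time Markov chain on $\mathcal S_n=\{r\in\frac1n\mathbb{N}_0^\infty:\sum_i r_i=1\}$ with generator $$\mathcal{L}^n g(r)=\frac{n\lambda}{\binom nL}\sum_{\ell\in\Sigma}\Big(\prod_{i=0}^\infty\binom{nr_i}{\rho_i(\ell)}\Big)\Big[g\big(r+\tfrac1n\Delta_\ell\big)-g(r)\Big]+k\sum_{i=1}^\infty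 nr_i\Big[g\big(r+\tfrac1n(e_{i-1}-e_i)\big)-g(r)\Big],$$ where $\Sigma=\{\ell=(\ell_1,\dots,\ell_L)\in\mathbb{N}_0^L:\ell_1\le\cdots\le\ell_L\}$, $\rho_i(\ell)=\sum_{j=1}^L1_{\{\ell_j=i\}}$, $\Delta_\ell=\sum_{i=1}^ke_{\ell_i+1}-\sum_{i=1}^ke_{\ell_i}$, and $e_y$ is the sequence with $1$ in coordinate $y$ and $0$ elsewhere; $u^n$ is the image of $\pi^n$ under $r\mapsto(\sum_{j\ge i}r_j)_{i\in\mathbb{N}_0}$. It is known (previously established, for $\lambda<1$) that $Q^n$ is positive recurrent and consequently that $u^n$ has a unique invariant distribution $\mathcal{L}_n$. *)

theory Defs
  imports "HOL-Probability.Probability"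
begin

section \<open>The state space and its topology\<close>

definition Ubar :: "(nat \<Rightarrow> real) set" where
  "Ubar = {u. u 0 = 1 \<and> (\<forall>i. u (Suc i) \<le> u i) \<and> (\<forall>i. 0 \<le> u i)}"

definition rho_dist :: "(nat \<Rightarrow> real) \<Rightarrow> (nat \<Rightarrow> real) \<Rightarrow> real" where
  "rho_dist x y = (\<Sum>j. (1/2) ^ Suc j * \<bar>x (Suc j) - y (Suc j)\<bar>)"

text \<open>
  Below, \<open>Ubar\<close> carries the library topology on functions (the product topology). The lemma
  \<open>openin_Ubar_iff_rho_dist\<close> records that this is the topology of the product metric \<open>rho_dist\<close>
  (the index \<open>j\<close> above is shifted by one, so the weights are \<open>2\<^sup>-\<^sup>j\<close> for \<open>j \<ge> 1\<close>).
\<close>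

lemma Ubar_le_1:
  assumes "u \<in> Ubar" shows "u i \<le> 1"
proof (induction i)
  case 0 then show ?case using assms by (simp add: Ubar_def)
next
  case (Suc i)
  have "u (Suc i) \<le> u i" using assms by (simp add: Ubar_def)
  then show ?case using Suc by simp
qed

lemma Ubar_nonneg: "u \<in> Ubar \<Longrightarrow> 0 \<le> u i"
  by (simp add: Ubar_def)

lemma Ubar_diff_le:
  assumes "x \<in> Ubar" "y \<in> Ubar"
  shows "(1/2) ^ Suc j * \<bar>x (Suc j) - y (Suc j)\<bar> \<le> (1/2) ^ Suc j"
proof -
  have "\<bar>x (Suc j) - y (Suc j)\<bar> \<le> 1"
    using Ubar_le_1[OF assms(1), of "Suc j"] Ubar_le_1[OF assms(2), of "Suc j"]
      Ubar_nonneg[OF assms(1), of "Suc j"] Ubar_nonneg[OF assms(2), of "Suc j"] by linarith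
  then show ?thesis by simp
qed

lemma summable_half: "summable (\<lambda>j. (1/2::real) ^ Suc j)"
  using summable_geometric[of "1/2::real"] by (simp add: summable_mult)

lemma rho_dist_summable:
  assumes "x \<in> Ubar" "y \<in> Ubar"
  shows "summable (\<lambda>j. (1/2) ^ Suc j * \<bar>x (Suc j) - y (Suc j)\<bar>)"
  by (rule summable_comparison_test'[OF summable_half, of 0])
     (use Ubar_diff_le[OF assms] in auto)

lemma coord_le_rho_dist:
  assumes "x \<in> Ubar" "y \<in> Ubar"
  shows "(1/2) ^ i * \<bar>x i - y i\<bar> \<le> rho_dist x y"
proof (cases i)
  case 0
  have "0 \<le> rho_dist x y"
    unfolding rho_dist_def by (rule suminf_nonneg[OF rho_dist_summable[OF assms]]) auto
  then show ?thesis using assms 0 by (simp add: Ubar_def)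
next
  case (Suc j)
  have "sum (\<lambda>j. (1/2) ^ Suc j * \<bar>x (Suc j) - y (Suc j)\<bar>) {j} \<le> rho_dist x y"
    unfolding rho_dist_def by (rule sum_le_suminf[OF rho_dist_summable[OF assms]]) auto
  then show ?thesis using Suc by simp
qed

lemma continuous_on_rho_dist:
  assumes "x \<in> Ubar"
  shows "continuous_on Ubar (rho_dist x)"
proof -
  have "uniform_limit Ubar (\<lambda>n y. \<Sum>j<n. (1/2) ^ Suc j * \<bar>x (Suc j) - y (Suc j)\<bar>)
          (\<lambda>y. \<Sum>j. (1/2) ^ Suc j * \<bar>x (Suc j) - y (Suc j)\<bar>) sequentially"
    by (rule Weierstrass_m_test[OF _ summable_half]) (use Ubar_diff_le[OF assms] in auto)
  then have "continuous_on Ubar (\<lambda>y. \<Sum>j. (1/2) ^ Suc j * \<bar>x (Suc j) - y (Suc j)\<bar>)"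
    by (rule uniform_limit_theorem[rotated])
       (auto intro!: always_eventually continuous_intros
          continuous_on_subset[OF continuous_on_product_coordinates])
  then show ?thesis by (simp add: rho_dist_def[abs_def])
qed

lemma openin_Ubar_iff_rho_dist:
  "openin (top_of_set Ubar) U \<longleftrightarrow>
     U \<subseteq> Ubar \<and> (\<forall>x\<in>U. \<exists>e>0. \<forall>y\<in>Ubar. rho_dist x y < e \<longrightarrow> y \<in> U)"
proof (intro iffI conjI ballI)
  assume U: "openin (top_of_set Ubar) U"
  then show "U \<subseteq> Ubar" by (simp add: openin_imp_subset)
  fix x assume x: "x \<in> U"
  then have xU: "x \<in> Ubar" using \<open>U \<subseteq> Ubar\<close> by auto
  obtain T where T: "open T" "U = Ubar \<inter> T" using U by (auto simp: openin_open)
  have "openin (product_topology (\<lambda>i. euclidean) UNIV) T"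
    using T by (simp add: open_fun_def)
  from product_topology_open_contains_basis[OF this, of x] x T
  obtain X where X: "x \<in> (\<Pi>\<^sub>E i\<in>UNIV. X i)" "\<And>i. open (X i)"
      "finite {i. X i \<noteq> UNIV}" "(\<Pi>\<^sub>E i\<in>UNIV. X i) \<subseteq> T"
    by auto
  define I where "I = {i. X i \<noteq> (UNIV :: real set)}"
  have "\<exists>e>0. \<forall>z. \<bar>z - x i\<bar> < e \<longrightarrow> z \<in> X i" for i
    using X(1,2) open_real[of "X i"] by (auto simp: PiE_iff open_dist dist_real_def)
  then obtain e where e: "\<And>i. e i > 0" "\<And>i z. \<bar>z - x i\<bar> < e i \<Longrightarrow> z \<in> X i"
    by metis
  define d where "d = Min (insert 1 ((\<lambda>i. (1/2) ^ i * e i) ` I))"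
  have finI: "finite I" using X(3) by (simp add: I_def)
  have "d > 0" unfolding d_def using finI e(1) by (subst Min_gr_iff) auto
  moreover have "y \<in> U" if y: "y \<in> Ubar" "rho_dist x y < d" for y
  proof -
    have "y i \<in> X i" for i
    proof (cases "i \<in> I")
      case True
      have "(1/2) ^ i * \<bar>x i - y i\<bar> < d" using coord_le_rho_dist[OF xU y(1), of i] y(2) by simp
      also have "d \<le> (1/2) ^ i * e i" unfolding d_def using finI True by (intro Min_le) auto
      finally have "\<bar>x i - y i\<bar> < e i" by simp
      then show ?thesis using e(2)[of "y i" i] by (simp add: abs_minus_commute)
    qed (auto simp: I_def)
    then show ?thesis using X(4) T y(1) by (auto simp: PiE_iff)
  qed
  ultimately show "\<exists>e>0. \<forall>y\<in>Ubar. rho_dist x y < e \<longrightarrow> y \<in> U" by blast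
next
  assume U: "U \<subseteq> Ubar \<and> (\<forall>x\<in>U. \<exists>e>0. \<forall>y\<in>Ubar. rho_dist x y < e \<longrightarrow> y \<in> U)"
  show "openin (top_of_set Ubar) U"
  proof (subst openin_subopen, intro ballI)
    fix x assume x: "x \<in> U"
    then obtain e where e: "e > 0" "\<And>y. y \<in> Ubar \<Longrightarrow> rho_dist x y < e \<Longrightarrow> y \<in> U"
      using U by blast
    have "openin (top_of_set Ubar) (Ubar \<inter> rho_dist x -` {..<e})"
      using continuous_on_rho_dist x U by (intro continuous_openin_preimage_gen) auto
    moreover have "rho_dist x x = 0" by (simp add: rho_dist_def)
    ultimately show "\<exists>T. openin (top_of_set Ubar) T \<and> x \<in> T \<and> T \<subseteq> U"
      using e x U by (intro exI[of _ "Ubar \<inter> rho_dist x -` {..<e}"]) auto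
  qed
qed

definition Ubar_borel :: "(nat \<Rightarrow> real) measure" where
  "Ubar_borel = restrict_space borel Ubar"

definition weakly_converges_Ubar ::
    "(nat \<Rightarrow> (nat \<Rightarrow> real) measure) \<Rightarrow> (nat \<Rightarrow> real) measure \<Rightarrow> bool" where
  "weakly_converges_Ubar \<mu> \<nu> \<longleftrightarrow>
     (\<forall>h :: (nat \<Rightarrow> real) \<Rightarrow> real. continuous_on Ubar h \<and> bounded (h ` Ubar) \<longrightarrow>
        (\<lambda>n. \<integral>u. h u \<partial>\<mu> n) \<longlonglongrightarrow> (\<integral>u. h u \<partial>\<nu>))"


section \<open>Continuous-time Markov chains with bounded generator\<close>

text \<open>
  \<open>P t x\<close> is the law at time \<open>t\<close> of the chain started from \<open>x\<close>. The generator \<open>A\<close> is required as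
  the derivative of the semigroup at \<open>0\<close> on all bounded functions, which is the right domain
  when the total jump rate is bounded (below, by \<open>n * (lam + k)\<close>); in that case these conditions
  determine \<open>P t x\<close> for all \<open>t \<ge> 0\<close> and \<open>x \<in> S\<close>. Values for \<open>t < 0\<close> or \<open>x \<notin> S\<close> play no role.
\<close>

definition transition_semigroup ::
    "'s set \<Rightarrow> (('s \<Rightarrow> real) \<Rightarrow> 's \<Rightarrow> real) \<Rightarrow> (real \<Rightarrow> 's \<Rightarrow> 's pmf) \<Rightarrow> bool" where
  "transition_semigroup S A P \<longleftrightarrow>
     (\<forall>x\<in>S. \<forall>t\<ge>0. set_pmf (P t x) \<subseteq> S) \<and>
     (\<forall>x\<in>S. P 0 x = return_pmf x) \<and>
     (\<forall>x\<in>S. \<forall>s\<ge>0. \<forall>t\<ge>0. P (s + t) x = bind_pmf (P s x) (P t)) \<and>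
     (\<forall>g. bounded (g ` S) \<longrightarrow>
        (\<forall>x\<in>S. ((\<lambda>t. measure_pmf.expectation (P t x) g) has_real_derivative A g x)
                 (at 0 within {0..})))"

definition past_events :: "'w measure \<Rightarrow> 's set \<Rightarrow> (real \<Rightarrow> 'w \<Rightarrow> 's) \<Rightarrow> real \<Rightarrow> 'w set set" where
  "past_events M S X s =
     sigma_sets (space M) {X r -` B \<inter> space M | r B. 0 \<le> r \<and> r \<le> s \<and> B \<subseteq> S}"

text \<open>
  A process on the countable state space \<open>S\<close> that is Markov for its natural filtration with
  transition semigroup \<open>P\<close>, and whose paths are right-continuous for the discrete topology on \<open>S\<close>.
\<close>

definition markov_process ::
    "'w measure \<Rightarrow> 's set \<Rightarrow> (real \<Rightarrow> 's \<Rightarrow> 's pmf) \<Rightarrow> (real \<Rightarrow> 'w \<Rightarrow> 's) \<Rightarrow> bool" where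
  "markov_process M S P X \<longleftrightarrow>
     prob_space M \<and>
     (\<forall>t\<ge>0. X t \<in> measurable M (count_space S)) \<and>
     (\<forall>s\<ge>0. \<forall>t\<ge>0. \<forall>E\<in>past_events M S X s. \<forall>x\<in>S. \<forall>y\<in>S.
        measure M {\<omega> \<in> E. X s \<omega> = x \<and> X (s + t) \<omega> = y} =
        measure M {\<omega> \<in> E. X s \<omega> = x} * pmf (P t x) y) \<and>
     (\<forall>\<omega>\<in>space M. \<forall>t\<ge>0. eventually (\<lambda>s. X s \<omega> = X t \<omega>) (at_right t))"


section \<open>The batch-sampling system\<close>

definition occ_states :: "nat \<Rightarrow> (nat \<Rightarrow> real) set" where
  "occ_states n = {r. (\<forall>i. \<exists>m::nat. r i = real m / real n) \<and> r sums 1}"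

definition unit_seq :: "nat \<Rightarrow> nat \<Rightarrow> real" where
  "unit_seq y = (\<lambda>j. if j = y then 1 else 0)"

definition sampled_lengths :: "nat \<Rightarrow> nat list set" where
  "sampled_lengths L = {l. length l = L \<and> sorted l}"

definition arrival_jump :: "nat \<Rightarrow> nat list \<Rightarrow> nat \<Rightarrow> real" where
  "arrival_jump k l =
     (\<lambda>j. (\<Sum>i<k. unit_seq (Suc (l ! i)) j) - (\<Sum>i<k. unit_seq (l ! i) j))"

text \<open>
  Generator of the occupancy process \<open>\<pi>\<^sup>n\<close>. On \<open>occ_states n\<close> the numbers \<open>n * r i\<close> are naturals, so
  \<open>gchoose\<close> is the ordinary binomial coefficient; only finitely many of the \<open>r i\<close> are nonzero there,
  so all three infinite operators have finite support.
\<close>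

definition occ_generator ::
    "nat \<Rightarrow> nat \<Rightarrow> real \<Rightarrow> nat \<Rightarrow> ((nat \<Rightarrow> real) \<Rightarrow> real) \<Rightarrow> (nat \<Rightarrow> real) \<Rightarrow> real" where
  "occ_generator L k lam n g r =
     real n * lam / real (n choose L) *
       (\<Sum>\<^sub>\<infinity>l\<in>sampled_lengths L.
          (\<Prod>i. (real n * r i) gchoose (count_list l i)) *
          (g (\<lambda>j. r j + arrival_jump k l j / real n) - g r)) +
     real k *
       (\<Sum>i. real n * r (Suc i) *
          (g (\<lambda>j. r j + (unit_seq i j - unit_seq (Suc i) j) / real n) - g r))"

definition tail_occ :: "(nat \<Rightarrow> real) \<Rightarrow> nat \<Rightarrow> real" where
  "tail_occ r i = (\<Sum>j. r (i + j))"

text \<open>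
  \<open>\<mu>\<close> is an invariant distribution of \<open>u\<^sup>n\<close>, the image of \<open>\<pi>\<^sup>n\<close> under \<open>tail_occ\<close>: for some initial law
  \<open>\<nu>\<close> of \<open>\<pi>\<^sup>n\<close>, the law of \<open>u\<^sup>n(t)\<close> is \<open>\<mu>\<close> at every time \<open>t \<ge> 0\<close>. As \<open>tail_occ\<close> is injective on
  \<open>occ_states n\<close>, \<open>u\<^sup>n\<close> is itself a Markov chain and \<open>\<nu>\<close> is determined by \<open>\<mu>\<close>.
\<close>

definition invariant_tail_distribution ::
    "nat \<Rightarrow> (real \<Rightarrow> (nat \<Rightarrow> real) \<Rightarrow> (nat \<Rightarrow> real) pmf) \<Rightarrow> (nat \<Rightarrow> real) measure \<Rightarrow> bool" where
  "invariant_tail_distribution n P \<mu> \<longleftrightarrow>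
     sets \<mu> = sets Ubar_borel \<and>
     (\<exists>\<nu>. set_pmf \<nu> \<subseteq> occ_states n \<and>
        (\<forall>t\<ge>0. \<forall>B\<in>sets Ubar_borel.
           emeasure \<mu> B = emeasure (measure_pmf (bind_pmf \<nu> (P t))) {r. tail_occ r \<in> B}))"


section \<open>The fixed point\<close>

text \<open>The subtraction \<open>L - k + i - 2\<close> does not truncate, since \<open>k < L\<close> and \<open>i \<ge> 1\<close>.\<close>

definition f_fun :: "nat \<Rightarrow> nat \<Rightarrow> real \<Rightarrow> real" where
  "f_fun L k x =
     (\<Sum>i=1..k. real (L choose (L - k + i)) * real ((L - k + i - 2) choose (i - 1)) *
        (-1) ^ (i - 1) * x ^ (L - k + i))"

primrec ubar :: "nat \<Rightarrow> nat \<Rightarrow> real \<Rightarrow> nat \<Rightarrow> real" where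
  "ubar L k lam 0 = 1"
| "ubar L k lam (Suc m) = lam * f_fun L k (ubar L k lam m) / real k"

end

theory Submission
  imports Defs
begin

text \<open>
  Write \<open>u\<^sub>j\<close> for the fraction of queues of length at least \<open>j\<close>. Its drift is
  \<open>lam (F\<^sub>n(u\<^sub>j\<^sub>-\<^sub>1) - F\<^sub>n(u\<^sub>j)) - k (u\<^sub>j - u\<^sub>j\<^sub>+\<^sub>1)\<close>, where \<open>F\<^sub>n(m/n)\<close> is the mean of \<open>(N - (L - k))\<^sup>+\<close> for the number \<open>N\<close> of
  marked elements, out of \<open>m\<close>, in a uniform \<open>L\<close>-subset of \<open>n\<close> elements; Newton's expansion of \<open>(N - (L - k))\<^sup>+\<close>
  in binomial coefficients gives \<open>F\<^sub>n \<rightarrow> f\<close>. Under a stationary law the generator has mean zero.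
  Applied to \<open>\<Sum>\<^sub>j u\<^sub>j\<close> this yields \<open>E u\<^sub>m \<le> lam E u\<^sub>m\<^sub>-\<^sub>1\<close>, hence uniformly small tails. Applied to a smoothing of
  \<open>\<Sum>\<^sub>j\<^sub>\<ge>\<^sub>m \<bar>u\<^sub>j - ubar\<^sub>j\<bar>\<close>, the monotonicity of \<open>f\<close> makes the drift telescope, so that
  \<open>k E \<bar>u\<^sub>m - ubar\<^sub>m\<bar>\<close> is at most \<open>lam E \<bar>f(u\<^sub>m\<^sub>-\<^sub>1) - f(ubar\<^sub>m\<^sub>-\<^sub>1)\<bar>\<close> up to an error that vanishes as \<open>n \<rightarrow> \<infinity>\<close>,
  and induction on \<open>m\<close> gives convergence in mean of every coordinate. For fixed \<open>n\<close>, the limit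
  \<open>t \<rightarrow> \<infinity>\<close> follows from irreducibility and the decay of the stationary second moment.
\<close>

section \<open>Markov semigroups with bounded rates\<close>

text \<open>The generator is given only as a pointwise derivative at time 0, on bounded functions.
  Two devices make it usable under a stationary law. The bound \<open>n * (lam + k)\<close> on the
  exit rates makes the difference quotients bounded uniformly in the state, so that expectation and
  derivative can be exchanged; and sums over all levels, which are unbounded, are cut at a level
  \<open>J\<close>, at the price of a boundary term. The stationary tail bound
  \<open>lam ^ m\<close> is the same for every \<open>n\<close>, so \<open>J\<close> can be fixed
  before \<open>n\<close> tends to infinity. The estimate at level \<open>m\<close> refers only to
  level \<open>m - 1\<close>, and level 0 is exact since both sequences start with 1. Hence the
  induction tolerates any Lipschitz constant of \<open>f\<close>. The coefficients of
  \<open>f\<close> alternate in sign, so its monotonicity, its sign and the bound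
  \<open>f x \<le> k * x\<close> cannot be read off its formula. They hold for the finite mean
  \<open>F\<^sub>n\<close>, where they follow sample by sample, and pass to the limit.\<close>

lemma integrable_pmf_bounded_on:
  fixes g :: "'s \<Rightarrow> real"
  assumes "bounded (g ` S)" "set_pmf p \<subseteq> S"
  shows "integrable (measure_pmf p) g"
proof -
  obtain B where "\<And>x. x \<in> S \<Longrightarrow> norm (g x) \<le> B"
    using assms(1) by (auto simp: bounded_iff)
  then show ?thesis
    using assms(2) by (intro measure_pmf.integrable_const_bound[where B=B]) (auto simp: AE_measure_pmf_iff)
qed

lemma abs_expectation_le:
  fixes g :: "'s \<Rightarrow> real"
  assumes "\<And>x. x \<in> S \<Longrightarrow> \<bar>g x\<bar> \<le> B" "set_pmf p \<subseteq> S"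
  shows "\<bar>measure_pmf.expectation p g\<bar> \<le> B"
proof -
  have "integrable (measure_pmf p) g"
    using assms by (intro integrable_pmf_bounded_on[of g S]) (auto simp: bounded_iff)
  then have "measure_pmf.expectation p g \<le> B" "measure_pmf.expectation p g \<ge> -B"
    using assms
    by (auto intro!: measure_pmf.integral_le_const measure_pmf.integral_ge_const
        simp: AE_measure_pmf_iff) (meson abs_le_D1 abs_le_D2 minus_le_iff subset_eq)+
  then show ?thesis by simp
qed

lemma expectation_bind_pmf_bounded_on:
  fixes g :: "'s \<Rightarrow> real"
  assumes g: "bounded (g ` S)" and p: "\<And>x. x \<in> set_pmf p \<Longrightarrow> set_pmf (f x) \<subseteq> S"
  shows "measure_pmf.expectation (bind_pmf p f) g =
    measure_pmf.expectation p (\<lambda>x. measure_pmf.expectation (f x) g)"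
proof -
  obtain B where B: "\<And>x. x \<in> S \<Longrightarrow> \<bar>g x\<bar> \<le> B"
    using g by (auto simp: bounded_iff)
  \<comment> \<open>\<open>integral_bind\<close> wants a bound on the whole type, whereas
    \<open>g\<close> is controlled only on \<open>S\<close>; the cut-off \<open>g'\<close> agrees
    with \<open>g\<close> under every law involved.\<close>
  define g' where "g' x = (if x \<in> S then g x else 0)" for x
  have g': "measure_pmf.expectation q g = measure_pmf.expectation q g'" if "set_pmf q \<subseteq> S" for q
    using that by (intro integral_cong_AE) (auto simp: AE_measure_pmf_iff g'_def)
  have "measure_pmf.expectation (bind_pmf p f) g' =
      measure_pmf.expectation p (\<lambda>x. measure_pmf.expectation (f x) g')"
    unfolding measure_pmf_bind
  proof (rule integral_bind[where K="count_space UNIV" and B="\<bar>B\<bar>" and B'=1])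
    show "\<bar>g' x\<bar> \<le> \<bar>B\<bar>" for x using B[of x] by (auto simp: g'_def)
    show "(\<lambda>x. measure_pmf (f x)) \<in> measure_pmf p \<rightarrow>\<^sub>M subprob_algebra (count_space UNIV)"
      using measurable_measure_pmf[of f] by simp
  qed (auto simp: measure_pmf.emeasure_space_1[unfolded space_measure_pmf]
      intro: measure_pmf.finite_measure_axioms)
  also have "\<dots> = measure_pmf.expectation p (\<lambda>x. measure_pmf.expectation (f x) g)"
    using g' p by (intro integral_cong_AE) (auto simp: AE_measure_pmf_iff)
  also have "measure_pmf.expectation (bind_pmf p f) g' = measure_pmf.expectation (bind_pmf p f) g"
    using p by (intro g'[symmetric]) auto
  finally show ?thesis .
qed

lemma integrable_indicator_pmf: "integrable (measure_pmf p) (indicator B :: 's \<Rightarrow> real)"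
  by (rule measure_pmf.integrable_const_bound[where B=1]) auto

text \<open>Keeping only the atom \<open>a\<close> in the integral that defines the variance gives
  the bound. It turns a small variance into closeness of \<open>h a\<close> to the mean at every
  point of positive mass.\<close>

lemma pmf_mult_square_le_variance:
  fixes h :: "'s \<Rightarrow> real"
  assumes "bounded (h ` S)" "set_pmf p \<subseteq> S"
  shows "pmf p a * (h a - measure_pmf.expectation p h)\<^sup>2 \<le>
    measure_pmf.expectation p (\<lambda>x. (h x)\<^sup>2) - (measure_pmf.expectation p h)\<^sup>2"
proof -
  let ?c = "measure_pmf.expectation p h"
  obtain B where B: "\<And>x. x \<in> S \<Longrightarrow> \<bar>h x\<bar> \<le> B"
    using assms by (auto simp: bounded_iff)
  have i1: "integrable (measure_pmf p) h" by (rule integrable_pmf_bounded_on[OF assms])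
  have i2: "integrable (measure_pmf p) (\<lambda>x. (h x)\<^sup>2)"
  proof (rule integrable_pmf_bounded_on[OF _ assms(2)])
    have "\<bar>(h x)\<^sup>2\<bar> \<le> B\<^sup>2" if "x \<in> S" for x
      using power_mono[OF B[OF that] abs_ge_zero, of 2] by simp
    then show "bounded ((\<lambda>x. (h x)\<^sup>2) ` S)" by (auto simp: bounded_iff)
  qed
  have "(\<integral>x. (h a - ?c)\<^sup>2 * indicator {a} x \<partial>measure_pmf p) \<le> (\<integral>x. (h x - ?c)\<^sup>2 \<partial>measure_pmf p)"
  proof (rule integral_mono)
    show "integrable (measure_pmf p) (\<lambda>x. (h x - ?c)\<^sup>2)" using i1 i2 by (simp add: power2_diff)
  qed (auto intro: integrable_indicator_pmf split: split_indicator)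
  also have "(\<integral>x. (h a - ?c)\<^sup>2 * indicator {a} x \<partial>measure_pmf p) = pmf p a * (h a - ?c)\<^sup>2"
    by (simp add: measure_pmf_single)
  also have "(\<integral>x. (h x - ?c)\<^sup>2 \<partial>measure_pmf p) = measure_pmf.expectation p (\<lambda>x. (h x)\<^sup>2) - ?c\<^sup>2"
    using i1 i2 by (subst measure_pmf.variance_eq) auto
  finally show ?thesis .
qed

text \<open>\<open>A (indicator {x}) x\<close> is the derivative at 0 of the probability of being at
  \<open>x\<close>, that is, minus the exit rate; so \<open>C\<close> bounds all exit rates.\<close>

locale bounded_rate_semigroup =
  fixes S :: "'s set" and A :: "('s \<Rightarrow> real) \<Rightarrow> 's \<Rightarrow> real" and P :: "real \<Rightarrow> 's \<Rightarrow> 's pmf" and C :: real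
  assumes semigroup: "transition_semigroup S A P"
    and rate_le: "x \<in> S \<Longrightarrow> - C \<le> A (indicator {x}) x"
begin

lemma set_P: "x \<in> S \<Longrightarrow> t \<ge> 0 \<Longrightarrow> set_pmf (P t x) \<subseteq> S"
  and P_0: "x \<in> S \<Longrightarrow> P 0 x = return_pmf x"
  and P_add: "x \<in> S \<Longrightarrow> s \<ge> 0 \<Longrightarrow> t \<ge> 0 \<Longrightarrow> P (s + t) x = bind_pmf (P s x) (P t)"
  and P_deriv: "bounded (g ` S) \<Longrightarrow> x \<in> S \<Longrightarrow>
    ((\<lambda>t. measure_pmf.expectation (P t x) g) has_real_derivative A g x) (at 0 within {0..})"
  for g :: "'s \<Rightarrow> real"
  using semigroup unfolding transition_semigroup_def by blast+

lemma bounded_P: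
  fixes g :: "'s \<Rightarrow> real"
  assumes "bounded (g ` S)" "t \<ge> 0"
  shows "bounded ((\<lambda>x. measure_pmf.expectation (P t x) g) ` S)"
proof -
  obtain B where "\<And>x. x \<in> S \<Longrightarrow> \<bar>g x\<bar> \<le> B"
    using assms by (auto simp: bounded_iff)
  then have "\<bar>measure_pmf.expectation (P t x) g\<bar> \<le> B" if "x \<in> S" for x
    using abs_expectation_le[of S g B] set_P that assms by blast
  then show ?thesis by (auto simp: bounded_iff)
qed

lemma expectation_P_add:
  fixes g :: "'s \<Rightarrow> real"
  assumes "bounded (g ` S)" "x \<in> S" "s \<ge> 0" "t \<ge> 0"
  shows "measure_pmf.expectation (P (s + t) x) g =
    measure_pmf.expectation (P s x) (\<lambda>y. measure_pmf.expectation (P t y) g)"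
proof -
  have "set_pmf (P t y) \<subseteq> S" if "y \<in> set_pmf (P s x)" for y
    using set_P[OF assms(2,3)] set_P[OF _ assms(4)] that by blast
  then show ?thesis
    unfolding P_add[OF assms(2-)] by (rule expectation_bind_pmf_bounded_on[OF assms(1)])
qed

lemma pmf_P_add_ge:
  assumes "x \<in> S" "s \<ge> 0" "t \<ge> 0"
  shows "pmf (P s x) y * pmf (P t y) z \<le> pmf (P (s + t) x) z"
proof -
  have "(\<integral>w. pmf (P t y) z * indicator {y} w \<partial>measure_pmf (P s x)) \<le> (\<integral>w. pmf (P t w) z \<partial>measure_pmf (P s x))"
    by (intro integral_mono measure_pmf.integrable_const_bound[where B=1])
       (auto split: split_indicator simp: pmf_le_1)
  then show ?thesis
    unfolding P_add[OF assms] pmf_bind by (simp add: measure_pmf_single mult.commute)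
qed

lemma bounded_indicator: "bounded ((indicator B :: 's \<Rightarrow> real) ` S)"
  by (auto simp: bounded_iff indicator_def intro!: exI[of _ 1])

text \<open>The times \<open>t / Suc m\<close> match the cutting of \<open>[0, t]\<close> into
  \<open>Suc m\<close> equal steps, and turn the derivative into a limit of a sequence, as dominated
  convergence requires.\<close>

lemma P_deriv_seq:
  fixes g :: "'s \<Rightarrow> real"
  assumes "bounded (g ` S)" "x \<in> S" "t > 0"
  shows "(\<lambda>m. (measure_pmf.expectation (P (t / real (Suc m)) x) g - g x) / (t / real (Suc m))) \<longlonglongrightarrow> A g x"
proof -
  have "((\<lambda>s. (measure_pmf.expectation (P s x) g - g x) / s) \<longlongrightarrow> A g x) (at 0 within {0..})"
    using P_deriv[OF assms(1,2)] by (simp add: has_field_derivative_iff P_0 assms)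
  moreover have "(\<lambda>m. t / real (Suc m)) \<longlonglongrightarrow> 0"
    by (rule LIMSEQ_Suc) (rule lim_const_over_n)
  then have "filterlim (\<lambda>m. t / real (Suc m)) (at 0 within {0..}) sequentially"
    using assms(3) by (auto simp: filterlim_at)
  ultimately show ?thesis by (rule filterlim_compose)
qed

text \<open>Supermultiplicativity in time and Bernoulli's inequality upgrade the derivative at \<open>0\<close>
  to a bound that is uniform in the state.\<close>

lemma pmf_P_stay_ge:
  assumes x: "x \<in> S" and t: "t \<ge> 0"
  shows "pmf (P t x) x \<ge> 1 - C * t"
proof (cases "t = 0")
  case True then show ?thesis using x by (simp add: P_0)
next
  case False
  then have t: "t > 0" using t by simp
  define \<phi> where "\<phi> s = pmf (P s x) x" for s
  have super: "\<phi> s ^ m \<le> \<phi> (real m * s)" if "s \<ge> 0" for s m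
  proof (induction m)
    case 0 then show ?case using x by (simp add: \<phi>_def P_0)
  next
    case (Suc m)
    have "\<phi> s ^ Suc m \<le> \<phi> s * \<phi> (real m * s)"
      using Suc by (simp add: \<phi>_def mult_left_mono)
    also have "\<dots> \<le> \<phi> (s + real m * s)"
      unfolding \<phi>_def using x that by (intro pmf_P_add_ge) auto
    finally show ?case by (simp add: algebra_simps)
  qed
  have "1 + t * ((\<phi> (t / real (Suc m)) - 1) / (t / real (Suc m))) \<le> \<phi> t" for m
  proof -
    have "1 + real (Suc m) * (\<phi> (t / real (Suc m)) - 1) \<le> (1 + (\<phi> (t / real (Suc m)) - 1)) ^ Suc m"
      by (rule Bernoulli_inequality) (simp add: \<phi>_def)
    also have "\<dots> = \<phi> (t / real (Suc m)) ^ Suc m" by simp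
    also have "\<dots> \<le> \<phi> (real (Suc m) * (t / real (Suc m)))"
      using t by (intro super) simp
    also have "real (Suc m) * (t / real (Suc m)) = t" by (simp del: of_nat_Suc)
    finally show ?thesis using t by (simp add: mult.commute del: of_nat_Suc)
  qed
  moreover have "(\<lambda>m. 1 + t * ((\<phi> (t / real (Suc m)) - 1) / (t / real (Suc m))))
      \<longlonglongrightarrow> 1 + t * A (indicator {x}) x"
    using P_deriv_seq[OF bounded_indicator x t, of "{x}"]
    by (intro tendsto_intros) (simp add: \<phi>_def measure_pmf_single)
  ultimately have "1 + t * A (indicator {x}) x \<le> \<phi> t"
    by (intro LIMSEQ_le_const2) auto
  moreover have "t * A (indicator {x}) x \<ge> t * (- C)"
    using rate_le[OF x] t by (intro mult_left_mono) auto
  ultimately show ?thesis by (simp add: \<phi>_def algebra_simps)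
qed

text \<open>\<open>g y - g x\<close> vanishes at \<open>y = x\<close> and is at most
  \<open>2 * B\<close> elsewhere, so the difference is at most \<open>2 * B\<close> times the
  probability of not being at \<open>x\<close> at time \<open>t\<close>.\<close>

lemma expectation_P_diff_le:
  fixes g :: "'s \<Rightarrow> real"
  assumes "\<And>x. x \<in> S \<Longrightarrow> \<bar>g x\<bar> \<le> B" "x \<in> S" "t \<ge> 0"
  shows "\<bar>measure_pmf.expectation (P t x) g - g x\<bar> \<le> 2 * B * (C * t)"
proof -
  have B: "B \<ge> 0" using assms(1,2) abs_ge_zero order_trans by blast
  have bd: "bounded (g ` S)" using assms(1) by (auto simp: bounded_iff)
  have int: "integrable (measure_pmf (P t x)) g"
    using integrable_pmf_bounded_on[OF bd set_P] assms by blast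
  have "\<bar>measure_pmf.expectation (P t x) g - g x\<bar> = \<bar>\<integral>y. g y - g x \<partial>measure_pmf (P t x)\<bar>"
    using int by simp
  also have "\<dots> \<le> (\<integral>y. \<bar>g y - g x\<bar> \<partial>measure_pmf (P t x))"
    by (rule integral_abs_bound)
  also have "\<dots> \<le> (\<integral>y. 2 * B * (1 - indicator {x} y) \<partial>measure_pmf (P t x))"
  proof (rule integral_mono_AE)
    have "\<bar>g y - g x\<bar> \<le> 2 * B" if "y \<in> S" for y
      using assms(1)[OF that] assms(1)[OF assms(2)] by linarith
    then show "AE y in measure_pmf (P t x). \<bar>g y - g x\<bar> \<le> 2 * B * (1 - indicator {x} y)"
      using set_P[OF assms(2,3)] by (auto simp: AE_measure_pmf_iff indicator_def)
    show "integrable (measure_pmf (P t x)) (\<lambda>y. \<bar>g y - g x\<bar>)" using int by auto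
  qed (auto intro!: integrable_indicator_pmf integrable_mult_right Bochner_Integration.integrable_diff)
  also have "\<dots> = 2 * B * (1 - pmf (P t x) x)"
    by (simp add: measure_pmf_single integrable_indicator_pmf)
  also have "\<dots> \<le> 2 * B * (C * t)"
    using pmf_P_stay_ge[OF assms(2,3)] B by (intro mult_left_mono) auto
  finally show ?thesis .
qed

text \<open>Positivity is asked at every \<open>t > 0\<close>, not just at one: a jump of positive
  rate can then be appended by spending a small part of the time on it, and time 1 serves all pairs
  of states at once.\<close>

definition reach :: "'s \<Rightarrow> 's set" where
  "reach x = {y \<in> S. \<forall>t>0. pmf (P t x) y > 0}"

lemma reach_step:
  assumes x: "x \<in> S" and y: "y \<in> reach x" and z: "z \<noteq> y" and pos: "A (indicator {z}) y > 0"
  shows "z \<in> reach x"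
proof -
  have yS: "y \<in> S" and yt: "\<And>t. t > 0 \<Longrightarrow> pmf (P t x) y > 0" using y by (auto simp: reach_def)
  have main: "pmf (P t x) z > 0" if t: "t > 0" for t
  proof -
    \<comment> \<open>A positive derivative makes the transition probability from \<open>y\<close>
      to \<open>z\<close> positive at arbitrarily short times; starting from \<open>t/2\<close>
      leaves a positive time \<open>t - s\<close> in which to reach \<open>y\<close>.\<close>
    have "\<forall>\<^sub>F m in sequentially.
        (measure_pmf.expectation (P ((t/2) / real (Suc m)) y) (indicator {z}) - indicator {z} y) /
          ((t/2) / real (Suc m)) > 0"
      using order_tendstoD(1)[OF P_deriv_seq[OF bounded_indicator yS, of "t/2" "{z}"] pos] t by simp
    then obtain m where m: "measure_pmf.expectation (P ((t/2) / real (Suc m)) y) (indicator {z}) /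
          ((t/2) / real (Suc m)) > 0"
      using z by (auto simp: eventually_sequentially)
    define s where "s = (t/2) / real (Suc m)"
    have s: "0 < s" using t by (simp add: s_def)
    have "s \<le> (t/2) / 1" unfolding s_def using t by (intro divide_left_mono) auto
    then have "s < t" using t by simp
    have "pmf (P s y) z > 0" using m s
      unfolding s_def[symmetric] by (simp add: zero_less_divide_iff measure_pmf_single)
    then have "0 < pmf (P (t - s) x) y * pmf (P s y) z" using yt[of "t-s"] \<open>s < t\<close> by simp
    also have "\<dots> \<le> pmf (P (t - s + s) x) z"
      using x s \<open>s < t\<close> by (intro pmf_P_add_ge) auto
    finally show ?thesis by simp
  qed
  have "z \<in> set_pmf (P 1 x)" using main[of 1] by (simp add: set_pmf_iff)
  then have "z \<in> S" using set_P[OF x, of 1] by auto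
  then show ?thesis using main by (simp add: reach_def)
qed

lemma reach_refl:
  assumes x: "x \<in> S"
  shows "x \<in> reach x"
proof -
  have "pmf (P t x) x > 0" if t: "t > 0" for t
  proof -
    \<comment> \<open>So many pieces that \<open>C * s < 1\<close>: the probability of staying at
      \<open>x\<close> is then positive on each piece, and the pieces multiply.\<close>
    define m where "m = nat \<lceil>\<bar>C\<bar> * t\<rceil>"
    define s where "s = t / real (Suc m)"
    have s: "s > 0" using t by (simp add: s_def)
    have "\<bar>C\<bar> * t < real (Suc m)" unfolding m_def by linarith
    then have "C * t < real (Suc m)" using t abs_ge_self[of C] mult_right_mono[of C "\<bar>C\<bar>" t] by linarith
    then have "C * s < 1" by (simp add: s_def field_simps)
    then have ps: "pmf (P s x) x > 0" using pmf_P_stay_ge[OF x, of s] s by linarith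
    have "pmf (P (real (Suc j) * s) x) x > 0" for j
    proof (induction j)
      case (Suc j)
      have "0 < pmf (P s x) x * pmf (P (real (Suc j) * s) x) x" using Suc ps by simp
      also have "\<dots> \<le> pmf (P (s + real (Suc j) * s) x) x"
        using x s by (intro pmf_P_add_ge) auto
      finally show ?case by (simp add: algebra_simps)
    qed (use ps in simp)
    from this[of m] show ?thesis by (simp add: s_def del: of_nat_Suc)
  qed
  then show ?thesis using x by (simp add: reach_def)
qed

end

section \<open>Stationary laws and convergence to them\<close>

locale stationary_semigroup = bounded_rate_semigroup +
  fixes \<nu> :: "'a pmf"
  assumes set_\<nu>: "set_pmf \<nu> \<subseteq> S"
    and stationary: "t \<ge> 0 \<Longrightarrow> bind_pmf \<nu> (P t) = \<nu>"
begin

lemma expectation_\<nu>_P: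
  fixes g :: "'a \<Rightarrow> real"
  assumes "bounded (g ` S)" "t \<ge> 0"
  shows "measure_pmf.expectation \<nu> (\<lambda>x. measure_pmf.expectation (P t x) g) = measure_pmf.expectation \<nu> g"
proof -
  have "set_pmf (P t x) \<subseteq> S" if "x \<in> set_pmf \<nu>" for x
    using set_P[OF _ assms(2)] set_\<nu> that by blast
  from expectation_bind_pmf_bounded_on[OF assms(1), of \<nu> "P t", OF this]
  show ?thesis by (simp add: stationary[OF assms(2)])
qed

text \<open>The difference quotients have stationary mean 0, and
  \<open>expectation_P_diff_le\<close> bounds them by \<open>2 * B * C\<close> for all states and
  time steps. Dominated convergence carries integrability and the zero mean over to
  \<open>A g\<close>.\<close>

lemma generator_stationary:
  fixes g :: "'a \<Rightarrow> real"
  assumes g: "bounded (g ` S)"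
  shows "integrable (measure_pmf \<nu>) (A g)" "measure_pmf.expectation \<nu> (A g) = 0"
proof -
  obtain B where B: "\<And>x. x \<in> S \<Longrightarrow> \<bar>g x\<bar> \<le> B"
    using g by (auto simp: bounded_iff)
  define D where "D m x = (measure_pmf.expectation (P (1 / real (Suc m)) x) g - g x) / (1 / real (Suc m))" for m x
  have lim: "(\<lambda>m. D m x) \<longlonglongrightarrow> A g x" if "x \<in> S" for x
    unfolding D_def using P_deriv_seq[OF g that, of 1] by simp
  have bound: "\<bar>D m x\<bar> \<le> 2 * B * C" if "x \<in> S" for m x
  proof -
    define \<delta> where "\<delta> = 1 / real (Suc m)"
    have \<delta>: "\<delta> > 0" by (simp add: \<delta>_def)
    have "\<bar>D m x\<bar> = \<bar>measure_pmf.expectation (P \<delta> x) g - g x\<bar> / \<delta>"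
      using \<delta> unfolding D_def \<delta>_def[symmetric] by (simp add: abs_divide)
    also have "\<dots> \<le> (2 * B * (C * \<delta>)) / \<delta>"
    proof (rule divide_right_mono)
      show "\<bar>measure_pmf.expectation (P \<delta> x) g - g x\<bar> \<le> 2 * B * (C * \<delta>)"
        using expectation_P_diff_le[of g B x \<delta>] B that \<delta> by (meson less_imp_le)
      show "0 \<le> \<delta>" using \<delta> by simp
    qed
    finally show ?thesis using \<delta> by simp
  qed
  have AE: "AE x in measure_pmf \<nu>. (\<lambda>m. D m x) \<longlonglongrightarrow> A g x"
      "AE x in measure_pmf \<nu>. norm (D m x) \<le> 2 * B * C" for m
    using set_\<nu> lim bound by (auto simp: AE_measure_pmf_iff)
  show "integrable (measure_pmf \<nu>) (A g)"
    by (rule integrable_dominated_convergence[where w="\<lambda>_. 2 * B * C" and s=D]) (use AE in auto)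
  have "(\<lambda>m. measure_pmf.expectation \<nu> (D m)) \<longlonglongrightarrow> measure_pmf.expectation \<nu> (A g)"
    by (rule integral_dominated_convergence[where w="\<lambda>_. 2 * B * C"]) (use AE in auto)
  moreover have "measure_pmf.expectation \<nu> (D m) = 0" for m
    unfolding D_def using expectation_\<nu>_P[OF g, of "1 / real (Suc m)"]
      integrable_pmf_bounded_on[OF g set_\<nu>]
      integrable_pmf_bounded_on[OF bounded_P[OF g, of "1 / real (Suc m)"] set_\<nu>]
    by (simp del: of_nat_Suc)
  ultimately show "measure_pmf.expectation \<nu> (A g) = 0"
    by (simp add: LIMSEQ_const_iff)
qed

text \<open>The second moment of \<open>P t g\<close> under the stationary law decreases in \<open>t\<close>; its decrement
  over unit time dominates the variance of \<open>P t g\<close> under \<open>P 1 x\<close>, so \<open>P t g\<close> becomes constant.\<close>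

lemma expectation_P_tendsto:
  fixes g :: "'a \<Rightarrow> real"
  assumes g: "bounded (g ` S)" and irr: "\<And>x. x \<in> S \<Longrightarrow> reach x = S" and a: "a \<in> S"
  shows "((\<lambda>t. measure_pmf.expectation (P t a) g) \<longlongrightarrow> measure_pmf.expectation \<nu> g) at_top"
proof -
  define h where "h t x = measure_pmf.expectation (P t x) g" for t x
  define V where "V t = measure_pmf.expectation \<nu> (\<lambda>x. (h t x)\<^sup>2)" for t
  obtain B where B: "\<And>x. x \<in> S \<Longrightarrow> \<bar>g x\<bar> \<le> B" using g by (auto simp: bounded_iff)
  have hB: "\<bar>h t x\<bar> \<le> B" if "x \<in> S" "t \<ge> 0" for t x
    unfolding h_def by (rule abs_expectation_le[OF B set_P[OF that]])
  have hb: "bounded (h t ` S)" if "t \<ge> 0" for t using hB that by (auto simp: bounded_iff)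
  have h2b: "bounded ((\<lambda>x. (h t x)\<^sup>2) ` S)" if "t \<ge> 0" for t
  proof -
    have "\<bar>(h t x)\<^sup>2\<bar> \<le> B\<^sup>2" if "x \<in> S" for x
      using power_mono[OF hB[OF that \<open>t \<ge> 0\<close>] abs_ge_zero, of 2] by simp
    then show ?thesis by (auto simp: bounded_iff)
  qed
  have h_add: "h (s + t) x = measure_pmf.expectation (P s x) (h t)" if "x \<in> S" "s \<ge> 0" "t \<ge> 0" for s t x
    unfolding h_def by (rule expectation_P_add[OF g that])
  \<comment> \<open>\<open>v s t x\<close> is the variance of \<open>h t\<close> under
    \<open>P s x\<close>, whose mean is \<open>h (s + t) x\<close>; averaged over the stationary law
    it becomes the decrement of \<open>V\<close>.\<close>
  define v where "v s t x = measure_pmf.expectation (P s x) (\<lambda>y. (h t y)\<^sup>2) -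
    (measure_pmf.expectation (P s x) (h t))\<^sup>2" for s t x
  have drop: "V t - V (s + t) = measure_pmf.expectation \<nu> (v s t)"
    and int_v: "integrable (measure_pmf \<nu>) (v s t)" if "s \<ge> 0" "t \<ge> 0" for s t
  proof -
    have i1: "integrable (measure_pmf \<nu>) (\<lambda>x. measure_pmf.expectation (P s x) (\<lambda>y. (h t y)\<^sup>2))"
      by (rule integrable_pmf_bounded_on[OF bounded_P[OF h2b] set_\<nu>]) (use that in auto)
    have i2: "integrable (measure_pmf \<nu>) (\<lambda>x. (h (s + t) x)\<^sup>2)"
      by (rule integrable_pmf_bounded_on[OF h2b set_\<nu>]) (use that in auto)
    have i3: "integrable (measure_pmf \<nu>) (\<lambda>x. (measure_pmf.expectation (P s x) (h t))\<^sup>2)"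
    proof (subst integrable_cong_AE[OF _ _ , of _ _ "\<lambda>x. (h (s + t) x)\<^sup>2"])
      show "AE x in measure_pmf \<nu>. (measure_pmf.expectation (P s x) (h t))\<^sup>2 = (h (s + t) x)\<^sup>2"
        using set_\<nu> h_add that by (auto simp: AE_measure_pmf_iff)
    qed (use i2 in auto)
    have "V (s + t) = measure_pmf.expectation \<nu> (\<lambda>x. (measure_pmf.expectation (P s x) (h t))\<^sup>2)"
      unfolding V_def using set_\<nu> h_add that by (intro integral_cong_AE) (auto simp: AE_measure_pmf_iff)
    moreover have "V t = measure_pmf.expectation \<nu> (\<lambda>x. measure_pmf.expectation (P s x) (\<lambda>y. (h t y)\<^sup>2))"
      unfolding V_def by (rule expectation_\<nu>_P[OF h2b, symmetric]) (use that in auto)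
    ultimately show "V t - V (s + t) = measure_pmf.expectation \<nu> (v s t)"
      using i1 i3 by (simp add: v_def[abs_def])
    show "integrable (measure_pmf \<nu>) (v s t)" using i1 i3 by (simp add: v_def[abs_def])
  qed
  have v_ge: "v s t x \<ge> pmf (P s x) b * (h t b - h (s + t) x)\<^sup>2" if "s \<ge> 0" "t \<ge> 0" "x \<in> S" for s t x b
    using pmf_mult_square_le_variance[OF hb set_P, of t x s b] h_add that by (simp add: v_def)
  have V_mono: "V (s + t) \<le> V t" if "s \<ge> 0" "t \<ge> 0" for s t
  proof -
    have "v s t x \<ge> 0"
      if "x \<in> S" for x
      using v_ge[OF \<open>s \<ge> 0\<close> \<open>t \<ge> 0\<close> that, of x] by (rule order_trans[rotated]) simp
    then have "0 \<le> V t - V (s + t)"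
      unfolding drop[OF that] using set_\<nu> by (intro integral_nonneg_AE) (auto simp: AE_measure_pmf_iff)
    then show ?thesis by simp
  qed
  have V_nonneg: "V t \<ge> 0" for t unfolding V_def by simp
  have V_lim: "((\<lambda>t. V t - V (1 + t)) \<longlongrightarrow> 0) at_top"
  proof (rule tendsto_sandwich[OF _ _ tendsto_const])
    define I where "I = Inf (V ` {0..})"
    have bdd: "bdd_below (V ` {0..})" using V_nonneg by (auto simp: bdd_below_def)
    have I: "I \<le> V t" if "t \<ge> 0" for t unfolding I_def using bdd that by (intro cINF_lower) auto
    show "\<forall>\<^sub>F t in at_top. 0 \<le> V t - V (1 + t)"
      using eventually_ge_at_top[of 0] by eventually_elim (use V_mono in auto)
    show "\<forall>\<^sub>F t in at_top. V t - V (1 + t) \<le> V t - I"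
      using eventually_ge_at_top[of 0] by eventually_elim (use I in auto)
    show "((\<lambda>t. V t - I) \<longlongrightarrow> 0) at_top"
    proof (rule decreasing_tendsto)
      show "\<forall>\<^sub>F t in at_top. 0 \<le> V t - I"
        using eventually_ge_at_top[of 0] by eventually_elim (use I in auto)
      fix e :: real assume "0 < e"
      then have "Inf (V ` {0..}) < I + e" by (simp add: I_def)
      then obtain T where T: "T \<ge> 0" "V T < I + e"
        using bdd by (subst (asm) cINF_less_iff) auto
      show "\<forall>\<^sub>F t in at_top. V t - I < e"
        using eventually_ge_at_top[of T]
      proof eventually_elim
        case (elim t)
        then show ?case using V_mono[of "t - T" T] T by simp
      qed
    qed
  qed
  obtain x where x: "x \<in> set_pmf \<nu>" using set_pmf_not_empty[of \<nu>] by blast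
  then have xS: "x \<in> S" and \<nu>x: "pmf \<nu> x > 0" using set_\<nu> by (auto simp: pmf_positive_iff)
  have merge: "((\<lambda>t. h t b - h (1 + t) x) \<longlongrightarrow> 0) at_top" if b: "b \<in> S" for b
  proof -
    \<comment> \<open>The stationary weight of a transition from \<open>x\<close> to
      \<open>b\<close> in unit time: positive by irreducibility and independent of \<open>t\<close>,
      so the squared difference is at most the decrement of \<open>V\<close> divided by
      \<open>c\<close>.\<close>
    define c where "c = pmf \<nu> x * pmf (P 1 x) b"
    have "b \<in> reach x" using irr[OF xS] b by simp
    then have c: "c > 0" unfolding c_def using \<nu>x by (simp add: reach_def)
    have "((\<lambda>t. (h t b - h (1 + t) x)\<^sup>2) \<longlongrightarrow> 0) at_top"
    proof (rule tendsto_sandwich[OF _ _ tendsto_const])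
      show "((\<lambda>t. (V t - V (1 + t)) / c) \<longlongrightarrow> 0) at_top"
        using tendsto_divide[OF V_lim tendsto_const, of c] c by simp
      show "\<forall>\<^sub>F t in at_top. (h t b - h (1 + t) x)\<^sup>2 \<le> (V t - V (1 + t)) / c"
        using eventually_ge_at_top[of 0]
      proof eventually_elim
        case (elim t)
        have "(\<integral>y. (pmf (P 1 x) b * (h t b - h (1 + t) x)\<^sup>2) * indicator {x} y \<partial>measure_pmf \<nu>) \<le> V t - V (1 + t)"
          unfolding drop[OF zero_le_one elim]
        proof (rule integral_mono_AE)
          have "0 \<le> v 1 t y"
            if "y \<in> S" for y
            using v_ge[OF zero_le_one elim that, of y] by (rule order_trans[rotated]) simp
          then show "AE y in measure_pmf \<nu>. (pmf (P 1 x) b * (h t b - h (1 + t) x)\<^sup>2) * indicator {x} y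
            \<le> v 1 t y"
            using set_\<nu> v_ge[OF zero_le_one elim xS]
            by (auto simp: AE_measure_pmf_iff indicator_def)
        qed (use int_v[OF zero_le_one elim] in \<open>auto intro: integrable_indicator_pmf\<close>)
        then show ?case using c by (simp add: c_def measure_pmf_single field_simps)
      qed
    qed auto
    from tendsto_real_sqrt[OF this] show ?thesis by (simp add: tendsto_rabs_zero_iff)
  qed
  have diff: "((\<lambda>t. h t a - h t b) \<longlongrightarrow> 0) at_top" if "b \<in> S" for b
    using tendsto_diff[OF merge[OF a] merge[OF that]] by simp
  \<comment> \<open>Clipping at 0 keeps the bound \<open>2 * B\<close> valid for negative times too,
    where nothing is known about \<open>P\<close>.\<close>
  define d where "d t y = h (max 0 t) a - h (max 0 t) y" for t y
  have "((\<lambda>t. measure_pmf.expectation \<nu> (d t)) \<longlongrightarrow> measure_pmf.expectation \<nu> (\<lambda>_. 0::real)) at_top"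
  proof (rule integral_dominated_convergence_at_top[where w="\<lambda>_. 2 * B"])
    have "((\<lambda>t. d t y) \<longlongrightarrow> 0) at_top" if "y \<in> S" for y
      by (rule Lim_transform_eventually[OF diff[OF that]])
         (use eventually_ge_at_top[of 0] in eventually_elim, auto simp: d_def)
    then show "AE y in measure_pmf \<nu>. ((\<lambda>t. d t y) \<longlongrightarrow> 0) at_top"
      using set_\<nu> by (auto simp: AE_measure_pmf_iff)
    have "\<bar>d t y\<bar> \<le> 2 * B" if "y \<in> S" for t y
      using hB[OF that, of "max 0 t"] hB[OF a, of "max 0 t"] by (simp add: d_def)
    then show "\<forall>\<^sub>F t in at_top. AE y in measure_pmf \<nu>. norm (d t y) \<le> 2 * B"
      using set_\<nu> by (intro always_eventually) (auto simp: AE_measure_pmf_iff)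
  qed auto
  then have "((\<lambda>t. measure_pmf.expectation \<nu> g + measure_pmf.expectation \<nu> (d t))
      \<longlongrightarrow> measure_pmf.expectation \<nu> g) at_top"
    using tendsto_add[OF tendsto_const] by fastforce
  then show ?thesis
  proof (rule Lim_transform_eventually)
    show "\<forall>\<^sub>F t in at_top. measure_pmf.expectation \<nu> g + measure_pmf.expectation \<nu> (d t) =
        measure_pmf.expectation (P t a) g"
      using eventually_ge_at_top[of 0]
    proof eventually_elim
      case (elim t)
      have "measure_pmf.expectation \<nu> (d t) = h t a - measure_pmf.expectation \<nu> (h t)"
        using elim integrable_pmf_bounded_on[OF hb[OF elim] set_\<nu>] by (simp add: d_def[abs_def])
      also have "measure_pmf.expectation \<nu> (h t) = measure_pmf.expectation \<nu> g"
        unfolding h_def by (rule expectation_\<nu>_P[OF g elim])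
      finally show ?case by (simp add: h_def)
    qed
  qed
qed

end

section \<open>Excess of a uniform sample\<close>

lemma alternating_choose_sum_zero:
  assumes "N \<le> K"
  shows "(\<Sum>j\<le>K. (- 1) ^ j * real ((a + j) choose j) * real (N choose (a + j))) = (if N = a then 1 else 0)"
proof (cases "a \<le> N")
  case True
  \<comment> \<open>Trinomial revision: \<open>N choose a\<close> factors out and an alternating row
    sum of binomials is left.\<close>
  have eq: "real ((a + j) choose j) * real (N choose (a + j)) = real (N choose a) * real ((N - a) choose j)" for j
  proof (cases "a + j \<le> N")
    case le: True
    have "(N choose (a + j)) * ((a + j) choose a) = (N choose a) * ((N - a) choose (a + j - a))"
      by (rule choose_mult) (use le in auto)
    moreover have "(a + j) choose a = (a + j) choose j"
      by (metis add_diff_cancel_left' binomial_symmetric le_add1)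
    ultimately show ?thesis by (simp flip: of_nat_mult add: mult.commute)
  qed (auto simp: binomial_eq_0)
  have "(\<Sum>j\<le>K. (- 1) ^ j * real ((a + j) choose j) * real (N choose (a + j))) =
      real (N choose a) * (\<Sum>j\<le>K. (- 1) ^ j * real ((N - a) choose j))"
    by (simp add: sum_distrib_left mult.assoc eq) (simp add: mult_ac)
  also have "(\<Sum>j\<le>K. (- 1) ^ j * real ((N - a) choose j)) = (\<Sum>j\<le>N-a. (- 1) ^ j * real ((N - a) choose j))"
    using assms by (intro sum.mono_neutral_right) (auto simp: binomial_eq_0)
  also have "\<dots> = (if N = a then 1 else 0)"
    using True choose_alternating_sum[of "N - a", where 'a=real] by auto
  finally show ?thesis by auto
qed (auto simp: binomial_eq_0)

text \<open>The three identities are successive discrete primitives in \<open>N\<close>: by Pascal's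
  rule, raising \<open>N\<close> by one adds the sum of the previous identity. The range
  \<open>{..K}\<close> is kept free of \<open>N\<close> so that the induction compares sums of equal
  length.\<close>

lemma alternating_choose_sum_one:
  assumes "N \<le> K"
  shows "(\<Sum>j\<le>K. (- 1) ^ j * real ((a + j) choose j) * real (N choose (Suc a + j))) = (if N \<ge> Suc a then 1 else 0)"
  using assms
proof (induction N)
  case (Suc N)
  have "(\<Sum>j\<le>K. (- 1) ^ j * real ((a + j) choose j) * real (Suc N choose (Suc a + j))) =
    (\<Sum>j\<le>K. (- 1) ^ j * real ((a + j) choose j) * real (N choose (Suc a + j))) +
    (\<Sum>j\<le>K. (- 1) ^ j * real ((a + j) choose j) * real (N choose (a + j)))"
    by (simp add: sum.distrib[symmetric] algebra_simps)
  also have "\<dots> = (if N \<ge> Suc a then 1 else 0) + (if N = a then 1 else 0)"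
    using Suc alternating_choose_sum_zero[of N K a] by simp
  finally show ?case by auto
qed simp

lemma diff_eq_alternating_choose_sum:
  assumes "N \<le> K"
  shows "real (N - Suc a) = (\<Sum>j\<le>K. (- 1) ^ j * real ((a + j) choose j) * real (N choose (Suc (Suc a) + j)))"
  using assms
proof (induction N)
  case (Suc N)
  have "(\<Sum>j\<le>K. (- 1) ^ j * real ((a + j) choose j) * real (Suc N choose (Suc (Suc a) + j))) =
    (\<Sum>j\<le>K. (- 1) ^ j * real ((a + j) choose j) * real (N choose (Suc (Suc a) + j))) +
    (\<Sum>j\<le>K. (- 1) ^ j * real ((a + j) choose j) * real (N choose (Suc a + j)))"
    by (simp add: sum.distrib[symmetric] algebra_simps)
  also have "\<dots> = real (N - Suc a) + (if N \<ge> Suc a then 1 else 0)"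
    using Suc alternating_choose_sum_one[of N K a] by simp
  finally show ?case by auto
qed simp

text \<open>Newton coefficient of the truncated difference at \<open>N choose (L - k + i)\<close>.
  \<open>f_fun\<close> and \<open>sampled_excess\<close> share these coefficients; the first
  multiplies them by powers, the second by quotients of binomials.\<close>

definition f_coeff :: "nat \<Rightarrow> nat \<Rightarrow> nat \<Rightarrow> real" where
  "f_coeff L k i = real ((L - k + i - 2) choose (i - 1)) * (- 1) ^ (i - 1)"

lemma diff_eq_f_coeff_sum:
  assumes "k < L" "N \<le> L"
  shows "real (N - (L - k)) = (\<Sum>i=1..k. f_coeff L k i * real (N choose (L - k + i)))"
proof -
  define a where "a = L - k - 1"
  have a: "L - k = Suc a" using assms by (simp add: a_def)
  have "real (N - (L - k)) = (\<Sum>j\<le>L. (- 1) ^ j * real ((a + j) choose j) * real (N choose (Suc (Suc a) + j)))"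
    unfolding a by (rule diff_eq_alternating_choose_sum[OF assms(2)])
  \<comment> \<open>For \<open>j \<ge> k\<close> the lower index \<open>Suc (Suc a) + j\<close>
    exceeds \<open>L\<close>, hence \<open>N\<close>.\<close>
  also have "\<dots> = (\<Sum>j<k. (- 1) ^ j * real ((a + j) choose j) * real (N choose (Suc (Suc a) + j)))"
  proof (rule sum.mono_neutral_right)
    show "\<forall>j\<in>{..L} - {..<k}. (- 1) ^ j * real ((a + j) choose j) * real (N choose (Suc (Suc a) + j)) = 0"
      using assms a by (auto simp: binomial_eq_0)
  qed (use assms in auto)
  also have "\<dots> = (\<Sum>i=1..k. f_coeff L k i * real (N choose (L - k + i)))"
    by (rule sum.reindex_bij_witness[of _ "\<lambda>i. i - 1" Suc]) (auto simp: f_coeff_def a)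
  finally show ?thesis .
qed

lemma f_fun_eq: "f_fun L k x = (\<Sum>i=1..k. f_coeff L k i * real (L choose (L - k + i)) * x ^ (L - k + i))"
  by (simp add: f_fun_def f_coeff_def mult_ac)

section \<open>Counting in uniform subsets\<close>

definition subsets_of_size :: "nat \<Rightarrow> nat \<Rightarrow> nat set set" where
  "subsets_of_size n L = {S. S \<subseteq> {..<n} \<and> card S = L}"

lemma finite_subsets_of_size [simp, intro]: "finite (subsets_of_size n L)"
  unfolding subsets_of_size_def by (rule finite_subset[of _ "Pow {..<n}"]) auto

lemma card_subsets_of_size: "card (subsets_of_size n L) = n choose L"
  unfolding subsets_of_size_def using n_subsets[of "{..<n}" L] by simp

lemma card_supersets_of_size:
  assumes "T \<subseteq> {..<n}" "card T = s" "s \<le> L"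
  shows "card {S \<in> subsets_of_size n L. T \<subseteq> S} = (n - s) choose (L - s)"
proof -
  have fin: "finite T" using assms finite_subset by auto
  have "bij_betw (\<lambda>S. S - T) {S \<in> subsets_of_size n L. T \<subseteq> S} {R. R \<subseteq> {..<n} - T \<and> card R = L - s}"
  proof (rule bij_betw_byWitness[where f'="\<lambda>R. R \<union> T"])
    show "(\<lambda>S. S - T) ` {S \<in> subsets_of_size n L. T \<subseteq> S} \<subseteq> {R. R \<subseteq> {..<n} - T \<and> card R = L - s}"
      using assms fin by (auto simp: subsets_of_size_def card_Diff_subset)
    show "(\<lambda>R. R \<union> T) ` {R. R \<subseteq> {..<n} - T \<and> card R = L - s} \<subseteq> {S \<in> subsets_of_size n L. T \<subseteq> S}"
    proof safe
      fix R assume R: "R \<subseteq> {..<n} - T" "card R = L - s"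
      then have "finite R" using finite_subset[of R "{..<n} - T"] by auto
      then have "card (R \<union> T) = L" using R assms fin by (subst card_Un_disjoint) auto
      then show "R \<union> T \<in> subsets_of_size n L" using R assms by (auto simp: subsets_of_size_def)
    qed
  qed auto
  then have "card {S \<in> subsets_of_size n L. T \<subseteq> S} = card {R. R \<subseteq> {..<n} - T \<and> card R = L - s}"
    by (rule bij_betw_same_card)
  also have "\<dots> = (n - s) choose (L - s)"
    using n_subsets[of "{..<n} - T" "L - s"] assms fin by (simp add: card_Diff_subset)
  finally show ?thesis .
qed

text \<open>Double counting of the pairs \<open>(S, T)\<close> with \<open>T\<close> an
  \<open>s\<close>-element subset of \<open>S \<inter> B\<close>: each \<open>T\<close> lies in
  \<open>(n - s) choose (L - s)\<close> of the sets \<open>S\<close>. These are the factorial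
  moments of the hypergeometric law.\<close>

lemma sum_choose_inter:
  assumes "B \<subseteq> {..<n}" "s \<le> L"
  shows "(\<Sum>S\<in>subsets_of_size n L. card (S \<inter> B) choose s) = (card B choose s) * ((n - s) choose (L - s))"
proof -
  let ?T = "{T. T \<subseteq> B \<and> card T = s}"
  have finB: "finite B" using assms finite_subset by auto
  have finT: "finite ?T" by (rule finite_subset[of _ "Pow B"]) (use finB in auto)
  have "(\<Sum>S\<in>subsets_of_size n L. card (S \<inter> B) choose s) =
      (\<Sum>S\<in>subsets_of_size n L. \<Sum>T\<in>?T. if T \<subseteq> S then 1 else 0)"
  proof (rule sum.cong[OF refl])
    fix S
    have "(card (S \<inter> B) choose s) = card {T. T \<subseteq> S \<inter> B \<and> card T = s}"
      using n_subsets[of "S \<inter> B" s] finB by simp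
    also have "{T. T \<subseteq> S \<inter> B \<and> card T = s} = {T \<in> ?T. T \<subseteq> S}" by auto
    finally show "(card (S \<inter> B) choose s) = (\<Sum>T\<in>?T. if T \<subseteq> S then 1 else 0)"
      using finT by (simp add: sum.If_cases Int_def)
  qed
  also have "\<dots> = (\<Sum>T\<in>?T. card {S \<in> subsets_of_size n L. T \<subseteq> S})"
    by (subst sum.swap) (simp add: sum.If_cases Int_def)
  also have "\<dots> = (\<Sum>T\<in>?T. (n - s) choose (L - s))"
    using assms by (intro sum.cong card_supersets_of_size) auto
  also have "\<dots> = (card B choose s) * ((n - s) choose (L - s))"
    using n_subsets[OF finB, of s] by simp
  finally show ?thesis .
qed

text \<open>The marked set is an initial segment, so that monotonicity in \<open>m\<close> is
  inclusion of sets; \<open>sum_card_inter_excess\<close> passes to an arbitrary set of the same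
  size.\<close>

definition sampled_excess :: "nat \<Rightarrow> nat \<Rightarrow> nat \<Rightarrow> nat \<Rightarrow> real" where
  "sampled_excess L k n m = (\<Sum>S\<in>subsets_of_size n L. real (card (S \<inter> {..<m}) - (L - k))) / real (n choose L)"

lemma sum_choose_quotient:
  assumes "k < L" "L \<le> n" "B \<subseteq> {..<n}"
  shows "(\<Sum>S\<in>subsets_of_size n L. real (card (S \<inter> B) - (L - k))) / real (n choose L) =
    (\<Sum>i=1..k. f_coeff L k i * real (L choose (L - k + i)) *
      (real (card B choose (L - k + i)) / real (n choose (L - k + i))))"
proof -
  have "(\<Sum>S\<in>subsets_of_size n L. real (card (S \<inter> B) - (L - k))) =
      (\<Sum>S\<in>subsets_of_size n L. \<Sum>i=1..k. f_coeff L k i * real (card (S \<inter> B) choose (L - k + i)))"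
  proof (rule sum.cong[OF refl])
    fix S assume "S \<in> subsets_of_size n L"
    then have "finite S" "card S = L" by (auto simp: subsets_of_size_def finite_subset)
    then have "card (S \<inter> B) \<le> L" using card_mono[of S "S \<inter> B"] by auto
    then show "real (card (S \<inter> B) - (L - k)) = (\<Sum>i=1..k. f_coeff L k i * real (card (S \<inter> B) choose (L - k + i)))"
      by (rule diff_eq_f_coeff_sum[OF assms(1)])
  qed
  also have "\<dots> = (\<Sum>i=1..k. f_coeff L k i * (\<Sum>S\<in>subsets_of_size n L. real (card (S \<inter> B) choose (L - k + i))))"
    by (subst sum.swap) (simp add: sum_distrib_left)
  also have "\<dots> = (\<Sum>i=1..k. f_coeff L k i * (real (card B choose (L - k + i)) * real ((n - (L - k + i)) choose (L - (L - k + i)))))"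
  proof (rule sum.cong[OF refl])
    fix i assume "i \<in> {1..k}"
    then have "L - k + i \<le> L" using assms by auto
    from sum_choose_inter[OF assms(3) this]
    show "f_coeff L k i * (\<Sum>S\<in>subsets_of_size n L. real (card (S \<inter> B) choose (L - k + i))) =
      f_coeff L k i * (real (card B choose (L - k + i)) * real ((n - (L - k + i)) choose (L - (L - k + i))))"
      by (simp flip: of_nat_sum of_nat_mult)
  qed
  finally have "(\<Sum>S\<in>subsets_of_size n L. real (card (S \<inter> B) - (L - k))) / real (n choose L) =
      (\<Sum>i=1..k. f_coeff L k i * (real (card B choose (L - k + i)) *
        (real ((n - (L - k + i)) choose (L - (L - k + i))) / real (n choose L))))"
    by (simp add: sum_divide_distrib)
  also have "\<dots> = (\<Sum>i=1..k. f_coeff L k i * real (L choose (L - k + i)) *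
      (real (card B choose (L - k + i)) / real (n choose (L - k + i))))"
  proof (rule sum.cong[OF refl])
    fix i assume i: "i \<in> {1..k}"
    define s where "s = L - k + i"
    have s: "s \<le> L" using assms i by (auto simp: s_def)
    \<comment> \<open>This rewrites the chance that a fixed \<open>s\<close>-set lies in the sample
      as \<open>L choose s\<close> over \<open>n choose s\<close>, which separates \<open>n\<close>
      from \<open>L\<close>.\<close>
    have "real (n choose L) * real (L choose s) = real (n choose s) * real ((n - s) choose (L - s))"
      using choose_mult[OF s assms(2)] by (simp flip: of_nat_mult)
    moreover have "real (n choose L) > 0" "real (n choose s) > 0" using assms s by (auto simp: zero_less_binomial)
    ultimately have "real ((n - s) choose (L - s)) / real (n choose L) = real (L choose s) / real (n choose s)"
      by (simp add: field_simps)
    then show "f_coeff L k i * (real (card B choose (L - k + i)) *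
        (real ((n - (L - k + i)) choose (L - (L - k + i))) / real (n choose L))) =
      f_coeff L k i * real (L choose (L - k + i)) *
        (real (card B choose (L - k + i)) / real (n choose (L - k + i)))"
      unfolding s_def[symmetric] by simp
  qed
  finally show ?thesis .
qed

lemma sampled_excess_eq:
  assumes "k < L" "L \<le> n" "m \<le> n"
  shows "sampled_excess L k n m = (\<Sum>i=1..k. f_coeff L k i * real (L choose (L - k + i)) *
      (real (m choose (L - k + i)) / real (n choose (L - k + i))))"
  using sum_choose_quotient[OF assms(1,2), of "{..<m}"] assms(3) by (simp add: sampled_excess_def)

lemma sum_card_inter_excess:
  assumes "k < L" "L \<le> n" "B \<subseteq> {..<n}"
  shows "(\<Sum>S\<in>subsets_of_size n L. real (card (S \<inter> B) - (L - k))) / real (n choose L) =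
    sampled_excess L k n (card B)"
proof -
  have "card B \<le> n" using card_mono[OF _ assms(3)] by simp
  then show ?thesis using sum_choose_quotient[OF assms] sampled_excess_eq[OF assms(1,2)] by simp
qed

lemma finite_in_subsets_of_size: "S \<in> subsets_of_size n L \<Longrightarrow> finite S"
  by (auto simp: subsets_of_size_def intro: finite_subset)

lemma sampled_excess_mono:
  assumes "m \<le> m'"
  shows "sampled_excess L k n m \<le> sampled_excess L k n m'"
  unfolding sampled_excess_def
  using assms by (intro divide_right_mono sum_mono of_nat_mono diff_le_mono card_mono)
    (auto dest: finite_in_subsets_of_size)

lemma sampled_excess_nonneg: "sampled_excess L k n m \<ge> 0"
  unfolding sampled_excess_def by (simp add: sum_nonneg)

text \<open>By convexity the truncated difference of \<open>t\<close> and \<open>L - k\<close> lies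
  below the chord \<open>k / L * t\<close> on \<open>[0, L]\<close>, with equality at both ends. The
  mean number of marked elements in the sample is \<open>L * m / n\<close>.\<close>

lemma sampled_excess_le:
  assumes "1 \<le> k" "k < L" "L \<le> n" "m \<le> n"
  shows "sampled_excess L k n m \<le> real k * (real m / real n)"
proof -
  have "real (card (S \<inter> {..<m}) - (L - k)) \<le> real k / real L * real (card (S \<inter> {..<m}))"
    if S: "S \<in> subsets_of_size n L" for S
  proof -
    define t where "t = card (S \<inter> {..<m})"
    have "t \<le> card S" unfolding t_def using finite_in_subsets_of_size[OF S] by (intro card_mono) auto
    then have t: "t \<le> L" using S by (simp add: subsets_of_size_def)
    have "real (t - (L - k)) \<le> real k / real L * real t"
    proof (cases "t \<le> L - k")
      case False
      then have "real (t - (L - k)) = real t - (real L - real k)" using assms by (simp add: of_nat_diff)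
      moreover have "(real L - real k) * (real L - real t) \<ge> 0" using assms t by simp
      ultimately show ?thesis using assms by (simp add: field_simps)
    qed simp
    then show ?thesis by (simp add: t_def)
  qed
  then have "(\<Sum>S\<in>subsets_of_size n L. real (card (S \<inter> {..<m}) - (L - k))) \<le>
      (\<Sum>S\<in>subsets_of_size n L. real k / real L * real (card (S \<inter> {..<m})))"
    by (rule sum_mono)
  also have "\<dots> = real k / real L * real (\<Sum>S\<in>subsets_of_size n L. card (S \<inter> {..<m}) choose 1)"
    by (simp add: sum_distrib_left)
  also have "\<dots> = real k / real L * (real m * real ((n - 1) choose (L - 1)))"
    using sum_choose_inter[of "{..<m}" n 1 L] assms by simp
  finally have "sampled_excess L k n m \<le> real k / real L * (real m * real ((n - 1) choose (L - 1))) / real (n choose L)"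
    unfolding sampled_excess_def by (rule divide_right_mono) simp
  also have "\<dots> = real k * (real m / real n)"
  proof -
    have "real L * real (n choose L) = real n * real ((n - 1) choose (L - 1))"
      using binomial_absorption[of "L - 1" n] assms by (simp flip: of_nat_mult)
    moreover have "real (n choose L) > 0" using assms by (simp add: zero_less_binomial)
    ultimately show ?thesis using assms by (simp add: field_simps)
  qed
  finally show ?thesis .
qed

section \<open>Binomial quotients against powers\<close>

lemma choose_quotient_eq_prod:
  assumes "s \<le> n"
  shows "real (m choose s) / real (n choose s) = (\<Prod>i<s. (real m - real i) / (real n - real i))"
  using assms by (simp add: binomial_gbinomial gbinomial_prod_rev prod_dividef atLeast0LessThan)

text \<open>The factor \<open>(m - i) / (n - i)\<close> misses \<open>m / n\<close> by
  \<open>i / (n - i) * (1 - m / n)\<close>; dropping the last factor makes the error uniform in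
  \<open>m\<close>.\<close>

definition choose_error :: "nat \<Rightarrow> nat \<Rightarrow> real" where
  "choose_error s n = (\<Sum>i<s. real i / (real n - real i))"

lemma choose_error_tendsto: "(\<lambda>n. choose_error s n) \<longlonglongrightarrow> 0"
proof -
  have "(\<lambda>n. real i / (real n - real i)) \<longlonglongrightarrow> 0" for i
  proof (rule tendsto_divide_0[OF tendsto_const], rule filterlim_at_top_imp_at_infinity)
    show "filterlim (\<lambda>n. real n - real i) at_top sequentially"
      using filterlim_tendsto_add_at_top[OF tendsto_const[of "- real i"] filterlim_real_sequentially]
      by simp
  qed
  then have "(\<lambda>n. \<Sum>i<s. real i / (real n - real i)) \<longlonglongrightarrow> (\<Sum>i<s. 0)" by (intro tendsto_sum)
  then show ?thesis by (simp add: choose_error_def)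
qed

lemma choose_quotient_approx:
  assumes "2 * s \<le> n" "m \<le> n" "1 \<le> n"
  shows "\<bar>real (m choose s) / real (n choose s) - (real m / real n) ^ s\<bar> \<le> choose_error s n"
proof -
  have "norm ((\<Prod>i<s. (real m - real i) / (real n - real i)) - (\<Prod>i<s. real m / real n)) \<le>
      (\<Sum>i<s. norm ((real m - real i) / (real n - real i) - real m / real n))"
  proof (rule norm_prod_diff)
    fix i assume "i \<in> {..<s}"
    \<comment> \<open>\<open>m\<close> may be smaller than \<open>i\<close>, which makes the factor
      negative; \<open>2 * i \<le> n\<close> still keeps it at least -1.\<close>
    then have "2 * real i \<le> real n" "real i < real n" using assms by auto
    then show "norm ((real m - real i) / (real n - real i)) \<le> 1"
      using assms by (simp add: abs_if field_simps)
    show "norm (real m / real n) \<le> 1" using assms by simp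
  qed
  also have "\<dots> \<le> choose_error s n"
    unfolding choose_error_def
  proof (rule sum_mono)
    fix i assume "i \<in> {..<s}"
    then have i: "real i < real n" using assms by auto
    have "(real m - real i) / (real n - real i) - real m / real n = - (real i / (real n - real i) * (1 - real m / real n))"
      using i by (simp add: field_simps)
    then have "norm ((real m - real i) / (real n - real i) - real m / real n) = real i / (real n - real i) * (1 - real m / real n)"
      using i assms by (simp add: abs_mult)
    also have "\<dots> \<le> real i / (real n - real i) * 1"
      using i by (intro mult_left_mono) auto
    finally show "norm ((real m - real i) / (real n - real i) - real m / real n) \<le> real i / (real n - real i)" by simp
  qed
  finally show ?thesis using assms by (simp add: choose_quotient_eq_prod)
qed

definition excess_error :: "nat \<Rightarrow> nat \<Rightarrow> nat \<Rightarrow> real" where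
  "excess_error L k n = (\<Sum>i=1..k. \<bar>f_coeff L k i\<bar> * real (L choose (L - k + i)) * choose_error (L - k + i) n)"

lemma excess_error_tendsto: "excess_error L k \<longlonglongrightarrow> 0"
proof -
  have "(\<lambda>n. \<Sum>i=1..k. \<bar>f_coeff L k i\<bar> * real (L choose (L - k + i)) * choose_error (L - k + i) n) \<longlonglongrightarrow>
      (\<Sum>i=1..k. \<bar>f_coeff L k i\<bar> * real (L choose (L - k + i)) * 0)"
    by (intro tendsto_intros choose_error_tendsto)
  then show ?thesis by (simp add: excess_error_def[abs_def])
qed

lemma sampled_excess_approx:
  assumes "1 \<le> k" "k < L" "2 * L \<le> n" "m \<le> n"
  shows "\<bar>sampled_excess L k n m - f_fun L k (real m / real n)\<bar> \<le> excess_error L k n"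
proof -
  have "\<bar>sampled_excess L k n m - f_fun L k (real m / real n)\<bar> =
      \<bar>\<Sum>i=1..k. f_coeff L k i * real (L choose (L - k + i)) *
        (real (m choose (L - k + i)) / real (n choose (L - k + i)) - (real m / real n) ^ (L - k + i))\<bar>"
    using assms by (simp add: sampled_excess_eq f_fun_eq sum_subtractf right_diff_distrib)
  also have "\<dots> \<le> (\<Sum>i=1..k. \<bar>f_coeff L k i * real (L choose (L - k + i)) *
        (real (m choose (L - k + i)) / real (n choose (L - k + i)) - (real m / real n) ^ (L - k + i))\<bar>)"
    by (rule sum_abs)
  also have "\<dots> \<le> excess_error L k n"
    unfolding excess_error_def
  proof (rule sum_mono)
    fix i assume "i \<in> {1..k}"
    then have "i \<le> k" by simp
    then have "2 * (L - k + i) \<le> n" using assms(2,3) by arith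
    then have "\<bar>real (m choose (L - k + i)) / real (n choose (L - k + i)) - (real m / real n) ^ (L - k + i)\<bar>
        \<le> choose_error (L - k + i) n"
      by (rule choose_quotient_approx) (use assms in linarith)+
    then show "\<bar>f_coeff L k i * real (L choose (L - k + i)) *
        (real (m choose (L - k + i)) / real (n choose (L - k + i)) - (real m / real n) ^ (L - k + i))\<bar> \<le>
      \<bar>f_coeff L k i\<bar> * real (L choose (L - k + i)) * choose_error (L - k + i) n"
      unfolding abs_mult abs_of_nat by (rule mult_left_mono) simp
  qed
  finally show ?thesis .
qed

text \<open>Realises any \<open>x\<close> in \<open>[0, 1]\<close> as a limit of fractions
  \<open>m / n\<close>. Properties of \<open>sampled_excess\<close> that are clear for each sample
  thereby reach \<open>f_fun\<close>.\<close>

lemma sampled_excess_floor_tendsto: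
  assumes "1 \<le> k" "k < L" "0 \<le> x" "x \<le> 1"
  shows "(\<lambda>n. sampled_excess L k n (nat \<lfloor>real n * x\<rfloor>)) \<longlonglongrightarrow> f_fun L k x"
    and "nat \<lfloor>real n * x\<rfloor> \<le> n"
proof -
  have le: "nat \<lfloor>real n * x\<rfloor> \<le> n" for n
  proof -
    have "real n * x \<le> real n * 1" using assms by (intro mult_left_mono) auto
    then show ?thesis by linarith
  qed
  then show "nat \<lfloor>real n * x\<rfloor> \<le> n" .
  have "(\<lambda>n. real (nat \<lfloor>real n * x\<rfloor>) / real n) \<longlonglongrightarrow> x"
  proof (rule tendsto_sandwich)
    show "\<forall>\<^sub>F n in sequentially. x - 1 / real n \<le> real (nat \<lfloor>real n * x\<rfloor>) / real n"
      using eventually_gt_at_top[of 0]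
    proof eventually_elim
      case (elim n)
      have "real n * x - 1 \<le> real (nat \<lfloor>real n * x\<rfloor>)" using assms by linarith
      then have "(real n * x - 1) / real n \<le> real (nat \<lfloor>real n * x\<rfloor>) / real n"
        by (rule divide_right_mono) simp
      then show ?case using elim by (simp add: diff_divide_distrib)
    qed
    show "\<forall>\<^sub>F n in sequentially. real (nat \<lfloor>real n * x\<rfloor>) / real n \<le> x"
      using eventually_gt_at_top[of 0]
    proof eventually_elim
      case (elim n)
      have "real (nat \<lfloor>real n * x\<rfloor>) \<le> real n * x" using assms by simp
      then show ?case using elim by (simp add: field_simps)
    qed
    show "(\<lambda>n. x - 1 / real n) \<longlonglongrightarrow> x"
      using tendsto_diff[OF tendsto_const lim_1_over_n, of x] by simp
  qed simp
  then have lim: "(\<lambda>n. f_fun L k (real (nat \<lfloor>real n * x\<rfloor>) / real n)) \<longlonglongrightarrow> f_fun L k x"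
    unfolding f_fun_eq by (intro tendsto_intros)
  have "(\<lambda>n. sampled_excess L k n (nat \<lfloor>real n * x\<rfloor>) - f_fun L k (real (nat \<lfloor>real n * x\<rfloor>) / real n)) \<longlonglongrightarrow> 0"
  proof (rule Lim_null_comparison[OF _ excess_error_tendsto[of L k]])
    show "\<forall>\<^sub>F n in sequentially. norm (sampled_excess L k n (nat \<lfloor>real n * x\<rfloor>) - f_fun L k (real (nat \<lfloor>real n * x\<rfloor>) / real n)) \<le> excess_error L k n"
      using eventually_ge_at_top[of "2 * L"]
      by eventually_elim (use sampled_excess_approx[OF assms(1,2) _ le] in auto)
  qed
  from tendsto_add[OF this lim] show "(\<lambda>n. sampled_excess L k n (nat \<lfloor>real n * x\<rfloor>)) \<longlonglongrightarrow> f_fun L k x"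
    by simp
qed

lemma f_fun_mono:
  assumes "1 \<le> k" "k < L" "0 \<le> x" "x \<le> y" "y \<le> 1"
  shows "f_fun L k x \<le> f_fun L k y"
proof (rule LIMSEQ_le)
  show "(\<lambda>n. sampled_excess L k n (nat \<lfloor>real n * x\<rfloor>)) \<longlonglongrightarrow> f_fun L k x"
    "(\<lambda>n. sampled_excess L k n (nat \<lfloor>real n * y\<rfloor>)) \<longlonglongrightarrow> f_fun L k y"
    by (rule sampled_excess_floor_tendsto(1); use assms in linarith)+
  have "sampled_excess L k n (nat \<lfloor>real n * x\<rfloor>) \<le> sampled_excess L k n (nat \<lfloor>real n * y\<rfloor>)" for n
    using assms by (intro sampled_excess_mono nat_mono floor_mono mult_left_mono) auto
  then show "\<exists>N. \<forall>n\<ge>N. sampled_excess L k n (nat \<lfloor>real n * x\<rfloor>) \<le> sampled_excess L k n (nat \<lfloor>real n * y\<rfloor>)"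
    by blast
qed

lemma f_fun_nonneg:
  assumes "1 \<le> k" "k < L" "0 \<le> x" "x \<le> 1"
  shows "0 \<le> f_fun L k x"
  by (rule LIMSEQ_le_const[OF sampled_excess_floor_tendsto(1)[OF assms]]) (simp add: sampled_excess_nonneg)

lemma f_fun_le:
  assumes "1 \<le> k" "k < L" "0 \<le> x" "x \<le> 1"
  shows "f_fun L k x \<le> real k * x"
proof (rule LIMSEQ_le_const2[OF sampled_excess_floor_tendsto(1)[OF assms]], intro exI[of _ L] allI impI)
  fix n assume n: "L \<le> n"
  have "sampled_excess L k n (nat \<lfloor>real n * x\<rfloor>) \<le> real k * (real (nat \<lfloor>real n * x\<rfloor>) / real n)"
    using assms(1,2) n sampled_excess_floor_tendsto(2)[OF assms] by (rule sampled_excess_le)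
  also have "\<dots> \<le> real k * x"
    using assms n by (intro mult_left_mono) (auto simp: divide_le_eq mult.commute)
  finally show "sampled_excess L k n (nat \<lfloor>real n * x\<rfloor>) \<le> real k * x" .
qed

lemma f_fun_lipschitz:
  obtains K where "K \<ge> 0" "\<And>x y. 0 \<le> x \<Longrightarrow> x \<le> 1 \<Longrightarrow> 0 \<le> y \<Longrightarrow> y \<le> 1 \<Longrightarrow> \<bar>f_fun L k x - f_fun L k y\<bar> \<le> K * \<bar>x - y\<bar>"
proof -
  define K where "K = (\<Sum>i=1..k. \<bar>f_coeff L k i * real (L choose (L - k + i))\<bar> * real (L - k + i))"
  have "K \<ge> 0" unfolding K_def by (intro sum_nonneg mult_nonneg_nonneg) auto
  moreover have "\<bar>f_fun L k x - f_fun L k y\<bar> \<le> K * \<bar>x - y\<bar>"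
    if xy: "0 \<le> x" "x \<le> 1" "0 \<le> y" "y \<le> 1" for x y
  proof -
    have "\<bar>f_fun L k x - f_fun L k y\<bar> =
        \<bar>\<Sum>i=1..k. f_coeff L k i * real (L choose (L - k + i)) * (x ^ (L - k + i) - y ^ (L - k + i))\<bar>"
      by (simp add: f_fun_eq sum_subtractf right_diff_distrib)
    also have "\<dots> \<le> (\<Sum>i=1..k. \<bar>f_coeff L k i * real (L choose (L - k + i)) * (x ^ (L - k + i) - y ^ (L - k + i))\<bar>)"
      by (rule sum_abs)
    also have "\<dots> \<le> (\<Sum>i=1..k. \<bar>f_coeff L k i * real (L choose (L - k + i))\<bar> * (real (L - k + i) * \<bar>x - y\<bar>))"
    proof (rule sum_mono)
      fix i
      have "\<bar>x ^ s - y ^ s\<bar> \<le> real s * \<bar>x - y\<bar>" for s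
        using norm_power_diff[of x y s] xy by simp
      from this[of "L - k + i"]
      show "\<bar>f_coeff L k i * real (L choose (L - k + i)) * (x ^ (L - k + i) - y ^ (L - k + i))\<bar> \<le>
          \<bar>f_coeff L k i * real (L choose (L - k + i))\<bar> * (real (L - k + i) * \<bar>x - y\<bar>)"
        unfolding abs_mult[of "f_coeff L k i * real (L choose (L - k + i))"] by (rule mult_left_mono) simp
    qed
    also have "\<dots> = K * \<bar>x - y\<bar>"
      by (simp add: K_def sum_distrib_right mult.assoc)
    finally show ?thesis .
  qed
  ultimately show ?thesis by (rule that)
qed

section \<open>Occupancy states and the generator\<close>

text \<open>An occupancy state has forgotten which server holds which queue. A vector
  \<open>q\<close> of individual lengths restores labels, so that sampling becomes the choice of a
  set of indices; as a sum over servers, tails can be taken term by term.\<close>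

definition occ :: "nat \<Rightarrow> (nat \<Rightarrow> nat) \<Rightarrow> nat \<Rightarrow> real" where
  "occ n q i = (\<Sum>x<n. unit_seq (q x) i) / real n"

lemma occ_eq_card: "occ n q i = real (card {x\<in>{..<n}. q x = i}) / real n"
proof -
  have "(\<Sum>x<n. unit_seq (q x) i) = (\<Sum>x<n. if q x = i then 1 else 0)"
    by (intro sum.cong) (auto simp: unit_seq_def)
  also have "\<dots> = real (card {x\<in>{..<n}. q x = i})"
    by (simp add: sum.If_cases Int_def)
  finally show ?thesis by (simp add: occ_def)
qed

lemma list_with_counts:
  fixes B :: nat
  shows "\<exists>xs. length xs = (\<Sum>i<B. N i) \<and> (\<forall>i. length (filter (\<lambda>y. y = i) xs) = (if i < B then N i else 0))"
proof (induction B)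
  case (Suc B)
  then obtain xs where "length xs = (\<Sum>i<B. N i)"
    "\<And>i. length (filter (\<lambda>y. y = i) xs) = (if i < B then N i else 0)" by auto
  then show ?case by (intro exI[of _ "xs @ replicate (N B) B"]) (auto simp: less_Suc_eq)
qed simp

text \<open>The values lie on a grid of mesh \<open>1 / n\<close> and tend to 0, so they are
  eventually below the mesh and hence zero.\<close>

lemma occ_states_finite_support:
  assumes "r \<in> occ_states n"
  obtains B where "\<And>i. i \<ge> B \<Longrightarrow> r i = 0"
proof (cases "n = 0")
  case True
  then have "r i = 0" for i using assms by (auto simp: occ_states_def)
  then show ?thesis by (rule that)
next
  case False
  have "r sums 1" using assms by (simp add: occ_states_def)
  then have "r \<longlonglongrightarrow> 0" by (intro summable_LIMSEQ_zero sums_summable)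
  then have "\<forall>\<^sub>F i in sequentially. r i < 1 / real n"
    using False by (intro order_tendstoD) auto
  then obtain B where B: "\<And>i. i \<ge> B \<Longrightarrow> r i < 1 / real n"
    by (auto simp: eventually_sequentially)
  have "r i = 0" if "i \<ge> B" for i
  proof -
    obtain m :: nat where "r i = real m / real n" using assms by (auto simp: occ_states_def)
    then show ?thesis using B[OF that] False by (simp add: divide_less_cancel)
  qed
  then show ?thesis by (rule that)
qed

lemma occ_states_obtain_lengths:
  assumes r: "r \<in> occ_states n" and n: "n > 0"
  obtains q where "r = occ n q"
proof -
  have "\<forall>i. \<exists>m::nat. r i = real m / real n" using r by (simp add: occ_states_def)
  then obtain N :: "nat \<Rightarrow> nat" where N: "\<And>i. r i = real (N i) / real n" by metis
  obtain B where B: "\<And>i. i \<ge> B \<Longrightarrow> r i = 0" using occ_states_finite_support[OF r] by blast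
  have N0: "N i = 0" if "i \<ge> B" for i using B[OF that] N[of i] n by simp
  have "r sums 1" using r by (simp add: occ_states_def)
  moreover have "r sums (\<Sum>i<B. r i)" by (rule sums_finite) (use B in auto)
  ultimately have "(\<Sum>i<B. r i) = 1" by (rule sums_unique2[symmetric])
  then have "real (\<Sum>i<B. N i) = real n" using n by (simp add: N flip: sum_divide_distrib)
  then have sumN: "(\<Sum>i<B. N i) = n" by (simp only: of_nat_eq_iff)
  obtain xs where xs: "length xs = n" "\<And>i. length (filter (\<lambda>y. y = i) xs) = (if i < B then N i else 0)"
    using list_with_counts[of N B] sumN by auto
  have "r i = occ n (nth xs) i" for i
    using xs N0[of i] by (simp add: occ_eq_card N length_filter_conv_card conj_commute split: if_splits)
  then show ?thesis using that by blast
qed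

lemma unit_seq_tail_sums: "(\<lambda>i. unit_seq y (j + i)) sums (if j \<le> y then 1 else 0)"
proof (cases "j \<le> y")
  case True
  have "(\<lambda>i. unit_seq y (j + i)) = (\<lambda>i. if i = y - j then 1 else 0)"
    using True by (auto simp: unit_seq_def fun_eq_iff)
  then show ?thesis using True sums_single[of "y - j" "\<lambda>_. 1::real"] by simp
next
  case False
  then have "(\<lambda>i. unit_seq y (j + i)) = (\<lambda>_. 0)" by (auto simp: unit_seq_def)
  then show ?thesis using False by simp
qed

lemma occ_tail_sums: "(\<lambda>i. occ n q (j + i)) sums (real (card {x\<in>{..<n}. j \<le> q x}) / real n)"
proof -
  have "(\<lambda>i. (\<Sum>x<n. unit_seq (q x) (j + i)) / real n) sums ((\<Sum>x<n. if j \<le> q x then 1 else 0) / real n)"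
    by (intro sums_divide sums_sum unit_seq_tail_sums)
  moreover have "(\<Sum>x<n. if j \<le> q x then 1 else 0) = real (card {x\<in>{..<n}. j \<le> q x})"
    by (simp add: sum.If_cases Int_def)
  ultimately show ?thesis by (simp add: occ_def)
qed

lemma tail_occ_occ: "tail_occ (occ n q) j = real (card {x\<in>{..<n}. j \<le> q x}) / real n"
  unfolding tail_occ_def by (rule sums_unique[symmetric, OF occ_tail_sums])

lemma tail_occ_0: "r \<in> occ_states n \<Longrightarrow> tail_occ r 0 = 1"
  by (auto simp: occ_states_def tail_occ_def sums_iff)

lemma occ_states_summable: "r \<in> occ_states n \<Longrightarrow> summable (\<lambda>i. r (j + i))"
  by (subst add.commute, subst summable_iff_shift) (auto simp: occ_states_def sums_iff)

lemma tail_occ_Suc: "r \<in> occ_states n \<Longrightarrow> tail_occ r (Suc j) = tail_occ r j - r j"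
  using suminf_split_head[OF occ_states_summable, of r n j] by (simp add: tail_occ_def)

lemma occ_states_nonneg: "r \<in> occ_states n \<Longrightarrow> r i \<ge> 0"
  by (auto simp: occ_states_def) (metis divide_nonneg_nonneg of_nat_0_le_iff)

lemma tail_occ_nonneg: "r \<in> occ_states n \<Longrightarrow> tail_occ r j \<ge> 0"
  unfolding tail_occ_def by (intro suminf_nonneg occ_states_summable occ_states_nonneg)

lemma tail_occ_Ubar: "r \<in> occ_states n \<Longrightarrow> tail_occ r \<in> Ubar"
  by (auto simp: Ubar_def tail_occ_0 tail_occ_nonneg tail_occ_Suc occ_states_nonneg)

lemma tail_occ_antimono: "r \<in> occ_states n \<Longrightarrow> i \<le> j \<Longrightarrow> tail_occ r j \<le> tail_occ r i"
  by (rule lift_Suc_antimono_le) (auto simp: tail_occ_Suc occ_states_nonneg)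

lemma tail_occ_inj:
  assumes "r \<in> occ_states n" "s \<in> occ_states m" "tail_occ r = tail_occ s"
  shows "r = s"
proof
  fix j show "r j = s j"
    using tail_occ_Suc[OF assms(1), of j] tail_occ_Suc[OF assms(2), of j] assms(3) by simp
qed

lemma tail_occ_eventually_0:
  assumes "r \<in> occ_states n"
  obtains B where "\<And>j. j \<ge> B \<Longrightarrow> tail_occ r j = 0"
proof -
  obtain B where "\<And>i. i \<ge> B \<Longrightarrow> r i = 0" using occ_states_finite_support[OF assms] by blast
  then have "tail_occ r j = 0" if "j \<ge> B" for j using that by (simp add: tail_occ_def)
  then show ?thesis by (rule that)
qed

lemma tail_occ_obtain_numbers:
  assumes "r \<in> occ_states n" "n > 0"
  obtains N where "\<And>j. N j \<le> n" "\<And>j. tail_occ r j = real (N j) / real n"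
proof -
  obtain q where q: "r = occ n q" using occ_states_obtain_lengths[OF assms] .
  have "card {x\<in>{..<n}. j \<le> q x} \<le> n" for j
    using card_mono[of "{..<n}" "{x\<in>{..<n}. j \<le> q x}"] by auto
  then show ?thesis using that[of "\<lambda>j. card {x\<in>{..<n}. j \<le> q x}"] q tail_occ_occ by simp
qed

section \<open>Jumps and their effect on tails\<close>

definition arrive :: "nat \<Rightarrow> nat \<Rightarrow> (nat \<Rightarrow> real) \<Rightarrow> nat list \<Rightarrow> nat \<Rightarrow> real" where
  "arrive k n r l = (\<lambda>j. r j + arrival_jump k l j / real n)"

definition depart :: "nat \<Rightarrow> (nat \<Rightarrow> real) \<Rightarrow> nat \<Rightarrow> nat \<Rightarrow> real" where
  "depart n r i = (\<lambda>j. r j + (unit_seq i j - unit_seq (Suc i) j) / real n)"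

text \<open>Lengthening a queue from \<open>y\<close> to \<open>Suc y\<close> changes the tail at
  level \<open>Suc y\<close> only, so level \<open>j\<close> gains one for each chosen queue that
  arrives at length \<open>j\<close>.\<close>

lemma tail_occ_arrive:
  assumes "r \<in> occ_states n"
  shows "tail_occ (arrive k n r l) j = tail_occ r j + real (card {i\<in>{..<k}. Suc (l ! i) = j}) / real n"
proof -
  have "(\<lambda>i. r (j + i) + arrival_jump k l (j + i) / real n) sums
      (tail_occ r j + ((\<Sum>i<k. if j \<le> Suc (l ! i) then 1 else 0) - (\<Sum>i<k. if j \<le> l ! i then 1 else 0)) / real n)"
    unfolding arrival_jump_def tail_occ_def
    by (intro sums_add sums_divide sums_diff sums_sum unit_seq_tail_sums summable_sums occ_states_summable[OF assms])
  moreover have "(\<Sum>i<k. if j \<le> Suc (l ! i) then 1 else 0) - (\<Sum>i<k. if j \<le> l ! i then 1 else 0) =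
      (\<Sum>i<k. if Suc (l ! i) = j then 1 else (0::real))"
    unfolding sum_subtractf[symmetric] by (intro sum.cong) auto
  moreover have "\<dots> = real (card {i\<in>{..<k}. Suc (l ! i) = j})"
    by (simp add: sum.If_cases Int_def)
  ultimately show ?thesis by (simp add: tail_occ_def arrive_def sums_iff)
qed

lemma tail_occ_depart:
  assumes "r \<in> occ_states n"
  shows "tail_occ (depart n r i) j = tail_occ r j - (if j = Suc i then 1 / real n else 0)"
proof -
  have "(\<lambda>x. r (j + x) + (unit_seq i (j + x) - unit_seq (Suc i) (j + x)) / real n) sums
      (tail_occ r j + ((if j \<le> i then 1 else 0) - (if j \<le> Suc i then 1 else 0)) / real n)"
    unfolding tail_occ_def
    by (intro sums_add sums_divide sums_diff unit_seq_tail_sums summable_sums occ_states_summable[OF assms])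
  then show ?thesis by (auto simp: tail_occ_def depart_def sums_iff)
qed

text \<open>Induction on \<open>X\<close>: a subset omits or contains the new element
  \<open>x\<close>, and Pascal's rule applies to the factor at \<open>q x\<close> while all others
  stay. The index set \<open>I\<close> is fixed in advance so that \<open>M\<close> and
  \<open>M\<close> with one element removed are handled over the same product.\<close>

lemma card_subsets_with_image_mset:
  assumes "finite X" "finite I" "set_mset M \<subseteq> I"
  shows "card {S. S \<subseteq> X \<and> image_mset q (mset_set S) = M} = (\<Prod>i\<in>I. card {x\<in>X. q x = i} choose count M i)"
  using assms(1,3)
proof (induction X arbitrary: M rule: finite_induct)
  case empty
  have "{S. S \<subseteq> {} \<and> image_mset q (mset_set S) = M} = (if M = {#} then {{}} else {})" by auto
  moreover have "(\<Prod>i\<in>I. 0 choose count M i) = (if M = {#} then 1 else 0)"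
  proof (cases "M = {#}")
    case False
    then obtain i where "i \<in># M" by (meson multiset_nonemptyE)
    then have "i \<in> I" "(0 choose count M i) = 0" using empty by auto
    then show ?thesis using False assms(2) by (auto intro: prod_zero)
  qed simp
  ultimately show ?case by simp
next
  case (insert x X)
  let ?f = "\<lambda>M. {S. S \<subseteq> X \<and> image_mset q (mset_set S) = M}"
  let ?X = "\<lambda>i. card {y\<in>X. q y = i}"
  have fin: "finite (?f M)" for M by (rule finite_subset[of _ "Pow X"]) (use insert in auto)
  have mset_insert: "image_mset q (mset_set (insert x S)) = add_mset (q x) (image_mset q (mset_set S))" if "S \<subseteq> X" for S
  proof -
    have "finite S" "x \<notin> S" using that insert finite_subset by auto
    then show ?thesis by simp
  qed
  have split: "{S. S \<subseteq> insert x X \<and> image_mset q (mset_set S) = M} =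
      ?f M \<union> insert x ` {S. S \<subseteq> X \<and> add_mset (q x) (image_mset q (mset_set S)) = M}" (is "?A = _ \<union> insert x ` ?B")
  proof (intro set_eqI iffI)
    fix S assume S: "S \<in> ?A"
    show "S \<in> ?f M \<union> insert x ` ?B"
    proof (cases "x \<in> S")
      case True
      then have "S = insert x (S - {x})" "S - {x} \<subseteq> X" using S by auto
      then show ?thesis using S mset_insert[of "S - {x}"] by (intro UnI2 image_eqI[of _ _ "S - {x}"]) auto
    qed (use S in auto)
  qed (use mset_insert in auto)
  have inj: "inj_on (insert x) ?B" using insert by (intro inj_onI) (simp, metis insert_ident subsetD)
  have finB: "finite ?B" by (rule finite_subset[of _ "Pow X"]) (use insert in auto)
  have card_split: "card {S. S \<subseteq> insert x X \<and> image_mset q (mset_set S) = M} = card (?f M) + card ?B"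
    unfolding split using insert fin finB inj by (subst card_Un_disjoint) (auto simp: card_image)
  have card_insert: "card {y\<in>insert x X. q y = i} = ?X i + (if i = q x then 1 else 0)" for i
  proof -
    have "{y\<in>insert x X. q y = i} = (if i = q x then insert x {y\<in>X. q y = i} else {y\<in>X. q y = i})" by auto
    then show ?thesis using insert by auto
  qed
  show ?case
  proof (cases "q x \<in># M")
    case False
    then have "?B = {}" by auto
    moreover have "(\<Prod>i\<in>I. card {y\<in>insert x X. q y = i} choose count M i) = (\<Prod>i\<in>I. ?X i choose count M i)"
      unfolding card_insert using False by (intro prod.cong) (auto simp: not_in_iff)
    ultimately show ?thesis using insert card_split by (simp add: card.empty)
  next
    case True
    then obtain M' where M': "M = add_mset (q x) M'" by (meson multi_member_split)
    have qI: "q x \<in> I" using True insert by auto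
    have B: "?B = ?f M'" using M' by auto
    have "card (?f M') = (\<Prod>i\<in>I. ?X i choose count M' i)" "card (?f M) = (\<Prod>i\<in>I. ?X i choose count M i)"
      using insert M' by auto
    moreover have "(\<Prod>i\<in>I. ?X i choose count M i) = (?X (q x) choose Suc (count M' (q x))) * (\<Prod>i\<in>I - {q x}. ?X i choose count M' i)"
      unfolding prod.remove[OF assms(2) qI] by (intro arg_cong2[where f="(*)"] prod.cong) (auto simp: M')
    moreover have "(\<Prod>i\<in>I. ?X i choose count M' i) = (?X (q x) choose (count M' (q x))) * (\<Prod>i\<in>I - {q x}. ?X i choose count M' i)"
      unfolding prod.remove[OF assms(2) qI] by (intro arg_cong2[where f="(*)"] prod.cong) (auto simp: M')
    moreover have "(\<Prod>i\<in>I. card {y\<in>insert x X. q y = i} choose count M i) =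
        (Suc (?X (q x)) choose Suc (count M' (q x))) * (\<Prod>i\<in>I - {q x}. ?X i choose count M' i)"
      unfolding card_insert prod.remove[OF assms(2) qI] by (intro arg_cong2[where f="(*)"] prod.cong) (auto simp: M')
    ultimately show ?thesis using card_split B by (simp add: algebra_simps)
  qed
qed

definition sample :: "(nat \<Rightarrow> nat) \<Rightarrow> nat set \<Rightarrow> nat list" where
  "sample q S = sorted_list_of_multiset (image_mset q (mset_set S))"

lemma sample_in_sampled_lengths:
  assumes "S \<in> subsets_of_size n L"
  shows "sample q S \<in> sampled_lengths L"
proof -
  have "length (sample q S) = size (mset (sample q S))" by (simp only: size_mset)
  then have "length (sample q S) = L" using assms by (simp add: sample_def subsets_of_size_def)
  then show ?thesis by (simp add: sampled_lengths_def sample_def)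
qed

lemma set_sample: "S \<in> subsets_of_size n L \<Longrightarrow> set (sample q S) = q ` S"
  using finite_in_subsets_of_size by (simp add: sample_def)

lemma card_sample_ge:
  assumes "S \<in> subsets_of_size n L"
  shows "card {i\<in>{..<L}. j \<le> sample q S ! i} = card (S \<inter> {x\<in>{..<n}. j \<le> q x})"
proof -
  have L: "length (sample q S) = L" using sample_in_sampled_lengths[OF assms] by (simp add: sampled_lengths_def)
  have "card {i\<in>{..<L}. j \<le> sample q S ! i} = length (filter (\<lambda>y. j \<le> y) (sample q S))"
    by (simp add: length_filter_conv_card L)
  also have "\<dots> = size (filter_mset (\<lambda>y. j \<le> y) (mset (sample q S)))"
    by (metis mset_filter size_mset)
  also have "\<dots> = card {x \<in> S. j \<le> q x}"
    using finite_in_subsets_of_size[OF assms] by (simp add: sample_def filter_mset_image_mset o_def)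
  also have "{x \<in> S. j \<le> q x} = S \<inter> {x\<in>{..<n}. j \<le> q x}"
    using assms by (auto simp: subsets_of_size_def)
  finally show ?thesis .
qed

text \<open>If one of the first \<open>k\<close> entries reaches \<open>j\<close>, sortedness makes
  all \<open>L - k\<close> later ones do so. Otherwise at most \<open>L - k\<close> entries reach
  \<open>j\<close>, and the truncated subtraction gives 0.\<close>

lemma card_sorted_take_ge:
  fixes l :: "nat list"
  assumes "sorted l" "length l = L" "k \<le> L"
  shows "card {i\<in>{..<k}. j \<le> l ! i} = card {i\<in>{..<L}. j \<le> l ! i} - (L - k)"
proof -
  have split: "{i\<in>{..<L}. j \<le> l ! i} = {i\<in>{..<k}. j \<le> l ! i} \<union> {i\<in>{k..<L}. j \<le> l ! i}"
    using assms by auto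
  have card: "card {i\<in>{..<L}. j \<le> l ! i} = card {i\<in>{..<k}. j \<le> l ! i} + card {i\<in>{k..<L}. j \<le> l ! i}"
    unfolding split by (rule card_Un_disjoint) auto
  show ?thesis
  proof (cases "{i\<in>{..<k}. j \<le> l ! i} = {}")
    case True
    have "card {i\<in>{k..<L}. j \<le> l ! i} \<le> L - k"
      by (rule order_trans[OF card_mono[of "{k..<L}"]]) auto
    then show ?thesis unfolding card True by simp
  next
    case False
    then obtain i where i: "i < k" "j \<le> l ! i" by auto
    have "j \<le> l ! i'" if "k \<le> i'" "i' < L" for i'
      using i that assms sorted_nth_mono[of l i i'] by fastforce
    then have "{i\<in>{k..<L}. j \<le> l ! i} = {k..<L}" by auto
    then show ?thesis unfolding card by simp
  qed
qed

text \<open>A task enters a queue of length \<open>j\<close> when one of the \<open>k\<close> shortest sampled queues has length exactly \<open>j\<close>;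
  since the \<open>L - k\<close> longest ones are passed over, this is a difference of truncated excesses.\<close>

lemma card_sample_eq:
  assumes "S \<in> subsets_of_size n L" "k \<le> L"
  shows "real (card {i\<in>{..<k}. Suc (sample q S ! i) = Suc j}) =
    real (card (S \<inter> {x\<in>{..<n}. j \<le> q x}) - (L - k)) - real (card (S \<inter> {x\<in>{..<n}. Suc j \<le> q x}) - (L - k))"
proof -
  let ?l = "sample q S"
  have l: "sorted ?l" "length ?l = L" using sample_in_sampled_lengths[OF assms(1)] by (auto simp: sampled_lengths_def)
  have "{i\<in>{..<k}. j \<le> ?l ! i} = {i\<in>{..<k}. Suc (?l ! i) = Suc j} \<union> {i\<in>{..<k}. Suc j \<le> ?l ! i}" by auto
  moreover have "card ({i\<in>{..<k}. Suc (?l ! i) = Suc j} \<union> {i\<in>{..<k}. Suc j \<le> ?l ! i}) =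
     card {i\<in>{..<k}. Suc (?l ! i) = Suc j} + card {i\<in>{..<k}. Suc j \<le> ?l ! i}"
    by (rule card_Un_disjoint) auto
  ultimately have "real (card {i\<in>{..<k}. Suc (?l ! i) = Suc j}) =
      real (card {i\<in>{..<k}. j \<le> ?l ! i}) - real (card {i\<in>{..<k}. Suc j \<le> ?l ! i})" by simp
  then show ?thesis
    unfolding card_sorted_take_ge[OF l assms(2)] card_sample_ge[OF assms(1)] .
qed

text \<open>The product of binomials is the number of \<open>L\<close>-sets of servers whose sorted
  lengths are \<open>l\<close>. The sum over lists is therefore a sum over sets, grouped by the
  fibres of \<open>sample\<close>; a list with empty fibre has weight 0.\<close>

lemma infsum_sampled_lengths:
  assumes n: "n > 0"
  shows "(\<Sum>\<^sub>\<infinity>l\<in>sampled_lengths L. (\<Prod>i. (real n * occ n q i) gchoose (count_list l i)) * H l) =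
    (\<Sum>S\<in>subsets_of_size n L. H (sample q S))"
proof -
  let ?A = "subsets_of_size n L"
  have weight: "(\<Prod>i. (real n * occ n q i) gchoose (count_list l i)) = real (card {S \<in> ?A. sample q S = l})"
    if l: "l \<in> sampled_lengths L" for l
  proof -
    have "(\<Prod>i. (real n * occ n q i) gchoose (count_list l i)) =
        (\<Prod>i\<in>set l. (real n * occ n q i) gchoose (count_list l i))"
      by (rule prodinf_finite) (auto simp: count_notin)
    also have "\<dots> = (\<Prod>i\<in>set l. real (card {x\<in>{..<n}. q x = i} choose count (mset l) i))"
      using n by (intro prod.cong) (auto simp: occ_eq_card binomial_gbinomial count_mset)
    also have "\<dots> = real (card {S. S \<subseteq> {..<n} \<and> image_mset q (mset_set S) = mset l})"
      by (subst card_subsets_with_image_mset[of _ "set l"]) auto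
    also have "{S. S \<subseteq> {..<n} \<and> image_mset q (mset_set S) = mset l} = {S \<in> ?A. sample q S = l}"
    proof (intro set_eqI iffI)
      fix S assume S: "S \<in> {S. S \<subseteq> {..<n} \<and> image_mset q (mset_set S) = mset l}"
      then have "size (image_mset q (mset_set S)) = L" using l by (simp add: sampled_lengths_def)
      moreover have "sample q S = l"
        using S l by (simp add: sample_def sampled_lengths_def sorted_list_of_multiset_mset sorted_sort_id)
      ultimately show "S \<in> {S \<in> ?A. sample q S = l}" using S by (simp add: subsets_of_size_def)
    next
      fix S assume "S \<in> {S \<in> ?A. sample q S = l}"
      then show "S \<in> {S. S \<subseteq> {..<n} \<and> image_mset q (mset_set S) = mset l}"
        by (auto simp: subsets_of_size_def sample_def)
    qed
    finally show ?thesis .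
  qed
  have "(\<Sum>\<^sub>\<infinity>l\<in>sampled_lengths L. (\<Prod>i. (real n * occ n q i) gchoose (count_list l i)) * H l) =
      (\<Sum>\<^sub>\<infinity>l\<in>sample q ` ?A. real (card {S \<in> ?A. sample q S = l}) * H l)"
  proof (rule infsum_cong_neutral)
    fix l assume "l \<in> sampled_lengths L - sample q ` ?A"
    then have "l \<in> sampled_lengths L" "{S \<in> ?A. sample q S = l} = {}" by auto
    then show "(\<Prod>i. (real n * occ n q i) gchoose (count_list l i)) * H l = 0"
      by (simp add: weight card.empty)
  next
    fix l assume "l \<in> sampled_lengths L \<inter> sample q ` ?A"
    then show "(\<Prod>i. (real n * occ n q i) gchoose (count_list l i)) * H l =
      real (card {S \<in> ?A. sample q S = l}) * H l" by (simp add: weight)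
  qed (use sample_in_sampled_lengths in auto)
  also have "\<dots> = (\<Sum>l\<in>sample q ` ?A. real (card {S \<in> ?A. sample q S = l}) * H l)"
    by simp
  also have "\<dots> = (\<Sum>l\<in>sample q ` ?A. \<Sum>S\<in>{S \<in> ?A. sample q S = l}. H (sample q S))"
    by (intro sum.cong) auto
  also have "\<dots> = (\<Sum>S\<in>?A. H (sample q S))"
    by (rule sum.image_gen[symmetric]) simp
  finally show ?thesis .
qed

lemma occ_generator_eq:
  assumes "n > 0"
  shows "occ_generator L k lam n g (occ n q) =
    real n * lam / real (n choose L) * (\<Sum>S\<in>subsets_of_size n L. g (arrive k n (occ n q) (sample q S)) - g (occ n q)) +
    real k * (\<Sum>i. real n * occ n q (Suc i) * (g (depart n (occ n q) i) - g (occ n q)))"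
  unfolding occ_generator_def infsum_sampled_lengths[OF assms]
  by (simp add: arrive_def depart_def)

section \<open>Drift of tail functionals\<close>

text \<open>Without the factor \<open>k\<close>, the departure rates add up to the number of busy
  servers. \<open>d\<close> stands for the increments of an indicator function.\<close>

lemma suminf_depart_rates:
  assumes r: "r \<in> occ_states n" and d: "\<And>i. \<bar>d i\<bar> \<le> 1"
  shows "summable (\<lambda>i. real n * r (Suc i) * d i)" "\<bar>\<Sum>i. real n * r (Suc i) * d i\<bar> \<le> real n"
proof -
  have s: "summable (\<lambda>i. real n * r (Suc i))"
    using occ_states_summable[OF r, of 1] by (intro summable_mult) simp
  have le: "norm (real n * r (Suc i) * d i) \<le> real n * r (Suc i)" for i
    using d[of i] occ_states_nonneg[OF r, of "Suc i"] by (simp add: abs_mult mult_left_le)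
  then show "summable (\<lambda>i. real n * r (Suc i) * d i)"
    by (intro summable_comparison_test'[OF s, of 0]) auto
  have "summable (\<lambda>i. norm (real n * r (Suc i) * d i))"
    using le by (intro summable_comparison_test'[OF s, of 0]) auto
  then have "norm (\<Sum>i. real n * r (Suc i) * d i) \<le> (\<Sum>i. norm (real n * r (Suc i) * d i))"
    by (rule summable_norm)
  also have "\<dots> \<le> (\<Sum>i. real n * r (Suc i))"
    using \<open>summable (\<lambda>i. norm _)\<close> s le by (intro suminf_le) auto
  also have "\<dots> = real n * (\<Sum>i. r (Suc i))"
    using occ_states_summable[OF r, of 1] by (intro suminf_mult) simp
  also have "(\<Sum>i. r (Suc i)) = tail_occ r 1" by (simp add: tail_occ_def)
  also have "real n * tail_occ r 1 \<le> real n"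
    using tail_occ_antimono[OF r, of 0 1] tail_occ_0[OF r] by (simp add: mult_left_le)
  finally show "\<bar>\<Sum>i. real n * r (Suc i) * d i\<bar> \<le> real n" by simp
qed

locale batch_sampling =
  fixes L k n :: nat and lam :: real
  assumes k1: "1 \<le> k" and kL: "k < L" and Ln: "L \<le> n" and lam0: "0 < lam"
begin

lemma n0: "n > 0" using k1 kL Ln by simp

lemma choose_pos: "real (n choose L) > 0" using Ln by (simp add: zero_less_binomial)

text \<open>A jump lowers the indicator by at most 1; arrivals come at rate \<open>n * lam\<close>,
  departures at rate at most \<open>n * k\<close>.\<close>

lemma occ_generator_indicator_ge:
  assumes r: "r \<in> occ_states n"
  shows "- (real n * (lam + real k)) \<le> occ_generator L k lam n (indicator {r}) r"
proof -
  obtain q where q: "r = occ n q" using occ_states_obtain_lengths[OF r n0] .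
  let ?s = "\<Sum>S\<in>subsets_of_size n L. indicator {r} (arrive k n r (sample q S)) - (indicator {r} r :: real)"
  have "(\<Sum>S\<in>subsets_of_size n L. - 1) \<le> ?s" by (intro sum_mono) (auto simp: indicator_def)
  then have "real n * lam / real (n choose L) * (- real (n choose L)) \<le> real n * lam / real (n choose L) * ?s"
    using lam0 by (intro mult_left_mono) (auto simp: card_subsets_of_size)
  moreover have "\<bar>\<Sum>i. real n * r (Suc i) * (indicator {r} (depart n r i) - indicator {r} r)\<bar> \<le> real n"
    by (intro suminf_depart_rates(2)[OF r]) (auto simp: indicator_def)
  then have "real k * (- real n) \<le> real k * (\<Sum>i. real n * r (Suc i) * (indicator {r} (depart n r i) - indicator {r} r))"
    by (intro mult_left_mono) auto
  ultimately show ?thesis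
    using choose_pos unfolding q occ_generator_eq[OF n0] by (simp add: algebra_simps)
qed

text \<open>The indicator of the target vanishes at \<open>r\<close>, so no term of the generator is
  negative, and the departure in question contributes a positive one.\<close>

lemma occ_generator_depart_pos:
  assumes r: "r \<in> occ_states n" and ri: "r (Suc i) > 0"
  shows "occ_generator L k lam n (indicator {depart n r i}) r > 0" "depart n r i \<noteq> r"
proof -
  obtain q where q: "r = occ n q" using occ_states_obtain_lengths[OF r n0] .
  have "tail_occ (depart n r i) (Suc i) \<noteq> tail_occ r (Suc i)"
    using n0 by (simp add: tail_occ_depart[OF r])
  then show ne: "depart n r i \<noteq> r" by metis
  let ?z = "depart n r i"
  have "0 \<le> (\<Sum>S\<in>subsets_of_size n L. indicator {?z} (arrive k n r (sample q S)) - (indicator {?z} r :: real))"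
    using ne by (intro sum_nonneg) (auto simp: indicator_def)
  then have "0 \<le> real n * lam / real (n choose L) *
      (\<Sum>S\<in>subsets_of_size n L. indicator {?z} (arrive k n r (sample q S)) - (indicator {?z} r :: real))"
    using lam0 by (intro mult_nonneg_nonneg) auto
  moreover have "0 < (\<Sum>i. real n * r (Suc i) * (indicator {?z} (depart n r i) - indicator {?z} r))"
  proof (rule suminf_pos2)
    show "summable (\<lambda>i. real n * r (Suc i) * (indicator {?z} (depart n r i) - indicator {?z} r))"
      by (intro suminf_depart_rates(1)[OF r]) (auto simp: indicator_def)
    show "0 \<le> real n * r (Suc j) * (indicator {?z} (depart n r j) - indicator {?z} r)" for j
      using ne occ_states_nonneg[OF r] by (auto simp: indicator_def)
    show "0 < real n * r (Suc i) * (indicator {?z} (depart n r i) - indicator {?z} r)"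
      using ne ri n0 by (simp add: indicator_def)
  qed
  then have "0 < real k * (\<Sum>i. real n * r (Suc i) * (indicator {?z} (depart n r i) - indicator {?z} r))"
    using k1 by simp
  ultimately show "occ_generator L k lam n (indicator {?z}) r > 0"
    unfolding q occ_generator_eq[OF n0] by linarith
qed

lemma occ_generator_arrive_pos:
  assumes r: "r \<in> occ_states n" and q: "r = occ n q" and S: "S \<in> subsets_of_size n L"
    and ne: "arrive k n r (sample q S) \<noteq> r"
  shows "occ_generator L k lam n (indicator {arrive k n r (sample q S)}) r > 0"
proof -
  let ?z = "arrive k n r (sample q S)"
  have "0 < (\<Sum>S\<in>subsets_of_size n L. indicator {?z} (arrive k n r (sample q S)) - (indicator {?z} r :: real))"
    using ne S by (intro sum_pos2[of _ S]) (auto simp: indicator_def)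
  then have "0 < real n * lam / real (n choose L) *
      (\<Sum>S\<in>subsets_of_size n L. indicator {?z} (arrive k n r (sample q S)) - (indicator {?z} r :: real))"
    using lam0 n0 choose_pos by (intro mult_pos_pos divide_pos_pos) auto
  moreover have "0 \<le> (\<Sum>i. real n * r (Suc i) * (indicator {?z} (depart n r i) - indicator {?z} r))"
  proof (rule suminf_nonneg)
    show "summable (\<lambda>i. real n * r (Suc i) * (indicator {?z} (depart n r i) - indicator {?z} r))"
      by (intro suminf_depart_rates(1)[OF r]) (auto simp: indicator_def)
    show "0 \<le> real n * r (Suc j) * (indicator {?z} (depart n r j) - indicator {?z} r)" for j
      using ne occ_states_nonneg[OF r] by (auto simp: indicator_def)
  qed
  then have "0 \<le> real k * (\<Sum>i. real n * r (Suc i) * (indicator {?z} (depart n r i) - indicator {?z} r))"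
    by simp
  ultimately show ?thesis
    unfolding q occ_generator_eq[OF n0] by linarith
qed

lemma sum_card_sample_eq:
  "(\<Sum>S\<in>subsets_of_size n L. real (card {i\<in>{..<k}. Suc (sample q S ! i) = Suc j})) / real (n choose L) =
    sampled_excess L k n (card {x\<in>{..<n}. j \<le> q x}) - sampled_excess L k n (card {x\<in>{..<n}. Suc j \<le> q x})"
proof -
  have "(\<Sum>S\<in>subsets_of_size n L. real (card {i\<in>{..<k}. Suc (sample q S ! i) = Suc j})) =
    (\<Sum>S\<in>subsets_of_size n L. real (card (S \<inter> {x\<in>{..<n}. j \<le> q x}) - (L - k)))
    - (\<Sum>S\<in>subsets_of_size n L. real (card (S \<inter> {x\<in>{..<n}. Suc j \<le> q x}) - (L - k)))"
    unfolding sum_subtractf[symmetric] using kL by (intro sum.cong card_sample_eq) auto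
  moreover have "{x\<in>{..<n}. j \<le> q x} \<subseteq> {..<n}" for j by auto
  ultimately show ?thesis
    by (simp only: diff_divide_distrib sum_card_inter_excess[OF kL Ln])
qed

text \<open>A jump moves a tail by at most \<open>k / n\<close>, while jumps come at a rate of order
  \<open>n\<close>. With the one-sided quadratic bound on \<open>\<psi> j\<close>, the linear parts
  add up to \<open>\<psi>' j\<close> times the drift; the quadratic parts leave
  \<open>c * lam * k^2 / n\<close> from arrivals and \<open>c * k / n\<close> from departures at
  each level. Level 0 is constant, and the inflow to level \<open>j\<close> is read at
  \<open>j - 1\<close>, so the range starts at \<open>m \<ge> 1\<close>.\<close>

lemma occ_generator_sum_le:
  fixes \<psi> \<psi>' :: "nat \<Rightarrow> real \<Rightarrow> real"
  assumes r: "r \<in> occ_states n" and N: "\<And>j. tail_occ r j = real (N j) / real n"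
    and m: "1 \<le> m" and c: "c \<ge> 0"
    and \<psi>: "\<And>j x h. j \<in> {m..J} \<Longrightarrow> \<psi> j (x + h) \<le> \<psi> j x + \<psi>' j x * h + c * h\<^sup>2"
  shows "occ_generator L k lam n (\<lambda>r. \<Sum>j=m..J. \<psi> j (tail_occ r j)) r \<le>
    (\<Sum>j=m..J. \<psi>' j (tail_occ r j) *
      (lam * (sampled_excess L k n (N (j - 1)) - sampled_excess L k n (N j)) - real k * (tail_occ r j - tail_occ r (Suc j)))
      + c * (lam * (real k)\<^sup>2 + real k) / real n)"
proof -
  obtain q where q: "r = occ n q" using occ_states_obtain_lengths[OF r n0] .
  have Nq: "N j = card {x\<in>{..<n}. j \<le> q x}" for j
    using N[of j] n0 by (simp add: q tail_occ_occ)
  define U where "U = tail_occ r"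
  define g where "g = (\<lambda>r. \<Sum>j=m..J. \<psi> j (tail_occ r j))"
  define a where "a j S = real (card {i\<in>{..<k}. Suc (sample q S ! i) = j})" for j S
  have a0: "0 \<le> a j S" and ak: "a j S \<le> real k" for j S
    using card_mono[of "{..<k}" "{i\<in>{..<k}. Suc (sample q S ! i) = j}"] by (auto simp: a_def)
  have arr: "g (arrive k n r (sample q S)) - g r \<le> (\<Sum>j=m..J. \<psi>' j (U j) * (a j S / real n) + c * (real k / real n)\<^sup>2)" for S
  proof -
    have "g (arrive k n r (sample q S)) - g r = (\<Sum>j=m..J. \<psi> j (U j + a j S / real n) - \<psi> j (U j))"
      by (simp add: g_def tail_occ_arrive[OF r] a_def U_def sum_subtractf)
    also have "\<dots> \<le> (\<Sum>j=m..J. \<psi>' j (U j) * (a j S / real n) + c * (real k / real n)\<^sup>2)"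
    proof (rule sum_mono)
      fix j assume j: "j \<in> {m..J}"
      have "c * (a j S / real n)\<^sup>2 \<le> c * (real k / real n)\<^sup>2"
        using c a0 ak by (intro mult_left_mono power_mono divide_right_mono) auto
      then show "\<psi> j (U j + a j S / real n) - \<psi> j (U j) \<le> \<psi>' j (U j) * (a j S / real n) + c * (real k / real n)\<^sup>2"
        using \<psi>[OF j, of "U j" "a j S / real n"] by linarith
    qed
    finally show ?thesis .
  qed
  have suma: "(\<Sum>S\<in>subsets_of_size n L. a j S) / real (n choose L) =
      sampled_excess L k n (N (j - 1)) - sampled_excess L k n (N j)" if j: "j \<in> {m..J}" for j
  proof -
    obtain j' where "j = Suc j'" using j m by (cases j) auto
    then show ?thesis using sum_card_sample_eq[of q j'] by (simp add: a_def Nq)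
  qed
  have "real n * lam / real (n choose L) * (\<Sum>S\<in>subsets_of_size n L. g (arrive k n r (sample q S)) - g r) \<le>
    real n * lam / real (n choose L) * (\<Sum>S\<in>subsets_of_size n L. \<Sum>j=m..J. \<psi>' j (U j) * (a j S / real n) + c * (real k / real n)\<^sup>2)"
    using lam0 by (intro mult_left_mono sum_mono arr) auto
  also have "\<dots> = real n * lam / real (n choose L) * (\<Sum>j=m..J. \<Sum>S\<in>subsets_of_size n L. \<psi>' j (U j) * (a j S / real n) + c * (real k / real n)\<^sup>2)"
    by (subst sum.swap) simp
  also have "\<dots> = (\<Sum>j=m..J. real n * lam / real (n choose L) * (\<Sum>S\<in>subsets_of_size n L. \<psi>' j (U j) * (a j S / real n) + c * (real k / real n)\<^sup>2))"
    by (rule sum_distrib_left)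
  also have "\<dots> = (\<Sum>j=m..J. \<psi>' j (U j) * (lam * (sampled_excess L k n (N (j - 1)) - sampled_excess L k n (N j))) + c * (lam * (real k)\<^sup>2) / real n)"
  proof (rule sum.cong[OF refl])
    fix j assume j: "j \<in> {m..J}"
    have "(\<Sum>S\<in>subsets_of_size n L. \<psi>' j (U j) * (a j S / real n) + c * (real k / real n)\<^sup>2) =
        \<psi>' j (U j) / real n * (\<Sum>S\<in>subsets_of_size n L. a j S) + real (n choose L) * (c * (real k / real n)\<^sup>2)"
      by (simp add: sum.distrib sum_distrib_left card_subsets_of_size)
    then have "real n * lam / real (n choose L) * (\<Sum>S\<in>subsets_of_size n L. \<psi>' j (U j) * (a j S / real n) + c * (real k / real n)\<^sup>2)
      = \<psi>' j (U j) * (lam * ((\<Sum>S\<in>subsets_of_size n L. a j S) / real (n choose L))) + real n * lam * (c * (real k / real n)\<^sup>2)"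
      using choose_pos n0 by (simp add: field_simps)
    also have "real n * lam * (c * (real k / real n)\<^sup>2) = c * (lam * (real k)\<^sup>2) / real n"
      using n0 by (simp add: power2_eq_square)
    finally show "real n * lam / real (n choose L) * (\<Sum>S\<in>subsets_of_size n L. \<psi>' j (U j) * (a j S / real n) + c * (real k / real n)\<^sup>2) =
       \<psi>' j (U j) * (lam * (sampled_excess L k n (N (j - 1)) - sampled_excess L k n (N j))) + c * (lam * (real k)\<^sup>2) / real n"
      unfolding suma[OF j] .
  qed
  finally have arrivals: "real n * lam / real (n choose L) * (\<Sum>S\<in>subsets_of_size n L. g (arrive k n r (sample q S)) - g r) \<le>
    (\<Sum>j=m..J. \<psi>' j (U j) * (lam * (sampled_excess L k n (N (j - 1)) - sampled_excess L k n (N j))) + c * (lam * (real k)\<^sup>2) / real n)" .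
  \<comment> \<open>A departure changes the tail at one level only, so the sum over departures
    becomes a sum over the levels \<open>j = Suc i\<close>.\<close>
  have dep: "g (depart n r i) - g r = (if Suc i \<in> {m..J} then \<psi> (Suc i) (U (Suc i) - 1 / real n) - \<psi> (Suc i) (U (Suc i)) else 0)" for i
  proof -
    have "g (depart n r i) - g r = (\<Sum>j=m..J. \<psi> j (tail_occ (depart n r i) j) - \<psi> j (tail_occ r j))"
      by (simp add: g_def sum_subtractf)
    also have "\<dots> = (\<Sum>j=m..J. if j = Suc i then \<psi> (Suc i) (U (Suc i) - 1 / real n) - \<psi> (Suc i) (U (Suc i)) else 0)"
      by (intro sum.cong) (auto simp: tail_occ_depart[OF r] U_def)
    finally show ?thesis by simp
  qed
  have "(\<Sum>i. real n * r (Suc i) * (g (depart n r i) - g r)) =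
      (\<Sum>i\<in>{m-1..<J}. real n * r (Suc i) * (g (depart n r i) - g r))"
    by (rule suminf_finite) (use m in \<open>auto simp: dep\<close>)
  also have "\<dots> = (\<Sum>j=m..J. real n * r j * (\<psi> j (U j - 1 / real n) - \<psi> j (U j)))"
    by (rule sum.reindex_bij_witness[of _ "\<lambda>j. j - 1" Suc]) (use m in \<open>auto simp: dep\<close>)
  also have "\<dots> \<le> (\<Sum>j=m..J. - (\<psi>' j (U j) * (U j - U (Suc j))) + c / real n)"
  proof (rule sum_mono)
    fix j assume j: "j \<in> {m..J}"
    have rj: "0 \<le> r j" "r j = U j - U (Suc j)"
      using occ_states_nonneg[OF r] tail_occ_Suc[OF r, of j] by (auto simp: U_def)
    have r1: "r j \<le> 1"
      using rj(2) tail_occ_antimono[OF r, of 0 j] tail_occ_0[OF r] tail_occ_nonneg[OF r, of "Suc j"]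
      by (simp add: U_def)
    have "\<psi> j (U j - 1 / real n) - \<psi> j (U j) \<le> \<psi>' j (U j) * (- (1 / real n)) + c * (1 / real n)\<^sup>2"
      using \<psi>[OF j, of "U j" "- (1 / real n)"] by simp
    then have "real n * r j * (\<psi> j (U j - 1 / real n) - \<psi> j (U j)) \<le>
        real n * r j * (\<psi>' j (U j) * (- (1 / real n)) + c * (1 / real n)\<^sup>2)"
      using rj by (intro mult_left_mono) auto
    also have "\<dots> = - (\<psi>' j (U j) * r j) + r j * (c / real n)"
      using n0 by (simp add: field_simps power2_eq_square)
    also have "\<dots> \<le> - (\<psi>' j (U j) * r j) + 1 * (c / real n)"
      using r1 c by (intro add_left_mono mult_right_mono) auto
    finally show "real n * r j * (\<psi> j (U j - 1 / real n) - \<psi> j (U j)) \<le> - (\<psi>' j (U j) * (U j - U (Suc j))) + c / real n"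
      unfolding rj(2) by simp
  qed
  finally have "real k * (\<Sum>i. real n * r (Suc i) * (g (depart n r i) - g r)) \<le>
      real k * (\<Sum>j=m..J. - (\<psi>' j (U j) * (U j - U (Suc j))) + c / real n)"
    by (rule mult_left_mono) simp
  also have "\<dots> = (\<Sum>j=m..J. - (\<psi>' j (U j) * (real k * (U j - U (Suc j)))) + c * real k / real n)"
    by (simp add: sum_distrib_left algebra_simps)
  finally have "occ_generator L k lam n g r \<le>
     (\<Sum>j=m..J. \<psi>' j (U j) * (lam * (sampled_excess L k n (N (j - 1)) - sampled_excess L k n (N j))) + c * (lam * (real k)\<^sup>2) / real n) +
     (\<Sum>j=m..J. - (\<psi>' j (U j) * (real k * (U j - U (Suc j)))) + c * real k / real n)"
    using arrivals unfolding q occ_generator_eq[OF n0] by linarith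
  also have "\<dots> = (\<Sum>j=m..J. \<psi>' j (U j) *
      (lam * (sampled_excess L k n (N (j - 1)) - sampled_excess L k n (N j)) - real k * (U j - U (Suc j)))
      + c * (lam * (real k)\<^sup>2 + real k) / real n)"
    by (simp only: sum.distrib[symmetric]) (intro sum.cong refl, simp add: algebra_simps add_divide_distrib)
  finally show ?thesis by (simp only: g_def U_def)
qed

end

section \<open>Irreducibility and stationary moments\<close>

lemma sum_pred_diff:
  fixes a :: "nat \<Rightarrow> real"
  assumes "1 \<le> m" "m \<le> J"
  shows "(\<Sum>j=m..J. a (j - 1) - a j) = a (m - 1) - a J"
  using assms(2)
proof (induction J rule: dec_induct)
  case (step J)
  then show ?case by (simp add: sum.nat_ivl_Suc')
qed simp

lemma sum_diff_Suc:
  fixes a :: "nat \<Rightarrow> real"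
  assumes "m \<le> J"
  shows "(\<Sum>j=m..J. a j - a (Suc j)) = a m - a (Suc J)"
  using assms
proof (induction J rule: dec_induct)
  case (step J)
  then show ?case by (simp add: sum.nat_ivl_Suc')
qed simp

text \<open>With \<open>s = sqrt (d^2 + e^2)\<close> and \<open>Y = (d + h)^2 + e^2\<close>, the
  inequality of arithmetic and geometric means gives \<open>2 * s * sqrt Y \<le> s^2 + Y\<close>;
  division by \<open>2 * s\<close> yields the quadratic bound \<open>b\<close>. Since
  \<open>s \<ge> e\<close>, its curvature is controlled by \<open>1 / e\<close>.\<close>

lemma smooth_abs_upper_quadratic:
  fixes d h e :: real
  assumes "e > 0"
  shows "sqrt ((d + h)\<^sup>2 + e\<^sup>2) \<le> sqrt (d\<^sup>2 + e\<^sup>2) + d / sqrt (d\<^sup>2 + e\<^sup>2) * h + 1 / e * h\<^sup>2"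
proof -
  define s where "s = sqrt (d\<^sup>2 + e\<^sup>2)"
  have s2: "s\<^sup>2 = d\<^sup>2 + e\<^sup>2" by (simp add: s_def)
  have "e \<le> s" unfolding s_def by (rule real_le_rsqrt) simp
  then have s: "s > 0" using assms by simp
  define b where "b = s + d / s * h + 1 / (2 * s) * h\<^sup>2"
  have "2 * s * b = 2 * s\<^sup>2 + 2 * d * h + h\<^sup>2"
    using s by (simp add: b_def field_simps power2_eq_square)
  then have b: "2 * s * b = s\<^sup>2 + ((d + h)\<^sup>2 + e\<^sup>2)"
    using s2 by (simp add: power2_sum)
  have "0 \<le> 2 * s * b" unfolding b by simp
  then have b0: "0 \<le> b" using s by (simp add: zero_le_mult_iff)
  have "4 * s\<^sup>2 * ((d + h)\<^sup>2 + e\<^sup>2) \<le> (s\<^sup>2 + ((d + h)\<^sup>2 + e\<^sup>2))\<^sup>2"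
    using arith_geo_mean_sqrt[of "s\<^sup>2" "(d + h)\<^sup>2 + e\<^sup>2"]
      sum_squares_bound[of "s\<^sup>2" "(d + h)\<^sup>2 + e\<^sup>2"] by (simp add: power2_sum)
  also have "\<dots> = 4 * s\<^sup>2 * b\<^sup>2" unfolding b[symmetric] by (simp add: power_mult_distrib)
  finally have "(d + h)\<^sup>2 + e\<^sup>2 \<le> b\<^sup>2" using s by simp
  then have "sqrt ((d + h)\<^sup>2 + e\<^sup>2) \<le> b" using b0 by (rule real_le_lsqrt[rotated])
  also have "b \<le> s + d / s * h + 1 / e * h\<^sup>2"
  proof -
    have "1 / (2 * s) \<le> 1 / e" using \<open>e \<le> s\<close> assms s by (intro divide_left_mono) auto
    then have "1 / (2 * s) * h\<^sup>2 \<le> 1 / e * h\<^sup>2" by (rule mult_right_mono) simp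
    then show ?thesis by (simp add: b_def)
  qed
  finally show ?thesis by (simp add: s_def)
qed

text \<open>For \<open>a * d \<ge> 0\<close> and \<open>s = sqrt (d^2 + e^2)\<close>,
  \<open>\<theta> * a\<close> equals \<open>\<bar>a\<bar> * \<bar>d\<bar> / s\<close>. The loss
  \<open>\<bar>a\<bar> * (s - \<bar>d\<bar>) / s\<close> is at most \<open>K * e\<close>, because
  \<open>\<bar>a\<bar> \<le> K * s\<close> and \<open>s \<le> \<bar>d\<bar> + e\<close>.\<close>

lemma smooth_sign:
  fixes d e :: real
  assumes e: "e > 0"
  defines "\<theta> \<equiv> d / sqrt (d\<^sup>2 + e\<^sup>2)"
  shows "\<bar>\<theta>\<bar> \<le> 1" and "\<bar>a\<bar> \<le> K * \<bar>d\<bar> \<Longrightarrow> 0 \<le> a * d \<Longrightarrow> 0 \<le> K \<Longrightarrow> \<bar>a\<bar> - K * e \<le> \<theta> * a"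
proof -
  define s where "s = sqrt (d\<^sup>2 + e\<^sup>2)"
  have ds: "\<bar>d\<bar> \<le> s" unfolding s_def by (rule real_le_rsqrt) simp
  have "e \<le> s" unfolding s_def by (rule real_le_rsqrt) simp
  then have s: "s > 0" using e by simp
  have "d\<^sup>2 + e\<^sup>2 \<le> (\<bar>d\<bar> + e)\<^sup>2" using e by (simp add: power2_sum)
  then have se: "s \<le> \<bar>d\<bar> + e" unfolding s_def using e by (intro real_le_lsqrt) auto
  show "\<bar>\<theta>\<bar> \<le> 1" using ds s by (simp add: \<theta>_def flip: s_def)
  show "\<bar>a\<bar> - K * e \<le> \<theta> * a" if a: "\<bar>a\<bar> \<le> K * \<bar>d\<bar>" "0 \<le> a * d" "0 \<le> K"
  proof -
    have "\<theta> * a = \<bar>d\<bar> * \<bar>a\<bar> / s"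
      using a(2) by (simp add: \<theta>_def abs_mult[symmetric] mult.commute flip: s_def)
    moreover have "\<bar>a\<bar> - \<bar>d\<bar> * \<bar>a\<bar> / s = \<bar>a\<bar> * (s - \<bar>d\<bar>) / s" using s by (simp add: field_simps)
    moreover have "\<bar>a\<bar> * (s - \<bar>d\<bar>) / s \<le> (K * s) * e / s"
    proof (intro divide_right_mono mult_mono)
      have "K * \<bar>d\<bar> \<le> K * s" using ds a(3) by (rule mult_left_mono)
      then show "\<bar>a\<bar> \<le> K * s" using a(1) by simp
    qed (use ds se s a(3) in auto)
    ultimately show ?thesis using s by simp
  qed
qed

locale stationary_batch_sampling = batch_sampling +
  fixes P :: "real \<Rightarrow> (nat \<Rightarrow> real) \<Rightarrow> (nat \<Rightarrow> real) pmf" and \<nu> :: "(nat \<Rightarrow> real) pmf"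
  assumes lam1: "lam < 1"
    and semigroup_P: "transition_semigroup (occ_states n) (occ_generator L k lam n) P"
    and set_nu: "set_pmf \<nu> \<subseteq> occ_states n"
    and stationary_nu: "\<And>t. t \<ge> 0 \<Longrightarrow> bind_pmf \<nu> (P t) = \<nu>"
begin

sublocale stationary_semigroup "occ_states n" "occ_generator L k lam n" P "real n * (lam + real k)" \<nu>
proof unfold_locales
  show "transition_semigroup (occ_states n) (occ_generator L k lam n) P" by (rule semigroup_P)
  show "- (real n * (lam + real k)) \<le> occ_generator L k lam n (indicator {x}) x" if "x \<in> occ_states n" for x
    using that by (rule occ_generator_indicator_ge)
  show "set_pmf \<nu> \<subseteq> occ_states n" by (rule set_nu)
  show "bind_pmf \<nu> (P t) = \<nu>" if "0 \<le> t" for t using that by (rule stationary_nu)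
qed

section \<open>Irreducibility by extremal states\<close>

lemma reach_depart:
  assumes "x \<in> occ_states n" "y \<in> reach x" "y (Suc i) > 0"
  shows "depart n y i \<in> reach x"
proof -
  have "y \<in> occ_states n" using assms(2) by (simp add: reach_def)
  from occ_generator_depart_pos[OF this assms(3)] show ?thesis
    using reach_step[OF assms(1,2)] by blast
qed

lemma reach_arrive:
  assumes "x \<in> occ_states n" "occ n q \<in> reach x" "S \<in> subsets_of_size n L"
    and ne: "arrive k n (occ n q) (sample q S) \<noteq> occ n q"
  shows "arrive k n (occ n q) (sample q S) \<in> reach x"
proof -
  have "occ n q \<in> occ_states n" using assms(2) by (simp add: reach_def)
  from occ_generator_arrive_pos[OF this refl assms(3) ne] show ?thesis
    using reach_step[OF assms(1,2) ne] by blast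
qed

text \<open>Values in \<open>nat\<close> make extremal states available. On
  \<open>occ_states n\<close> the floor only changes the type, as \<open>n * tail_occ r j\<close> is
  already a natural number.\<close>

definition count_upto :: "nat \<Rightarrow> nat \<Rightarrow> (nat \<Rightarrow> real) \<Rightarrow> nat" where
  "count_upto m J r = (\<Sum>j=m..J. nat \<lfloor>real n * tail_occ r j\<rfloor>)"

lemma real_count_upto:
  assumes "r \<in> occ_states n"
  shows "real (count_upto m J r) = real n * (\<Sum>j=m..J. tail_occ r j)"
proof -
  obtain N where "\<And>j. N j \<le> n" "\<And>j. tail_occ r j = real (N j) / real n"
    using tail_occ_obtain_numbers[OF assms n0] by blast
  then have "real (nat \<lfloor>real n * tail_occ r j\<rfloor>) = real n * tail_occ r j" for j
    using n0 by simp
  then show ?thesis by (simp add: count_upto_def sum_distrib_left)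
qed

text \<open>Every arrival that samples a queue shorter than \<open>m\<close> raises the number of tasks below level \<open>m\<close>,
  so a reachable state with the largest such number has all queues at least \<open>m\<close> long.\<close>

lemma reach_all_long:
  assumes x: "x \<in> occ_states n"
  obtains y where "y \<in> reach x" "tail_occ y m = 1"
proof -
  have bound: "count_upto 1 m y < n * m + 1" if "y \<in> reach x" for y
  proof -
    have y: "y \<in> occ_states n" using that by (simp add: reach_def)
    have "(\<Sum>j=1..m. tail_occ y j) \<le> (\<Sum>j=1..m. 1)"
      using tail_occ_antimono[OF y, of 0] tail_occ_0[OF y] by (intro sum_mono) auto
    then have "real (count_upto 1 m y) \<le> real n * real m"
      unfolding real_count_upto[OF y] by (intro mult_left_mono) auto
    then show ?thesis by (simp flip: of_nat_mult)
  qed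
  obtain y where y: "y \<in> reach x" and max: "\<And>z. z \<in> reach x \<Longrightarrow> count_upto 1 m z \<le> count_upto 1 m y"
    using ex_has_greatest_nat[of "\<lambda>y. y \<in> reach x" x "count_upto 1 m" "n * m + 1"] reach_refl[OF x] bound
    by blast
  have yS: "y \<in> occ_states n" using y by (simp add: reach_def)
  have "tail_occ y m = 1"
  proof (rule ccontr)
    assume ne: "tail_occ y m \<noteq> 1"
    obtain q where q: "y = occ n q" using occ_states_obtain_lengths[OF yS n0] .
    have "\<not> {..<n} \<subseteq> {x\<in>{..<n}. m \<le> q x}"
    proof
      assume "{..<n} \<subseteq> {x\<in>{..<n}. m \<le> q x}"
      then have "{x\<in>{..<n}. m \<le> q x} = {..<n}" by auto
      then show False using ne n0 by (simp add: q tail_occ_occ)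
    qed
    then obtain x0 where "x0 \<in> {..<n}" "x0 \<notin> {x\<in>{..<n}. m \<le> q x}" by blast
    then have x0: "x0 < n" "q x0 < m" by auto
    have "L - 1 \<le> card ({..<n} - {x0})" using x0 Ln by simp
    then obtain S0 where S0: "S0 \<subseteq> {..<n} - {x0}" "card S0 = L - 1"
      using obtain_subset_with_card_n by metis
    define S where "S = insert x0 S0"
    have "finite S0" "x0 \<notin> S0" using S0 finite_subset[of S0 "{..<n} - {x0}"] by auto
    then have S: "S \<in> subsets_of_size n L" "x0 \<in> S"
      using S0 x0 k1 kL by (auto simp: S_def subsets_of_size_def)
    define l where "l = sample q S"
    have l: "length l = L" "sorted l" using sample_in_sampled_lengths[OF S(1), of q] by (auto simp: sampled_lengths_def l_def)
    have "q x0 \<in> set l" using S set_sample[OF S(1)] by (simp add: l_def)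
    then obtain i where i: "i < L" "l ! i = q x0" using l by (auto simp: in_set_conv_nth)
    \<comment> \<open>The shortest sampled queue is no longer than that of \<open>x0\<close>, and it
      always receives a task since \<open>k \<ge> 1\<close>.\<close>
    have l0: "l ! 0 < m" using sorted_nth_mono[OF l(2), of 0 i] i l x0 by simp
    define z where "z = arrive k n y l"
    have tz: "tail_occ z j = tail_occ y j + real (card {i\<in>{..<k}. Suc (l ! i) = j}) / real n" for j
      unfolding z_def by (rule tail_occ_arrive[OF yS])
    have "0 \<in> {i\<in>{..<k}. Suc (l ! i) = Suc (l ! 0)}" using k1 by simp
    then have "card {i\<in>{..<k}. Suc (l ! i) = Suc (l ! 0)} > 0" by (subst card_gt_0_iff) auto
    then have lt: "tail_occ y (Suc (l ! 0)) < tail_occ z (Suc (l ! 0))" using n0 unfolding tz by simp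
    then have "z \<noteq> y" by auto
    then have z: "z \<in> reach x"
      using reach_arrive[OF x _ S(1), of q] y by (simp add: z_def q l_def)
    then have zS: "z \<in> occ_states n" by (simp add: reach_def)
    have "(\<Sum>j=1..m. tail_occ y j) < (\<Sum>j=1..m. tail_occ z j)"
      using lt l0 by (intro sum_strict_mono_ex1) (auto simp: tz intro!: bexI[of _ "Suc (l ! 0)"])
    then have "real (count_upto 1 m y) < real (count_upto 1 m z)"
      unfolding real_count_upto[OF yS] real_count_upto[OF zS] using n0 by simp
    then show False using max[OF z] by simp
  qed
  then show ?thesis using that y by blast
qed

text \<open>A state whose queues all have length at least \<open>B\<close> dominates
  \<open>a\<close> in every tail. Among the reachable dominating states, one with the fewest tasks
  must be \<open>a\<close>, since otherwise a suitable departure leads to a smaller one.\<close>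

lemma reach_eq:
  assumes x: "x \<in> occ_states n"
  shows "reach x = occ_states n"
proof (intro equalityI subsetI)
  fix a assume a: "a \<in> occ_states n"
  obtain B where B: "\<And>j. j \<ge> B \<Longrightarrow> tail_occ a j = 0" using tail_occ_eventually_0[OF a] by blast
  obtain y0 where y0: "y0 \<in> reach x" "tail_occ y0 B = 1" using reach_all_long[OF x] by blast
  have y0S: "y0 \<in> occ_states n" using y0 by (simp add: reach_def)
  obtain D where D: "\<And>j. j \<ge> D \<Longrightarrow> tail_occ y0 j = 0" using tail_occ_eventually_0[OF y0S] by blast
  \<comment> \<open>Vanishing beyond \<open>D\<close> is preserved by departures and confines the
    excess over \<open>a\<close> to levels that \<open>count_upto 1 D\<close> sees.\<close>
  define R where "R = {y \<in> reach x. (\<forall>j. tail_occ a j \<le> tail_occ y j) \<and> (\<forall>j\<ge>D. tail_occ y j = 0)}"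
  have "tail_occ a j \<le> tail_occ y0 j" for j
  proof (cases "j \<le> B")
    case True
    have "tail_occ a j \<le> tail_occ a 0" using a by (rule tail_occ_antimono) simp
    also have "\<dots> = tail_occ y0 B" using y0 tail_occ_0[OF a] by simp
    also have "\<dots> \<le> tail_occ y0 j" using y0S True by (rule tail_occ_antimono)
    finally show ?thesis .
  qed (use B tail_occ_nonneg[OF y0S] in auto)
  then have "y0 \<in> R" using y0 D by (simp add: R_def)
  then obtain y where y: "y \<in> R" and min: "\<And>z. z \<in> R \<Longrightarrow> count_upto 1 D y \<le> count_upto 1 D z"
    using ex_has_least_nat[of "\<lambda>y. y \<in> R" y0 "count_upto 1 D"] by blast
  have yS: "y \<in> occ_states n" and yr: "y \<in> reach x" and ya: "\<And>j. tail_occ a j \<le> tail_occ y j"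
    and yD: "\<And>j. j \<ge> D \<Longrightarrow> tail_occ y j = 0"
    using y by (auto simp: R_def reach_def)
  have "tail_occ y = tail_occ a"
  proof (rule ccontr)
    assume "tail_occ y \<noteq> tail_occ a"
    then obtain j1 where "tail_occ y j1 \<noteq> tail_occ a j1" by auto
    then have j1: "tail_occ a j1 < tail_occ y j1" using ya[of j1] by simp
    define J where "J = {j. tail_occ a j < tail_occ y j}"
    have "j < D" if "j \<in> J" for j
      using that yD[of j] tail_occ_nonneg[OF a, of j] by (cases "j < D") (auto simp: J_def)
    then have "finite J" by (intro finite_subset[of J "{..<D}"]) auto
    moreover have "J \<noteq> {}" using j1 by (auto simp: J_def)
    ultimately have jJ: "Max J \<in> J" and jmax: "\<And>j. j \<in> J \<Longrightarrow> j \<le> Max J" by auto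
    \<comment> \<open>At the highest level of excess the tail of \<open>y\<close> falls strictly to
      that of \<open>a\<close>. So \<open>y\<close> has a queue of length exactly \<open>j\<close>,
      and its departure lowers only this level, by one grid step.\<close>
    define j where "j = Max J"
    have j: "tail_occ a j < tail_occ y j" "j < D" using jJ \<open>\<And>j. j \<in> J \<Longrightarrow> j < D\<close> by (auto simp: j_def J_def)
    have "Suc j \<notin> J" using jmax[of "Suc j"] by (auto simp: j_def)
    then have "tail_occ y (Suc j) = tail_occ a (Suc j)" using ya[of "Suc j"] by (simp add: J_def)
    also have "\<dots> \<le> tail_occ a j" using a by (rule tail_occ_antimono) simp
    finally have "y j > 0" using j tail_occ_Suc[OF yS, of j] by simp
    have "j \<noteq> 0" using j tail_occ_0[OF a] tail_occ_0[OF yS] by (metis order_less_irrefl)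
    then obtain i where i: "j = Suc i" by (cases j) auto
    define z where "z = depart n y i"
    have z: "z \<in> reach x" unfolding z_def using x yr \<open>y j > 0\<close> i by (intro reach_depart) auto
    then have zS: "z \<in> occ_states n" by (simp add: reach_def)
    have tz: "tail_occ z j' = tail_occ y j' - (if j' = j then 1 / real n else 0)" for j'
      unfolding z_def i by (rule tail_occ_depart[OF yS])
    have "tail_occ a j \<le> tail_occ y j - 1 / real n"
    proof -
      obtain N where N: "\<And>j. tail_occ a j = real (N j) / real n"
        using tail_occ_obtain_numbers[OF a n0] by blast
      obtain N' where N': "\<And>j. tail_occ y j = real (N' j) / real n"
        using tail_occ_obtain_numbers[OF yS n0] by blast
      have "N j < N' j" using j n0 by (simp add: N N' divide_less_cancel)
      then have "real (N j) / real n \<le> (real (N' j) - 1) / real n" by (intro divide_right_mono) auto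
      then show ?thesis by (simp add: N N' diff_divide_distrib)
    qed
    then have "z \<in> R" using z ya yD j by (auto simp: R_def tz)
    have "(\<Sum>j'=1..D. tail_occ z j') < (\<Sum>j'=1..D. tail_occ y j')"
      using j n0 i by (intro sum_strict_mono_ex1) (auto simp: tz intro!: bexI[of _ j])
    then have "real (count_upto 1 D z) < real (count_upto 1 D y)"
      unfolding real_count_upto[OF yS] real_count_upto[OF zS] using n0 by simp
    then show False using min[OF \<open>z \<in> R\<close>] by simp
  qed
  then have "y = a" using tail_occ_inj[OF yS a] by simp
  then show "a \<in> reach x" using yr by simp
qed (simp add: reach_def)

section \<open>Stationary means of tails\<close>

lemma tail_occ_le_1: "r \<in> occ_states n \<Longrightarrow> tail_occ r j \<le> 1"
  using Ubar_le_1[OF tail_occ_Ubar] .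

lemma bounded_tail_sum:
  fixes \<psi> :: "nat \<Rightarrow> real \<Rightarrow> real"
  assumes "\<And>j x. 0 \<le> x \<Longrightarrow> x \<le> 1 \<Longrightarrow> \<bar>\<psi> j x\<bar> \<le> B j"
  shows "bounded ((\<lambda>r. \<Sum>j=m..J. \<psi> j (tail_occ r j)) ` occ_states n)"
proof -
  have "\<bar>\<Sum>j=m..J. \<psi> j (tail_occ r j)\<bar> \<le> (\<Sum>j=m..J. B j)" if "r \<in> occ_states n" for r
  proof -
    have "(\<Sum>j=m..J. \<bar>\<psi> j (tail_occ r j)\<bar>) \<le> (\<Sum>j=m..J. B j)"
      by (intro sum_mono assms tail_occ_nonneg[OF that] tail_occ_le_1[OF that])
    then show ?thesis using sum_abs[of "\<lambda>j. \<psi> j (tail_occ r j)" "{m..J}"] by linarith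
  qed
  then show ?thesis by (auto simp: bounded_iff)
qed

lemma integrable_tail:
  fixes \<phi> :: "real \<Rightarrow> real"
  assumes "\<And>x. 0 \<le> x \<Longrightarrow> x \<le> 1 \<Longrightarrow> \<bar>\<phi> x\<bar> \<le> B"
  shows "integrable (measure_pmf \<nu>) (\<lambda>r. \<phi> (tail_occ r j))"
proof (rule integrable_pmf_bounded_on[OF _ set_nu])
  have "\<bar>\<phi> (tail_occ r j)\<bar> \<le> B" if "r \<in> occ_states n" for r
    using tail_occ_nonneg[OF that] tail_occ_le_1[OF that] by (rule assms)
  then show "bounded ((\<lambda>r. \<phi> (tail_occ r j)) ` occ_states n)" by (auto simp: bounded_iff)
qed

lemma integrable_tail_occ: "integrable (measure_pmf \<nu>) (\<lambda>r. tail_occ r j)"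
  by (rule integrable_tail[of "\<lambda>x. x" 1]) auto

lemma integrable_abs_dev: "integrable (measure_pmf \<nu>) (\<lambda>r. \<bar>tail_occ r j - w\<bar>)"
  by (rule integrable_tail[of "\<lambda>x. \<bar>x - w\<bar>" "1 + \<bar>w\<bar>"]) auto

text \<open>The full sum of tails is the number of tasks divided by \<open>n\<close>, which is
  unbounded, hence the cut at \<open>J\<close>. Both parts of the drift telescope; the cut leaves
  the departure term at \<open>Suc J\<close>, which vanishes as \<open>J\<close> grows with
  \<open>n\<close> fixed.\<close>

lemma mean_tail_step:
  assumes m: "1 \<le> m" and J: "m \<le> J"
  shows "measure_pmf.expectation \<nu> (\<lambda>r. tail_occ r m) \<le>
    lam * measure_pmf.expectation \<nu> (\<lambda>r. tail_occ r (m - 1)) + measure_pmf.expectation \<nu> (\<lambda>r. tail_occ r (Suc J))"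
proof -
  define g where "g = (\<lambda>r. \<Sum>j=m..J. tail_occ r j)"
  have bg: "bounded (g ` occ_states n)"
    unfolding g_def by (rule bounded_tail_sum[of "\<lambda>j x. x" "\<lambda>j. 1"]) auto
  have le: "occ_generator L k lam n g r \<le>
      real k * (lam * tail_occ r (m - 1) - tail_occ r m + tail_occ r (Suc J))" if r: "r \<in> occ_states n" for r
  proof -
    obtain N where N: "\<And>j. N j \<le> n" "\<And>j. tail_occ r j = real (N j) / real n"
      using tail_occ_obtain_numbers[OF r n0] by blast
    let ?F = "\<lambda>j. sampled_excess L k n (N j)"
    have "occ_generator L k lam n g r \<le>
      (\<Sum>j=m..J. 1 * (lam * (?F (j - 1) - ?F j) - real k * (tail_occ r j - tail_occ r (Suc j)))
        + 0 * (lam * (real k)\<^sup>2 + real k) / real n)"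
      unfolding g_def by (rule occ_generator_sum_le[OF r N(2) m]) auto
    also have "\<dots> = lam * (\<Sum>j=m..J. ?F (j - 1) - ?F j) - real k * (\<Sum>j=m..J. tail_occ r j - tail_occ r (Suc j))"
      by (simp add: sum_subtractf sum_distrib_left right_diff_distrib)
    also have "\<dots> = lam * (?F (m - 1) - ?F J) - real k * (tail_occ r m - tail_occ r (Suc J))"
      unfolding sum_pred_diff[OF m J, of ?F] sum_diff_Suc[OF J] ..
    also have "\<dots> \<le> lam * (real k * tail_occ r (m - 1)) - real k * (tail_occ r m - tail_occ r (Suc J))"
    proof -
      have "?F (m - 1) \<le> real k * tail_occ r (m - 1)"
        unfolding N(2) by (rule sampled_excess_le[OF k1 kL Ln N(1)])
      then have "?F (m - 1) - ?F J \<le> real k * tail_occ r (m - 1)"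
        using sampled_excess_nonneg[of L k n "N J"] by linarith
      then show ?thesis using lam0 by simp
    qed
    finally show ?thesis by (simp add: algebra_simps)
  qed
  have "0 = measure_pmf.expectation \<nu> (occ_generator L k lam n g)"
    using generator_stationary(2)[OF bg] by simp
  also have "\<dots> \<le> measure_pmf.expectation \<nu> (\<lambda>r. real k * (lam * tail_occ r (m - 1) - tail_occ r m + tail_occ r (Suc J)))"
    using generator_stationary(1)[OF bg] le set_nu
    by (intro integral_mono_AE) (auto simp: AE_measure_pmf_iff integrable_tail_occ)
  also have "\<dots> = real k * (lam * measure_pmf.expectation \<nu> (\<lambda>r. tail_occ r (m - 1)) -
      measure_pmf.expectation \<nu> (\<lambda>r. tail_occ r m) + measure_pmf.expectation \<nu> (\<lambda>r. tail_occ r (Suc J)))"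
    by (simp add: integrable_tail_occ)
  finally show ?thesis using k1 by (simp add: zero_le_mult_iff)
qed

lemma mean_tail_tendsto: "(\<lambda>J. measure_pmf.expectation \<nu> (\<lambda>r. tail_occ r J)) \<longlonglongrightarrow> 0"
proof -
  have "(\<lambda>J. measure_pmf.expectation \<nu> (\<lambda>r. tail_occ r J)) \<longlonglongrightarrow> measure_pmf.expectation \<nu> (\<lambda>_. 0)"
  proof (rule integral_dominated_convergence[where w="\<lambda>_. 1"])
    have "(\<lambda>J. tail_occ r J) \<longlonglongrightarrow> 0" if r: "r \<in> occ_states n" for r
    proof -
      obtain B where "\<And>j. j \<ge> B \<Longrightarrow> tail_occ r j = 0" using tail_occ_eventually_0[OF r] by blast
      then show ?thesis by (intro tendsto_eventually) (auto simp: eventually_sequentially)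
    qed
    then show "AE r in measure_pmf \<nu>. (\<lambda>J. tail_occ r J) \<longlonglongrightarrow> 0"
      using set_nu by (auto simp: AE_measure_pmf_iff)
    show "AE r in measure_pmf \<nu>. norm (tail_occ r J) \<le> 1" for J
      using set_nu tail_occ_le_1 tail_occ_nonneg by (auto simp: AE_measure_pmf_iff subset_eq)
  qed auto
  then show ?thesis by simp
qed

lemma mean_tail_le: "measure_pmf.expectation \<nu> (\<lambda>r. tail_occ r m) \<le> lam ^ m"
proof (induction m)
  case 0
  have "measure_pmf.expectation \<nu> (\<lambda>r. tail_occ r 0) = measure_pmf.expectation \<nu> (\<lambda>r. 1)"
    using set_nu tail_occ_0 by (intro integral_cong_AE) (auto simp: AE_measure_pmf_iff)
  then show ?case by simp
next
  case (Suc m)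
  have "(\<lambda>J. lam * measure_pmf.expectation \<nu> (\<lambda>r. tail_occ r m) + measure_pmf.expectation \<nu> (\<lambda>r. tail_occ r (Suc J)))
      \<longlonglongrightarrow> lam * measure_pmf.expectation \<nu> (\<lambda>r. tail_occ r m) + 0"
    by (intro tendsto_add tendsto_const LIMSEQ_Suc mean_tail_tendsto)
  then have "measure_pmf.expectation \<nu> (\<lambda>r. tail_occ r (Suc m)) \<le> lam * measure_pmf.expectation \<nu> (\<lambda>r. tail_occ r m) + 0"
    by (rule LIMSEQ_le_const) (use mean_tail_step[of "Suc m"] in auto)
  also have "\<dots> \<le> lam * lam ^ m" using Suc lam0 by simp
  finally show ?case by simp
qed

end

section \<open>Convergence to the fixed point\<close>

text \<open>From \<open>0 \<le> f x \<le> k * x\<close> on \<open>[0, 1]\<close>, a step of the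
  recursion contracts by the factor \<open>lam\<close>. The claims go through one induction because
  this bound is available only inside \<open>[0, 1]\<close>.\<close>

lemma ubar_bounds:
  assumes "1 \<le> k" "k < L" "0 < lam" "lam < 1"
  shows "0 \<le> ubar L k lam m \<and> ubar L k lam m \<le> lam ^ m \<and> ubar L k lam m \<le> 1 \<and>
    ubar L k lam (Suc m) \<le> ubar L k lam m"
proof (induction m)
  case 0
  have "f_fun L k 1 \<le> real k * 1" using assms by (intro f_fun_le) auto
  then have "lam * f_fun L k 1 \<le> 1 * real k"
    using assms f_fun_nonneg[of k L 1] by (intro mult_mono) auto
  then show ?case using assms by simp
next
  case (Suc m)
  have step: "0 \<le> lam * f_fun L k x / real k" "lam * f_fun L k x / real k \<le> lam * x" if "0 \<le> x" "x \<le> 1" for x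
  proof -
    show "0 \<le> lam * f_fun L k x / real k"
      using assms f_fun_nonneg[of k L x] that by simp
    have "lam * f_fun L k x \<le> lam * (real k * x)"
      using assms f_fun_le[of k L x] that by (intro mult_left_mono) auto
    then show "lam * f_fun L k x / real k \<le> lam * x" using assms by (simp add: field_simps)
  qed
  let ?u = "ubar L k lam"
  have m: "0 \<le> ?u (Suc m)" "?u (Suc m) \<le> lam * ?u m"
    using Suc step[of "?u m"] by auto
  have "lam * ?u m \<le> lam * lam ^ m" using Suc assms by simp
  then have pow: "?u (Suc m) \<le> lam ^ Suc m" using m by simp
  have le1: "?u (Suc m) \<le> 1" using Suc by linarith
  have "?u (Suc (Suc m)) \<le> lam * ?u (Suc m)"
    using step[OF m(1) le1] by simp
  also have "\<dots> \<le> 1 * ?u (Suc m)" using assms m by (intro mult_right_mono) auto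
  finally show ?case using m pow le1 by simp
qed

lemma ubar_in_Ubar:
  assumes "1 \<le> k" "k < L" "0 < lam" "lam < 1"
  shows "ubar L k lam \<in> Ubar"
  using ubar_bounds[OF assms] unfolding Ubar_def by auto

context stationary_batch_sampling
begin

text \<open>Differentiating \<open>\<Sum>\<^sub>j \<bar>u\<^sub>j - ubar\<^sub>j\<bar>\<close> along the mean-field drift telescopes, because the arrival term is
  nondecreasing in \<open>u\<^sub>j\<close>. The square roots smooth the kinks, on which the jumps of size
  \<open>1/n\<close> would otherwise contribute terms of order \<open>1\<close>.\<close>

lemma mean_dev_step:
  fixes K e :: real
  assumes m: "1 \<le> m" and J: "m \<le> J" and Ln2: "2 * L \<le> n" and K: "0 \<le> K" and e: "0 < e"
    and lip: "\<And>x y. 0 \<le> x \<Longrightarrow> x \<le> 1 \<Longrightarrow> 0 \<le> y \<Longrightarrow> y \<le> 1 \<Longrightarrow> \<bar>f_fun L k x - f_fun L k y\<bar> \<le> K * \<bar>x - y\<bar>"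
  shows "real k * measure_pmf.expectation \<nu> (\<lambda>r. \<bar>tail_occ r m - ubar L k lam m\<bar>) \<le>
    lam * K * measure_pmf.expectation \<nu> (\<lambda>r. \<bar>tail_occ r (m - 1) - ubar L k lam (m - 1)\<bar>) +
    2 * real k * lam ^ Suc J +
    real (Suc J) * (2 * lam * excess_error L k n + (lam * K + real k) * e + 1 / e * (lam * (real k)\<^sup>2 + real k) / real n)"
proof -
  define w where "w = ubar L k lam"
  have w: "0 \<le> w j" "w j \<le> 1" "w j \<le> lam ^ j" for j
    using ubar_bounds[OF k1 kL lam0 lam1, of j] by (auto simp: w_def)
  have w_Suc: "real k * w (Suc j) = lam * f_fun L k (w j)" for j
    using k1 by (simp add: w_def)
  define \<delta> where "\<delta> = excess_error L k n"
  define R where "R = 2 * lam * \<delta> + (lam * K + real k) * e + 1 / e * (lam * (real k)\<^sup>2 + real k) / real n"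
  define g where "g = (\<lambda>r. \<Sum>j=m..J. sqrt ((tail_occ r j - w j)\<^sup>2 + e\<^sup>2))"
  have bg: "bounded (g ` occ_states n)"
    unfolding g_def
  proof (rule bounded_tail_sum[of "\<lambda>j x. sqrt ((x - w j)\<^sup>2 + e\<^sup>2)" "\<lambda>j. sqrt (1 + e\<^sup>2)"])
    fix j and x :: real assume "0 \<le> x" "x \<le> 1"
    then have "\<bar>x - w j\<bar> \<le> 1" using w[of j] by linarith
    then have "(x - w j)\<^sup>2 \<le> 1" by (simp add: abs_square_le_1)
    then show "\<bar>sqrt ((x - w j)\<^sup>2 + e\<^sup>2)\<bar> \<le> sqrt (1 + e\<^sup>2)" by simp
  qed
  have \<delta>0: "0 \<le> \<delta>"
    using sampled_excess_approx[OF k1 kL Ln2, of 0] unfolding \<delta>_def by linarith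
  then have R0: "0 \<le> R" unfolding R_def using K e lam0 by simp
  have le: "occ_generator L k lam n g r \<le>
      lam * K * \<bar>tail_occ r (m - 1) - w (m - 1)\<bar> - real k * \<bar>tail_occ r m - w m\<bar> +
      real k * \<bar>tail_occ r (Suc J) - w (Suc J)\<bar> + real (Suc J) * R" if r: "r \<in> occ_states n" for r
  proof -
    obtain N where N: "\<And>j. N j \<le> n" "\<And>j. tail_occ r j = real (N j) / real n"
      using tail_occ_obtain_numbers[OF r n0] by blast
    define U where "U = tail_occ r"
    define d where "d j = U j - w j" for j
    define \<alpha> where "\<alpha> j = lam * (f_fun L k (U j) - f_fun L k (w j))" for j
    define \<theta> where "\<theta> j = d j / sqrt ((d j)\<^sup>2 + e\<^sup>2)" for j
    define err where "err j = sampled_excess L k n (N j) - f_fun L k (U j)" for j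
    have U: "0 \<le> U j" "U j \<le> 1" for j using tail_occ_nonneg[OF r] tail_occ_le_1[OF r] by (auto simp: U_def)
    have err: "\<bar>err j\<bar> \<le> \<delta>" for j
      using sampled_excess_approx[OF k1 kL Ln2 N(1)[of j]] by (simp add: err_def \<delta>_def U_def N(2))
    have \<alpha>_le: "\<bar>\<alpha> j\<bar> \<le> lam * K * \<bar>d j\<bar>" for j
    proof -
      have "\<bar>\<alpha> j\<bar> = lam * \<bar>f_fun L k (U j) - f_fun L k (w j)\<bar>" using lam0 by (simp add: \<alpha>_def abs_mult)
      also have "\<dots> \<le> lam * (K * \<bar>d j\<bar>)" unfolding d_def using lam0 U w by (intro mult_left_mono lip) auto
      finally show ?thesis by simp
    qed
    have \<alpha>_sign: "0 \<le> \<alpha> j * d j" for j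
    proof (cases "w j \<le> U j")
      case True
      then have "f_fun L k (w j) \<le> f_fun L k (U j)" using f_fun_mono[OF k1 kL] w U by simp
      then show ?thesis using True lam0 by (simp add: \<alpha>_def d_def)
    next
      case False
      then have "f_fun L k (U j) \<le> f_fun L k (w j)" using f_fun_mono[OF k1 kL] w U by simp
      then show ?thesis using False lam0
        by (intro mult_nonpos_nonpos) (auto simp: \<alpha>_def d_def mult_le_0_iff)
    qed
    have \<theta>1: "\<bar>\<theta> j\<bar> \<le> 1" for j using smooth_sign(1)[OF e, of "d j"] by (simp add: \<theta>_def)
    have \<theta>_le: "\<theta> j * x \<le> \<bar>x\<bar>" for j x
    proof -
      have "\<theta> j * x \<le> \<bar>\<theta> j\<bar> * \<bar>x\<bar>" by (simp flip: abs_mult)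
      also have "\<dots> \<le> 1 * \<bar>x\<bar>" using \<theta>1 by (rule mult_right_mono) simp
      finally show ?thesis by simp
    qed
    have \<theta>\<alpha>: "\<bar>\<alpha> j\<bar> - lam * K * e \<le> \<theta> j * \<alpha> j" for j
      unfolding \<theta>_def by (rule smooth_sign(2)[OF e \<alpha>_le \<alpha>_sign]) (use lam0 K in simp)
    have \<theta>d: "\<bar>d j\<bar> - e \<le> \<theta> j * d j" for j
      using smooth_sign(2)[OF e, of "d j" 1 "d j"] by (simp add: \<theta>_def)
    have "occ_generator L k lam n g r \<le>
      (\<Sum>j=m..J. \<theta> j * (lam * (sampled_excess L k n (N (j - 1)) - sampled_excess L k n (N j)) - real k * (U j - U (Suc j)))
        + 1 / e * (lam * (real k)\<^sup>2 + real k) / real n)"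
      unfolding g_def \<theta>_def d_def U_def
    proof (rule occ_generator_sum_le[OF r N(2) m])
      show "sqrt ((x + h - w j)\<^sup>2 + e\<^sup>2) \<le> sqrt ((x - w j)\<^sup>2 + e\<^sup>2) + (x - w j) / sqrt ((x - w j)\<^sup>2 + e\<^sup>2) * h + 1 / e * h\<^sup>2"
        for j x h
        using smooth_abs_upper_quadratic[OF e, of "x - w j" h] by (simp add: algebra_simps)
    qed (use e in auto)
    also have "\<dots> \<le> (\<Sum>j=m..J. (\<bar>\<alpha> (j - 1)\<bar> - \<bar>\<alpha> j\<bar>) - real k * (\<bar>d j\<bar> - \<bar>d (Suc j)\<bar>) + R)"
    proof (rule sum_mono)
      fix j assume j: "j \<in> {m..J}"
      then obtain i where i: "j = Suc i" using m by (cases j) auto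
      \<comment> \<open>By the recursion the limiting drift vanishes at \<open>w\<close>: both
        \<open>lam * (f (w (j - 1)) - f (w j))\<close> and \<open>k * (w j - w (Suc j))\<close>
        equal the same difference. Subtracting it leaves deviations and sampling errors
        only.\<close>
      have inner: "lam * (sampled_excess L k n (N (j - 1)) - sampled_excess L k n (N j)) - real k * (U j - U (Suc j)) =
          \<alpha> (j - 1) - \<alpha> j - real k * d j + real k * d (Suc j) + lam * (err (j - 1) - err j)"
        using w_Suc[of i] w_Suc[of j] by (simp add: i \<alpha>_def d_def err_def algebra_simps)
      have "\<theta> j * (lam * (err (j - 1) - err j)) \<le> \<bar>lam * (err (j - 1) - err j)\<bar>" by (rule \<theta>_le)
      also have "\<dots> = lam * \<bar>err (j - 1) - err j\<bar>" using lam0 by (simp add: abs_mult)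
      also have "\<dots> \<le> lam * (2 * \<delta>)"
        using err[of j] err[of "j - 1"] lam0 by (intro mult_left_mono) auto
      finally have 1: "\<theta> j * (lam * (err (j - 1) - err j)) \<le> 2 * lam * \<delta>" by simp
      have 2: "\<theta> j * \<alpha> (j - 1) \<le> \<bar>\<alpha> (j - 1)\<bar>" by (rule \<theta>_le)
      have 3: "real k * (\<theta> j * d (Suc j)) \<le> real k * \<bar>d (Suc j)\<bar>"
        by (intro mult_left_mono \<theta>_le) simp
      have 4: "real k * (\<bar>d j\<bar> - e) \<le> real k * (\<theta> j * d j)"
        by (intro mult_left_mono \<theta>d) simp
      have "\<theta> j * (\<alpha> (j - 1) - \<alpha> j - real k * d j + real k * d (Suc j) + lam * (err (j - 1) - err j)) =
         \<theta> j * \<alpha> (j - 1) - \<theta> j * \<alpha> j - real k * (\<theta> j * d j) + real k * (\<theta> j * d (Suc j)) + \<theta> j * (lam * (err (j - 1) - err j))"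
        by (simp add: algebra_simps)
      also have "\<dots> \<le> \<bar>\<alpha> (j - 1)\<bar> - (\<bar>\<alpha> j\<bar> - lam * K * e) - real k * (\<bar>d j\<bar> - e) + real k * \<bar>d (Suc j)\<bar> + 2 * lam * \<delta>"
        using 1 2 3 4 \<theta>\<alpha>[of j] by linarith
      finally show "\<theta> j * (lam * (sampled_excess L k n (N (j - 1)) - sampled_excess L k n (N j)) - real k * (U j - U (Suc j)))
        + 1 / e * (lam * (real k)\<^sup>2 + real k) / real n \<le> (\<bar>\<alpha> (j - 1)\<bar> - \<bar>\<alpha> j\<bar>) - real k * (\<bar>d j\<bar> - \<bar>d (Suc j)\<bar>) + R"
        unfolding inner R_def by (simp add: algebra_simps)
    qed
    also have "\<dots> = (\<Sum>j=m..J. \<bar>\<alpha> (j - 1)\<bar> - \<bar>\<alpha> j\<bar>) - real k * (\<Sum>j=m..J. \<bar>d j\<bar> - \<bar>d (Suc j)\<bar>) + real (Suc J - m) * R"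
      by (simp only: sum.distrib sum_subtractf sum_distrib_left sum_constant card_atLeastAtMost right_diff_distrib)
    also have "\<dots> = \<bar>\<alpha> (m - 1)\<bar> - \<bar>\<alpha> J\<bar> - real k * (\<bar>d m\<bar> - \<bar>d (Suc J)\<bar>) + real (Suc J - m) * R"
      unfolding sum_pred_diff[OF m J, of "\<lambda>j. \<bar>\<alpha> j\<bar>"] sum_diff_Suc[OF J, of "\<lambda>j. \<bar>d j\<bar>"] ..
    also have "\<dots> \<le> lam * K * \<bar>d (m - 1)\<bar> - real k * \<bar>d m\<bar> + real k * \<bar>d (Suc J)\<bar> + real (Suc J) * R"
    proof -
      have "real (Suc J - m) * R \<le> real (Suc J) * R" using R0 by (intro mult_right_mono) auto
      then show ?thesis using \<alpha>_le[of "m - 1"] abs_ge_zero[of "\<alpha> J"]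
        unfolding right_diff_distrib by linarith
    qed
    finally show ?thesis by (simp add: d_def U_def)
  qed
  let ?D = "\<lambda>j. measure_pmf.expectation \<nu> (\<lambda>r. \<bar>tail_occ r j - w j\<bar>)"
  have "0 = measure_pmf.expectation \<nu> (occ_generator L k lam n g)"
    using generator_stationary(2)[OF bg] by simp
  also have "\<dots> \<le> measure_pmf.expectation \<nu> (\<lambda>r. lam * K * \<bar>tail_occ r (m - 1) - w (m - 1)\<bar> - real k * \<bar>tail_occ r m - w m\<bar> +
      real k * \<bar>tail_occ r (Suc J) - w (Suc J)\<bar> + real (Suc J) * R)"
    using generator_stationary(1)[OF bg] le set_nu
    by (intro integral_mono_AE) (auto simp: AE_measure_pmf_iff integrable_abs_dev)
  also have "\<dots> = lam * K * ?D (m - 1) - real k * ?D m + real k * ?D (Suc J) + real (Suc J) * R"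
    by (simp add: integrable_abs_dev)
  finally have main: "real k * ?D m \<le> lam * K * ?D (m - 1) + real k * ?D (Suc J) + real (Suc J) * R" by simp
  \<comment> \<open>Beyond the cut, the mean tail and the fixed point are each at most
    \<open>lam ^ Suc J\<close>, whatever \<open>n\<close> is.\<close>
  have "?D (Suc J) \<le> measure_pmf.expectation \<nu> (\<lambda>r. tail_occ r (Suc J) + w (Suc J))"
    using set_nu tail_occ_nonneg w[of "Suc J"]
    by (intro integral_mono_AE) (auto simp: AE_measure_pmf_iff integrable_abs_dev integrable_tail_occ abs_le_iff subset_eq add_nonneg_nonneg)
  also have "\<dots> = measure_pmf.expectation \<nu> (\<lambda>r. tail_occ r (Suc J)) + w (Suc J)"
    by (simp add: integrable_tail_occ)
  also have "\<dots> \<le> 2 * lam ^ Suc J" using mean_tail_le[of "Suc J"] w(3)[of "Suc J"] by linarith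
  finally have "real k * ?D (Suc J) \<le> real k * (2 * lam ^ Suc J)" by (rule mult_left_mono) simp
  then show ?thesis using main unfolding R_def \<delta>_def w_def by simp
qed

end

text \<open>The order of choices matters: first \<open>J\<close>, to make the geometric term small
  for all \<open>n\<close> at once, then \<open>n\<close>, with \<open>Suc J\<close> a constant in
  front of \<open>\<eta> n\<close>. As level 0 has no deviation, the size of \<open>c\<close> is
  irrelevant.\<close>

lemma deviations_tendsto_0:
  fixes D :: "nat \<Rightarrow> nat \<Rightarrow> real"
  assumes "0 < k" "0 < lam" "lam < 1"
    and nonneg: "\<And>n m. 0 \<le> D n m" and D0: "\<And>n. n \<ge> N \<Longrightarrow> D n 0 = 0" and \<eta>: "\<eta> \<longlonglongrightarrow> 0"
    and step: "\<And>n m J. n \<ge> N \<Longrightarrow> 1 \<le> m \<Longrightarrow> m \<le> J \<Longrightarrow>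
      k * D n m \<le> c * D n (m - 1) + 2 * k * lam ^ Suc J + real (Suc J) * \<eta> n"
  shows "(\<lambda>n. D n m) \<longlonglongrightarrow> 0"
proof (induction m)
  case 0
  show ?case by (rule tendsto_eventually) (use D0 in \<open>auto simp: eventually_sequentially\<close>)
next
  case (Suc m)
  show ?case
  proof (rule decreasing_tendsto)
    fix e :: real assume e: "0 < e"
    have lim: "(\<lambda>J. 2 * k * lam ^ Suc J) \<longlonglongrightarrow> 2 * k * 0"
      using assms by (intro tendsto_mult_left LIMSEQ_Suc LIMSEQ_realpow_zero) auto
    have "\<forall>\<^sub>F J in sequentially. 2 * k * lam ^ Suc J < k * e / 2"
      by (rule order_tendstoD(2)[OF lim]) (use e assms(1) in simp)
    then have "\<forall>\<^sub>F J in sequentially. 2 * k * lam ^ Suc J < k * e / 2 \<and> Suc m \<le> J"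
      using eventually_ge_at_top[of "Suc m"] by eventually_elim auto
    then obtain J where J: "2 * k * lam ^ Suc J < k * e / 2" "Suc m \<le> J"
      by (auto simp: eventually_sequentially)
    have "(\<lambda>n. c * D n m + real (Suc J) * \<eta> n) \<longlonglongrightarrow> c * 0 + real (Suc J) * 0"
      by (intro tendsto_intros Suc \<eta>)
    then have "\<forall>\<^sub>F n in sequentially. c * D n m + real (Suc J) * \<eta> n < k * e / 2"
      using e assms(1) by (intro order_tendstoD(2)) auto
    then show "\<forall>\<^sub>F n in sequentially. D n (Suc m) < e"
      using eventually_ge_at_top[of N]
    proof eventually_elim
      case (elim n)
      have "k * D n (Suc m) < k * e"
        using step[OF elim(2) _ J(2)] elim(1) J(1) by simp
      then show ?case using assms(1) by simp
    qed
  qed (use nonneg in auto)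
qed

text \<open>Invariance is stated for a measure on tail sequences, while drifts act on occupancy
  states. Tested on singletons \<open>{tail_occ x}\<close>, and with \<open>tail_occ\<close>
  injective on \<open>occ_states n\<close>, it makes the initial law itself stationary.\<close>

lemma invariant_tail_distribution_obtain:
  assumes sg: "transition_semigroup (occ_states n) A P" and inv: "invariant_tail_distribution n P \<mu>"
    and n: "n > 0"
  obtains \<nu> where "set_pmf \<nu> \<subseteq> occ_states n" "\<And>t. t \<ge> 0 \<Longrightarrow> bind_pmf \<nu> (P t) = \<nu>"
    "\<And>h :: _ \<Rightarrow> real. h \<in> borel_measurable Ubar_borel \<Longrightarrow>
      (\<integral>u. h u \<partial>\<mu>) = measure_pmf.expectation \<nu> (\<lambda>r. h (tail_occ r))"
proof -
  let ?S = "occ_states n"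
  obtain \<nu> where \<nu>: "set_pmf \<nu> \<subseteq> ?S" and eq: "\<And>t B. t \<ge> 0 \<Longrightarrow> B \<in> sets Ubar_borel \<Longrightarrow>
      emeasure \<mu> B = emeasure (measure_pmf (bind_pmf \<nu> (P t))) {r. tail_occ r \<in> B}"
    and sets: "sets \<mu> = sets Ubar_borel"
    using inv by (auto simp: invariant_tail_distribution_def)
  have P0: "bind_pmf \<nu> (P 0) = \<nu>"
  proof -
    have "bind_pmf \<nu> (P 0) = bind_pmf \<nu> return_pmf"
      using sg \<nu> by (intro bind_pmf_cong) (auto simp: transition_semigroup_def)
    then show ?thesis by (simp add: bind_return_pmf')
  qed
  have supp: "set_pmf (bind_pmf \<nu> (P t)) \<subseteq> ?S" if "t \<ge> 0" for t
    using sg \<nu> that unfolding transition_semigroup_def set_bind_pmf by blast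
  have stat: "bind_pmf \<nu> (P t) = \<nu>" if t: "t \<ge> 0" for t
  proof (rule pmf_eqI)
    fix x show "pmf (bind_pmf \<nu> (P t)) x = pmf \<nu> x"
    proof (cases "x \<in> ?S")
      case True
      have single: "emeasure (measure_pmf p) {r. tail_occ r \<in> {tail_occ x}} = ennreal (pmf p x)" if "set_pmf p \<subseteq> ?S" for p
      proof -
        have "emeasure (measure_pmf p) {r. tail_occ r \<in> {tail_occ x}} = emeasure (measure_pmf p) {x}"
          using that True tail_occ_inj by (intro emeasure_eq_AE) (auto simp: AE_measure_pmf_iff)
        then show ?thesis by (simp add: emeasure_pmf_single)
      qed
      have "{tail_occ x} \<in> sets Ubar_borel"
        using tail_occ_Ubar[OF True] unfolding Ubar_borel_def sets_restrict_space
        by (intro image_eqI[of _ _ "{tail_occ x}"]) (auto intro: borel_closed)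
      from eq[OF t this] eq[OF order_refl this] show ?thesis
        using single[OF supp[OF t]] single[OF \<nu>] by (simp add: P0)
    next
      case False
      then have "x \<notin> set_pmf (bind_pmf \<nu> (P t))" "x \<notin> set_pmf \<nu>" using supp[OF t] \<nu> by auto
      then show ?thesis by (simp add: set_pmf_iff del: set_bind_pmf)
    qed
  qed
  have "(\<integral>u. h u \<partial>\<mu>) = measure_pmf.expectation \<nu> (\<lambda>r. h (tail_occ r))"
    if h: "h \<in> borel_measurable Ubar_borel" for h :: "_ \<Rightarrow> real"
  proof -
    obtain r0 where "r0 \<in> ?S" using \<nu> set_pmf_not_empty[of \<nu>] by blast
    \<comment> \<open>\<open>tail_occ\<close> is known to land in \<open>Ubar\<close> only on
      \<open>occ_states n\<close>; sending all other points to \<open>r0\<close> gives a measurable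
      map without changing it almost surely.\<close>
    define T where "T r = tail_occ (if r \<in> ?S then r else r0)" for r
    have T: "T \<in> measurable (measure_pmf \<nu>) Ubar_borel"
      using tail_occ_Ubar \<open>r0 \<in> ?S\<close> by (auto simp: T_def Ubar_borel_def space_restrict_space)
    have "\<mu> = distr (measure_pmf \<nu>) Ubar_borel T"
    proof (rule measure_eqI)
      fix B assume "B \<in> sets \<mu>"
      then have B: "B \<in> sets Ubar_borel" by (simp add: sets)
      have "emeasure \<mu> B = emeasure (measure_pmf \<nu>) {r. tail_occ r \<in> B}"
        using eq[OF order_refl B] by (simp add: P0)
      also have "\<dots> = emeasure (measure_pmf \<nu>) (T -` B)"
        using \<nu> by (intro emeasure_eq_AE) (auto simp: AE_measure_pmf_iff T_def)
      finally show "emeasure \<mu> B = emeasure (distr (measure_pmf \<nu>) Ubar_borel T) B"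
        using T B by (simp add: emeasure_distr)
    qed (simp add: sets)
    then have "(\<integral>u. h u \<partial>\<mu>) = measure_pmf.expectation \<nu> (\<lambda>r. h (T r))"
      using T h by (simp add: integral_distr)
    also have "\<dots> = measure_pmf.expectation \<nu> (\<lambda>r. h (tail_occ r))"
      using \<nu> by (intro integral_cong_AE) (auto simp: AE_measure_pmf_iff T_def)
    finally show ?thesis .
  qed
  then show ?thesis using that \<nu> stat by blast
qed

lemma countable_occ_states:
  assumes "n > 0"
  shows "countable (occ_states n)"
proof (rule countable_subset)
  show "occ_states n \<subseteq> range (\<lambda>xs. occ n (nth xs))"
  proof
    fix r assume "r \<in> occ_states n"
    then obtain q where "r = occ n q" using occ_states_obtain_lengths[OF _ assms] by blast
    also have "\<dots> = occ n (nth (map q [0..<n]))" by (auto simp: occ_def fun_eq_iff intro!: sum.cong)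
    finally show "r \<in> range (\<lambda>xs. occ n (nth xs))" by blast
  qed
qed simp

text \<open>The Markov property from time 0, with the whole space as past event, gives the point
  masses of the law of \<open>X t\<close>; countability of \<open>S\<close> extends this to the
  whole law.\<close>

lemma markov_process_expectation:
  fixes h :: "'s \<Rightarrow> real"
  assumes mp: "markov_process M S P X" and cS: "countable S"
    and X0: "\<And>\<omega>. \<omega> \<in> space M \<Longrightarrow> X 0 \<omega> = x0" and x0: "x0 \<in> S" and t: "t \<ge> 0"
    and supp: "set_pmf (P t x0) \<subseteq> S"
  shows "(\<integral>\<omega>. h (X t \<omega>) \<partial>M) = measure_pmf.expectation (P t x0) h"
proof -
  have ps: "prob_space M" and Xt: "X t \<in> measurable M (count_space S)"
    using mp t by (auto simp: markov_process_def)
  interpret prob_space M by (rule ps)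
  have "space M \<in> past_events M S X 0"
    unfolding past_events_def by (rule sigma_sets_top)
  then have law: "measure M {\<omega> \<in> space M. X 0 \<omega> = x \<and> X (0 + t) \<omega> = y} =
      measure M {\<omega> \<in> space M. X 0 \<omega> = x} * pmf (P t x) y" if "x \<in> S" "y \<in> S" for x y
    using mp t that unfolding markov_process_def by blast
  have meas: "measure M {\<omega> \<in> space M. X t \<omega> = y} = pmf (P t x0) y" if "y \<in> S" for y
  proof -
    have "{\<omega> \<in> space M. X 0 \<omega> = x0 \<and> X (0 + t) \<omega> = y} = {\<omega> \<in> space M. X t \<omega> = y}"
      "{\<omega> \<in> space M. X 0 \<omega> = x0} = space M" using X0 by auto
    then show ?thesis using law[OF x0 that] by (simp add: prob_space)
  qed
  define T where "T y = (if y \<in> S then y else x0)" for y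
  have T: "T \<in> measurable (measure_pmf (P t x0)) (count_space S)"
    using x0 by (auto simp: T_def)
  have "distr M (count_space S) (X t) = distr (measure_pmf (P t x0)) (count_space S) T"
  proof (rule measure_eqI_countable[OF _ _ cS])
    fix y assume y: "y \<in> S"
    have "emeasure (distr M (count_space S) (X t)) {y} = emeasure M {\<omega> \<in> space M. X t \<omega> = y}"
      using Xt y by (simp add: emeasure_distr vimage_def Int_def conj_commute)
    also have "\<dots> = ennreal (pmf (P t x0) y)" using meas[OF y] by (simp add: emeasure_eq_measure)
    also have "\<dots> = emeasure (measure_pmf (P t x0)) (T -` {y})"
      unfolding emeasure_pmf_single[symmetric] using supp y
      by (intro emeasure_eq_AE) (auto simp: AE_measure_pmf_iff T_def)
    also have "\<dots> = emeasure (distr (measure_pmf (P t x0)) (count_space S) T) {y}"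
      using T y by (simp add: emeasure_distr)
    finally show "emeasure (distr M (count_space S) (X t)) {y} =
      emeasure (distr (measure_pmf (P t x0)) (count_space S) T) {y}" .
  qed auto
  then have "(\<integral>y. h y \<partial>distr M (count_space S) (X t)) = (\<integral>y. h y \<partial>distr (measure_pmf (P t x0)) (count_space S) T)"
    by simp
  then have "(\<integral>\<omega>. h (X t \<omega>) \<partial>M) = (\<integral>y. h (T y) \<partial>measure_pmf (P t x0))"
    using Xt T by (simp add: integral_distr)
  also have "\<dots> = measure_pmf.expectation (P t x0) h"
    using supp by (intro integral_cong_AE) (auto simp: AE_measure_pmf_iff T_def)
  finally show ?thesis .
qed

section \<open>Weak convergence from coordinatewise deviations\<close>

lemma rho_dist_le:
  assumes x: "x \<in> Ubar" and y: "y \<in> Ubar"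
  shows "rho_dist x y \<le> (\<Sum>j<J. \<bar>x (Suc j) - y (Suc j)\<bar>) + (1/2) ^ J"
proof -
  let ?a = "\<lambda>j. (1/2) ^ Suc j * \<bar>x (Suc j) - y (Suc j)\<bar>"
  have sa: "summable ?a" by (rule rho_dist_summable[OF x y])
  have "rho_dist x y = (\<Sum>j. ?a (j + J)) + (\<Sum>j<J. ?a j)"
    unfolding rho_dist_def by (rule suminf_split_initial_segment[OF sa])
  moreover have "(\<Sum>j<J. ?a j) \<le> (\<Sum>j<J. \<bar>x (Suc j) - y (Suc j)\<bar>)"
    by (intro sum_mono mult_left_le_one_le power_le_one) auto
  moreover have "(\<Sum>j. ?a (j + J)) \<le> (\<Sum>j. (1/2) ^ Suc (j + J))"
  proof (rule suminf_le)
    show "?a (j + J) \<le> (1/2) ^ Suc (j + J)" for j by (rule Ubar_diff_le[OF x y])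
    show "summable (\<lambda>j. ?a (j + J))" using sa summable_iff_shift[of ?a J] by blast
    show "summable (\<lambda>j. (1/2::real) ^ Suc (j + J))"
      using summable_half summable_iff_shift[of "\<lambda>j. (1/2::real) ^ Suc j" J] by blast
  qed
  moreover have "(\<Sum>j. (1/2::real) ^ Suc (j + J)) = (1/2) ^ J"
  proof -
    have "(\<lambda>j. (1/2::real) ^ J * (1/2) ^ Suc j) sums ((1/2) ^ J * 1)"
      using power_half_series by (intro sums_mult) simp
    then show ?thesis by (simp add: sums_iff power_add mult_ac)
  qed
  ultimately show ?thesis by linarith
qed

text \<open>Near \<open>w\<close>, continuity makes \<open>h u - h w\<close> small; elsewhere it is
  at most \<open>2 * B\<close>, which a pointwise form of Markov's inequality charges to the
  deviations of the first \<open>J\<close> coordinates. One bound covers both cases and is then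
  integrated.\<close>

lemma weak_limit_of_deviations:
  fixes p :: "nat \<Rightarrow> 's pmf" and T :: "'s \<Rightarrow> nat \<Rightarrow> real"
  assumes T: "\<And>n r. n \<ge> N \<Longrightarrow> r \<in> set_pmf (p n) \<Longrightarrow> T r \<in> Ubar" and w: "w \<in> Ubar"
    and dev: "\<And>m. (\<lambda>n. measure_pmf.expectation (p n) (\<lambda>r. \<bar>T r m - w m\<bar>)) \<longlonglongrightarrow> 0"
    and h: "continuous_on Ubar h" "bounded (h ` Ubar)"
  shows "(\<lambda>n. measure_pmf.expectation (p n) (\<lambda>r. h (T r))) \<longlonglongrightarrow> (h w :: real)"
proof (rule LIMSEQ_I)
  fix e :: real assume e: "0 < e"
  obtain B where B: "\<And>u. u \<in> Ubar \<Longrightarrow> \<bar>h u\<bar> \<le> B" using h(2) by (auto simp: bounded_iff)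
  have B0: "0 \<le> B" using B[OF w] by simp
  have "openin (top_of_set Ubar) (Ubar \<inter> h -` {h w - e / 2 <..< h w + e / 2})"
    by (rule continuous_openin_preimage_gen[OF h(1)]) simp
  moreover have "w \<in> Ubar \<inter> h -` {h w - e / 2 <..< h w + e / 2}" using w e by auto
  ultimately obtain d where d: "d > 0"
    and near': "\<forall>u\<in>Ubar. rho_dist w u < d \<longrightarrow> u \<in> Ubar \<inter> h -` {h w - e / 2 <..< h w + e / 2}"
    unfolding openin_Ubar_iff_rho_dist by blast
  have near: "\<bar>h u - h w\<bar> < e / 2" if "u \<in> Ubar" "rho_dist w u < d" for u
    using near'[rule_format, OF that] unfolding abs_less_iff by auto
  \<comment> \<open>The geometric tail of the metric gets half of the radius \<open>d\<close>, the
    first \<open>J\<close> coordinates the other half; hence the factor \<open>2 / d\<close>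
    below.\<close>
  obtain J where J: "(1/2::real) ^ J < d / 2"
    using real_arch_pow_inv[of "d / 2" "1/2"] d by auto
  have bound: "\<bar>h u - h w\<bar> \<le> e / 2 + 2 * B * (2 / d) * (\<Sum>j<J. \<bar>u (Suc j) - w (Suc j)\<bar>)" (is "_ \<le> _ + ?c * ?s u") if u: "u \<in> Ubar" for u
  proof (cases "?s u < d / 2")
    case True
    have "rho_dist w u \<le> ?s u + (1/2) ^ J"
      using rho_dist_le[OF w u, of J] by (simp add: abs_minus_commute)
    then have "\<bar>h u - h w\<bar> < e / 2" using True J by (intro near u) simp
    moreover have "0 \<le> ?c * ?s u" using B0 d by (intro mult_nonneg_nonneg sum_nonneg) auto
    ultimately show ?thesis by linarith
  next
    case False
    then have "1 \<le> 2 / d * ?s u" using d by (simp add: field_simps)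
    then have "2 * B * 1 \<le> 2 * B * (2 / d * ?s u)" using B0 by (intro mult_left_mono) auto
    moreover have "\<bar>h u - h w\<bar> \<le> 2 * B" using B[OF u] B[OF w] by linarith
    ultimately show ?thesis using e by (simp add: mult.assoc)
  qed
  define c where "c = 2 * B * (2 / d)"
  have "(\<lambda>n. c * (\<Sum>j<J. measure_pmf.expectation (p n) (\<lambda>r. \<bar>T r (Suc j) - w (Suc j)\<bar>))) \<longlonglongrightarrow> c * (\<Sum>j<J. 0)"
    by (intro tendsto_intros dev)
  then have "\<forall>\<^sub>F n in sequentially. c * (\<Sum>j<J. measure_pmf.expectation (p n) (\<lambda>r. \<bar>T r (Suc j) - w (Suc j)\<bar>)) < e / 2"
    using e by (intro order_tendstoD(2)) auto
  then have "\<forall>\<^sub>F n in sequentially. norm (measure_pmf.expectation (p n) (\<lambda>r. h (T r)) - h w) < e"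
    using eventually_ge_at_top[of N]
  proof eventually_elim
    case (elim n)
    have Tn: "T r \<in> Ubar" if "r \<in> set_pmf (p n)" for r using T[OF elim(2) that] .
    have ih: "integrable (measure_pmf (p n)) (\<lambda>r. h (T r))"
      by (rule measure_pmf.integrable_const_bound[where B=B]) (use B Tn in \<open>auto simp: AE_measure_pmf_iff\<close>)
    have id: "integrable (measure_pmf (p n)) (\<lambda>r. \<bar>T r j - w j\<bar>)" for j
    proof (rule measure_pmf.integrable_const_bound[where B=1])
      have "\<bar>T r j - w j\<bar> \<le> 1" if "r \<in> set_pmf (p n)" for r
        using Ubar_le_1[OF Tn[OF that], of j] Ubar_nonneg[OF Tn[OF that], of j] Ubar_le_1[OF w, of j] Ubar_nonneg[OF w, of j]
        by linarith
      then show "AE r in measure_pmf (p n). norm \<bar>T r j - w j\<bar> \<le> 1" by (simp add: AE_measure_pmf_iff)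
    qed simp
    have "\<bar>measure_pmf.expectation (p n) (\<lambda>r. h (T r)) - h w\<bar> = \<bar>\<integral>r. h (T r) - h w \<partial>measure_pmf (p n)\<bar>"
      using ih by simp
    also have "\<dots> \<le> (\<integral>r. \<bar>h (T r) - h w\<bar> \<partial>measure_pmf (p n))" by (rule integral_abs_bound)
    also have "\<dots> \<le> (\<integral>r. e / 2 + c * (\<Sum>j<J. \<bar>T r (Suc j) - w (Suc j)\<bar>) \<partial>measure_pmf (p n))"
      using ih id bound Tn by (intro integral_mono_AE) (auto simp: AE_measure_pmf_iff c_def)
    also have "\<dots> = e / 2 + c * (\<Sum>j<J. measure_pmf.expectation (p n) (\<lambda>r. \<bar>T r (Suc j) - w (Suc j)\<bar>))"
      using id by simp
    also have "\<dots> < e" using elim(1) by simp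
    finally show ?case by simp
  qed
  then show "\<exists>no. \<forall>n\<ge>no. norm (measure_pmf.expectation (p n) (\<lambda>r. h (T r)) - h w) < e"
    by (simp add: eventually_sequentially)
qed

lemma stationary_deviation_tendsto_0:
  assumes k: "1 \<le> k" and kL: "k < L" and lam: "0 < lam" "lam < 1"
    and stat: "\<And>n. L \<le> n \<Longrightarrow> stationary_batch_sampling L k n lam (P n) (\<nu> n)"
  shows "(\<lambda>n. measure_pmf.expectation (\<nu> n) (\<lambda>r. \<bar>tail_occ r m - ubar L k lam m\<bar>)) \<longlonglongrightarrow> 0"
proof -
  define D where "D n m = measure_pmf.expectation (\<nu> n) (\<lambda>r. \<bar>tail_occ r m - ubar L k lam m\<bar>)" for n m
  obtain K where K: "0 \<le> K" and lip: "\<And>x y. 0 \<le> x \<Longrightarrow> x \<le> 1 \<Longrightarrow> 0 \<le> y \<Longrightarrow> y \<le> 1 \<Longrightarrow>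
      \<bar>f_fun L k x - f_fun L k y\<bar> \<le> K * \<bar>x - y\<bar>"
    using f_fun_lipschitz[of L k] by blast
  \<comment> \<open>The choice \<open>e = 1 / sqrt n\<close> balances the two smoothing errors of
    \<open>mean_dev_step\<close>: the bias of order \<open>e\<close> and the curvature term of order
    \<open>1 / (e * n)\<close>.\<close>
  define \<eta> where "\<eta> n = 2 * lam * excess_error L k n + (lam * K + real k) * (1 / sqrt (real n)) +
    (lam * (real k)\<^sup>2 + real k) * (1 / sqrt (real n))" for n
  have sq: "(\<lambda>n. 1 / sqrt (real n)) \<longlonglongrightarrow> 0"
    using tendsto_real_sqrt[OF lim_1_over_n[where 'a=real]] by (simp add: real_sqrt_divide)
  have "\<eta> \<longlonglongrightarrow> 2 * lam * 0 + (lam * K + real k) * 0 + (lam * (real k)\<^sup>2 + real k) * 0"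
    unfolding \<eta>_def by (intro tendsto_intros excess_error_tendsto sq)
  then have \<eta>: "\<eta> \<longlonglongrightarrow> 0" by simp
  have "(\<lambda>n. D n m) \<longlonglongrightarrow> 0"
  proof (rule deviations_tendsto_0[where k="real k" and c="lam * K" and lam=lam and N="2 * L" and \<eta>=\<eta>])
    show "D n 0 = 0" if "n \<ge> 2 * L" for n
    proof -
      interpret stationary_batch_sampling L k n lam "P n" "\<nu> n" by (rule stat) (use that in simp)
      have "D n 0 = measure_pmf.expectation (\<nu> n) (\<lambda>_. 0)"
        unfolding D_def using set_nu by (intro integral_cong_AE) (auto simp: AE_measure_pmf_iff tail_occ_0 subset_eq)
      then show ?thesis by simp
    qed
    show "real k * D n m \<le> lam * K * D n (m - 1) + 2 * real k * lam ^ Suc J + real (Suc J) * \<eta> n"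
      if n: "n \<ge> 2 * L" and m: "1 \<le> m" "m \<le> J" for n m J
    proof -
      interpret stationary_batch_sampling L k n lam "P n" "\<nu> n" by (rule stat) (use n in simp)
      have s: "1 / sqrt (real n) > 0" using n0 by simp
      have "1 / (1 / sqrt (real n)) * (lam * (real k)\<^sup>2 + real k) / real n = (lam * (real k)\<^sup>2 + real k) * (sqrt (real n) / real n)"
        by simp
      also have "sqrt (real n) / real n = 1 / sqrt (real n)"
        by (simp add: real_divide_square_eq sqrt_divide_self_eq inverse_eq_divide)
      finally show ?thesis
        using mean_dev_step[OF m n K s lip] unfolding D_def \<eta>_def by simp
    qed
    show "0 \<le> D n m" for n m unfolding D_def by simp
  qed (use k lam \<eta> in auto)
  then show ?thesis by (simp add: D_def)
qed

theorem theorem2p4: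
  fixes L k :: nat and lam :: real
    and P :: "nat \<Rightarrow> real \<Rightarrow> (nat \<Rightarrow> real) \<Rightarrow> (nat \<Rightarrow> real) pmf"
    and M :: "nat \<Rightarrow> 'w measure"
    and \<pi> :: "nat \<Rightarrow> real \<Rightarrow> 'w \<Rightarrow> nat \<Rightarrow> real"
    and r\<^sub>0 :: "nat \<Rightarrow> nat \<Rightarrow> real"
    and u :: "nat \<Rightarrow> real \<Rightarrow> 'w \<Rightarrow> nat \<Rightarrow> real"
    and Linv :: "nat \<Rightarrow> (nat \<Rightarrow> real) measure"
  assumes "1 \<le> k" and "k < L" and "0 < lam" and "lam < 1"
    and "\<And>n. L \<le> n \<Longrightarrow> transition_semigroup (occ_states n) (occ_generator L k lam n) (P n)"
    and "\<And>n. L \<le> n \<Longrightarrow> markov_process (M n) (occ_states n) (P n) (\<pi> n)"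
    and "\<And>n \<omega>. L \<le> n \<Longrightarrow> \<omega> \<in> space (M n) \<Longrightarrow> \<pi> n 0 \<omega> = r\<^sub>0 n"
    and "\<And>n t \<omega>. u n t \<omega> = tail_occ (\<pi> n t \<omega>)"
    and "\<And>n. L \<le> n \<Longrightarrow> invariant_tail_distribution n (P n) (Linv n)"
  shows "weakly_converges_Ubar Linv (return Ubar_borel (ubar L k lam)) \<and>
         (\<exists>v :: nat \<Rightarrow> nat \<Rightarrow> real.
           (\<forall>n\<ge>L. \<forall>i. ((\<lambda>t. \<integral>\<omega>. u n t \<omega> i \<partial>M n) \<longlongrightarrow> v n i) at_top) \<and>
           (\<forall>i. (\<lambda>n. v n i) \<longlonglongrightarrow> ubar L k lam i))"
proof -
  note k = assms(1) and kL = assms(2) and lam = assms(3,4)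
  let ?w = "ubar L k lam"
  have "\<exists>\<nu>. set_pmf \<nu> \<subseteq> occ_states n \<and> (\<forall>t\<ge>0. bind_pmf \<nu> (P n t) = \<nu>) \<and>
      (\<forall>h :: _ \<Rightarrow> real. h \<in> borel_measurable Ubar_borel \<longrightarrow>
        (\<integral>u. h u \<partial>Linv n) = measure_pmf.expectation \<nu> (\<lambda>r. h (tail_occ r)))" if n: "L \<le> n" for n
  proof -
    have "n > 0" using n k kL by simp
    from invariant_tail_distribution_obtain[OF assms(5)[OF n] assms(9)[OF n] this] show ?thesis by metis
  qed
  then obtain \<nu> where \<nu>: "\<And>n. L \<le> n \<Longrightarrow> set_pmf (\<nu> n) \<subseteq> occ_states n"
    "\<And>n t. L \<le> n \<Longrightarrow> t \<ge> 0 \<Longrightarrow> bind_pmf (\<nu> n) (P n t) = \<nu> n"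
    "\<And>n h. L \<le> n \<Longrightarrow> h \<in> borel_measurable Ubar_borel \<Longrightarrow>
        (\<integral>u. h u \<partial>Linv n) = (measure_pmf.expectation (\<nu> n) (\<lambda>r. h (tail_occ r)) :: real)"
    by metis
  have stat: "stationary_batch_sampling L k n lam (P n) (\<nu> n)" if n: "L \<le> n" for n
    by unfold_locales (fact k kL n lam assms(5)[OF n] \<nu>(1)[OF n] \<nu>(2)[OF n])+
  note dev = stationary_deviation_tendsto_0[OF k kL lam stat]
  have w: "?w \<in> Ubar" by (rule ubar_in_Ubar[OF k kL lam])
  have tail_Ubar: "tail_occ r \<in> Ubar" if "L \<le> n" "r \<in> set_pmf (\<nu> n)" for n r
    using \<nu>(1)[OF that(1)] that(2) tail_occ_Ubar by blast
  note weak = weak_limit_of_deviations[where p=\<nu> and T=tail_occ, OF tail_Ubar w dev]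
  have "weakly_converges_Ubar Linv (return Ubar_borel ?w)"
    unfolding weakly_converges_Ubar_def
  proof (intro allI impI)
    fix h :: "(nat \<Rightarrow> real) \<Rightarrow> real" assume h: "continuous_on Ubar h \<and> bounded (h ` Ubar)"
    then have hm: "h \<in> borel_measurable Ubar_borel"
      unfolding Ubar_borel_def by (intro borel_measurable_continuous_on_restrict) simp
    have "(\<lambda>n. measure_pmf.expectation (\<nu> n) (\<lambda>r. h (tail_occ r))) \<longlonglongrightarrow> h ?w"
      using h by (intro weak) auto
    moreover have "\<forall>\<^sub>F n in sequentially. measure_pmf.expectation (\<nu> n) (\<lambda>r. h (tail_occ r)) = (\<integral>u. h u \<partial>Linv n)"
      using eventually_ge_at_top[of L] by eventually_elim (simp add: \<nu>(3)[OF _ hm])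
    ultimately have "(\<lambda>n. \<integral>u. h u \<partial>Linv n) \<longlonglongrightarrow> h ?w" by (rule Lim_transform_eventually)
    moreover have "(\<integral>u. h u \<partial>return Ubar_borel ?w) = h ?w"
      using w hm by (intro integral_return) (auto simp: Ubar_borel_def space_restrict_space)
    ultimately show "(\<lambda>n. \<integral>u. h u \<partial>Linv n) \<longlonglongrightarrow> (\<integral>u. h u \<partial>return Ubar_borel ?w)" by simp
  qed
  moreover have "((\<lambda>t. \<integral>\<omega>. u n t \<omega> i \<partial>M n) \<longlongrightarrow> measure_pmf.expectation (\<nu> n) (\<lambda>r. tail_occ r i)) at_top"
    if n: "L \<le> n" for n i
  proof -
    interpret stationary_batch_sampling L k n lam "P n" "\<nu> n" by (rule stat[OF n])
    have mp: "markov_process (M n) (occ_states n) (P n) (\<pi> n)" by (rule assms(6)[OF n])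
    then have "prob_space (M n)" "\<pi> n 0 \<in> measurable (M n) (count_space (occ_states n))"
      by (auto simp: markov_process_def)
    \<comment> \<open>The initial state is seen to lie in \<open>occ_states n\<close> because a
      probability space is nonempty and \<open>\<pi> n 0\<close> is measurable into
      \<open>count_space (occ_states n)\<close>.\<close>
    then obtain \<omega> where "\<omega> \<in> space (M n)" "\<pi> n 0 \<omega> \<in> occ_states n"
      using prob_space.not_empty measurable_space by (metis ex_in_conv space_count_space)
    then have r0: "r\<^sub>0 n \<in> occ_states n" using assms(7)[OF n] by simp
    have "bounded ((\<lambda>r. tail_occ r i) ` occ_states n)"
      using tail_occ_nonneg tail_occ_le_1 by (auto simp: bounded_iff intro!: exI[of _ 1])
    then have "((\<lambda>t. measure_pmf.expectation (P n t (r\<^sub>0 n)) (\<lambda>r. tail_occ r i)) \<longlongrightarrow>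
        measure_pmf.expectation (\<nu> n) (\<lambda>r. tail_occ r i)) at_top"
      using reach_eq r0 by (rule expectation_P_tendsto)
    then show ?thesis
    proof (rule Lim_transform_eventually)
      show "\<forall>\<^sub>F t in at_top. measure_pmf.expectation (P n t (r\<^sub>0 n)) (\<lambda>r. tail_occ r i) = (\<integral>\<omega>. u n t \<omega> i \<partial>M n)"
        using eventually_ge_at_top[of 0]
      proof eventually_elim
        case (elim t)
        show ?case
          using markov_process_expectation[OF mp countable_occ_states[OF n0] assms(7)[OF n] r0 elim set_P[OF r0 elim],
              of "\<lambda>r. tail_occ r i"]
          by (simp add: assms(8))
      qed
    qed
  qed
  \<comment> \<open>With the inner limit identified as a stationary mean, the outer limit is weak
    convergence tested on a coordinate, which is bounded and continuous on
    \<open>Ubar\<close>.\<close>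
  moreover have "(\<lambda>n. measure_pmf.expectation (\<nu> n) (\<lambda>r. tail_occ r i)) \<longlonglongrightarrow> ?w i" for i
  proof (rule weak[where h="\<lambda>u. u i"])
    show "continuous_on Ubar (\<lambda>u. u i)"
      by (rule continuous_on_subset[OF continuous_on_product_coordinates]) simp
    show "bounded ((\<lambda>u. u i) ` Ubar)"
      using Ubar_le_1 Ubar_nonneg by (auto simp: bounded_iff intro!: exI[of _ 1])
  qed
  ultimately show ?thesis
    by (intro conjI exI[of _ "\<lambda>n i. measure_pmf.expectation (\<nu> n) (\<lambda>r. tail_occ r i)"]) auto
qed

end
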